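(* Let $K$ be a field of characteristic zero and $\alpha\in\overline K^*$ with $\alpha^2\in K^*\setminus K^{*2}$. Let $\mathfrak g$ be a split simple Lie algebra over $K$ with a fixed pinning, let $r_{\mathrm{BD}}$ be a Belavin--Drinfeld $r$-matrix on $\mathfrak g$ with associated admissible quadruple $(\Gamma_1,\Gamma_2,\tau,r_{\mathfrak h})$, and let $\mathbf A_{\mathrm{BD}}=\mathbf{Aut}(\mathfrak g,\partial r_{\mathrm{BD}})$. Assume that the twisted cohomology set $\overline H^1_{\mathrm{Gal}}(K,\mathbf A_{\mathrm{BD}},\alpha)$ is non-empty, and let $\pi$ be any diagram automorphism of $\Gamma$ of order at most two satisfying $$\pi(\Gamma_1)=\Gamma_2,\quad\pi(\Gamma_2)=\Gamma_1,\quad\pi\tau\pi^{-1}=\tau^{-1},\quad(\widehat\pi\otimes\widehat\pi)(r_{\mathfrak h})=r_{\mathfrak h}^{21}.$$ Then the map $$\overline Z^1(K,\mathbf A_{\mathrm{BD}},\alpha)\to Z^1_{\mathrm{Gal}}(K,(\mathbf A_{\mathrm{BD}})_v)$$ sending the cocycle $(u_\gamma)$ to the cocycle $(\widehat u_\gamma)$ defined by $$\widehat u_\gamma=\begin{cases} u_\gamma & \text{if }\gamma\in\mathrm{Gal}(K(\alpha)), \\ {} u_\gamma\widehat\pi\chi & \text{if }\gamma(\alpha)=-\alpha, \end{cases}$$ induces an injective map $$\overline H^1_{\mathrm{Gal}}(K,\mathbf A_{\mathrm{BD}},\alpha)\to H^1_{\mathrm{Gal}}(K,(\mathbf A_{\mathrm{BD}})_v),$$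 where $v=v_\pi$ is the cocycle defined in the context.
   Context: $\overline K$ is an algebraic closure of $K$, $\mathrm{Gal}(F)=\mathrm{Gal}(\overline K/F)$; $\kappa$ is the flip of tensor factors and $s^{21}=\kappa(s)$; $x\wedge y=x\otimes y-y\otimes x$. Setup: $\mathfrak g=\mathrm{Lie}(\mathbf G)$, $\mathbf G$ split simple adjoint with pinning $(\mathbf H,\Gamma,(X_\alpha)_{\alpha\in\Gamma})$, $\mathfrak h=\mathrm{Lie}(\mathbf H)$, root system $\Delta\supset\Delta^+$ with base $\Gamma$. Fix a nondegenerate invariant symmetric bilinear form (from the split $\mathbb Q$-form); root vectors $X_\beta$ ($\beta\in\Delta$) extend the pinning, with $(X_\beta,X_{-\beta})=1$; the Casimir element is $\Omega=\Omega_{\mathfrak h}+\sum_{\beta\in\Delta}X_\beta\otimes X_{-\beta}$, $\Omega_{\mathfrak h}\in\mathfrak h\otimes\mathfrak h$. An admissible quadruple is $(\Gamma_1,\Gamma_2,\tau,r_{\mathfrak h})$ with $\Gamma_1,\Gamma_2\subset\Gamma$, $\tau:\Gamma_1\to\Gamma_2$ a bijective isometry such that for each $\beta\in\Gamma_1$ some $\tau^k(\beta)\notin\Gamma_1$ ($k>0$), and $r_{\mathfrak h}\in\mathfrak h\otimes\mathfrak h$ with $r_{\mathfrak h}+\kappa(r_{\mathfrak h})=\Omega_{\mathfrak h}$ and $(\tau(\beta)\otimes1+1\otimes\beta)(r_{\mathfrak h})=0$ for $\beta\in\Gamma_1$. With $\tau$ extended additively and root vectors chosen compatibly with $\tau$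 (the Lie algebra isomorphism $X_{\pm\beta}\mapsto X_{\pm\tau(\beta)}$, $\beta\in\Gamma_1$, between the subalgebras generated by these elements maps $X_\beta$ to $X_{\tau(\beta)}$ for all roots $\beta$ in the span of $\Gamma_1$), $$r_{\mathrm{BD}}=r_{\mathfrak h}+\sum_{\beta\in\Delta^+}X_\beta\otimes X_{-\beta}+\sum_{\beta\in\mathrm{Span}_{\mathbb Z}(\Gamma_1)^+,\,k>0}X_\beta\wedge X_{-\tau^k(\beta)},$$ the sum being over positive roots $\beta$ in the $\mathbb Z$-span of $\Gamma_1$ and $k>0$ with $\tau^k(\beta)$ defined. $\partial r(a)=(\mathrm{ad}_a\otimes1+1\otimes\mathrm{ad}_a)(r)$. $\mathbf A_{\mathrm{BD}}$ is the group scheme of Lie algebra automorphisms $\phi$ of $\mathfrak g$ commuting with $\delta=\partial r_{\mathrm{BD}}$ in the sense $(\phi\otimes\phi)\delta=\delta\phi$. $\widehat\pi$ is the automorphism of $\mathfrak g$ preserving $\mathfrak h$ with $\widehat\pi(X_\beta)=X_{\pi(\beta)}$ for $\beta\in\Gamma$; $\chi$ is the Chevalley automorphism of $\mathfrak g$, with $\chi(h)=-h$ on $\mathfrak h$ and $\chi(X_{\pm\beta})=-X_{\mp\beta}$ for $\beta\in\Gamma$. Twisted cohomology: $\overline Z^1(K,\mathbf A_{\mathrm{BD}},\alpha)$ is the set of $\mathrm{Gal}(K)$-cocycles $(u_\gamma)$ in $\mathbf{Aut}(\mathfrak g)(\overline K)$ (continuous, $u_{\gamma\eta}=u_\gamma{}^\gamma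 u_\eta$) with $(u_\gamma\otimes u_\gamma)(r_{\mathrm{BD}})=r_{\mathrm{BD}}$ if $\gamma\in\mathrm{Gal}(K(\alpha))$ and $=\kappa(r_{\mathrm{BD}})$ if $\gamma(\alpha)=-\alpha$; $\overline H^1_{\mathrm{Gal}}(K,\mathbf A_{\mathrm{BD}},\alpha)$ is its quotient by $(w_\gamma)\sim(u_\gamma)\iff\exists\rho\in\mathbf A_{\mathrm{BD}}(\overline K)\ \forall\gamma:\ w_\gamma=\rho^{-1}u_\gamma{}^\gamma\rho$. The cocycle $v=v_\pi:\mathrm{Gal}(K)\to\mathbf{Aut}(\mathbf A_{\mathrm{BD}})(\overline K)$ is: $v(\gamma)=\mathrm{Id}$ if $\gamma\in\mathrm{Gal}(K(\alpha))$, and $v(\gamma)(\rho)=\chi\widehat\pi\rho(\chi\widehat\pi)^{-1}$ if $\gamma(\alpha)=-\alpha$. $(\mathbf A_{\mathrm{BD}})_v$ is the corresponding twisted $K$-group: the $\mathrm{Gal}(K)$-action on $\overline K$-points defining $Z^1_{\mathrm{Gal}}(K,(\mathbf A_{\mathrm{BD}})_v)$ and $H^1_{\mathrm{Gal}}(K,(\mathbf A_{\mathrm{BD}})_v)$ is $\gamma\cdot\rho=v(\gamma)({}^\gamma\rho)$. *)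

theory Defs
  imports "HOL-Analysis.Analysis" "HOL-Algebra.Algebraic_Closure_Type"
begin

unbundle no fps_syntax

text \<open>
  A finite-dimensional space over a field is taken with a basis, as \<open>'a^'n\<close>. Then
  \<open>'a^('n \<times> 'n)\<close> is its tensor square, and the base change of \<open>'k^'n\<close> to the algebraic closure is
  \<open>'k alg_closure^'n\<close>, on which the Galois group acts coordinatewise. A Lie algebra is an arbitrary
  bracket on such a space.
\<close>

section \<open>Lie algebras\<close>

definition bilinear_map ::
  "('a::field \<Rightarrow> 'b::ab_group_add \<Rightarrow> 'b) \<Rightarrow> ('a^'n \<Rightarrow> 'a^'n \<Rightarrow> 'b) \<Rightarrow> bool" where
  "bilinear_map sc f \<longleftrightarrow>
     (\<forall>x. Vector_Spaces.linear (*s) sc (f x)) \<and> (\<forall>y. Vector_Spaces.linear (*s) sc (\<lambda>x. f x y))"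

definition lie_bracket :: "('a::field^'n \<Rightarrow> 'a^'n \<Rightarrow> 'a^'n) \<Rightarrow> bool" where
  "lie_bracket br \<longleftrightarrow> bilinear_map (*s) br \<and> (\<forall>x. br x x = 0) \<and>
     (\<forall>x y z. br x (br y z) + br y (br z x) + br z (br x y) = 0)"

definition lie_ideal :: "('a::field^'n \<Rightarrow> 'a^'n \<Rightarrow> 'a^'n) \<Rightarrow> ('a^'n) set \<Rightarrow> bool" where
  "lie_ideal br I \<longleftrightarrow> vec.subspace I \<and> (\<forall>x. \<forall>y\<in>I. br x y \<in> I)"

definition simple_lie :: "('a::field^'n \<Rightarrow> 'a^'n \<Rightarrow> 'a^'n) \<Rightarrow> bool" where
  "simple_lie br \<longleftrightarrow> lie_bracket br \<and> (\<exists>x y. br x y \<noteq> 0) \<and>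
     (\<forall>I. lie_ideal br I \<longrightarrow> I = {0} \<or> I = UNIV)"

definition lie_subalg :: "('a::field^'n \<Rightarrow> 'a^'n \<Rightarrow> 'a^'n) \<Rightarrow> ('a^'n) set \<Rightarrow> bool" where
  "lie_subalg br L \<longleftrightarrow> vec.subspace L \<and> (\<forall>x\<in>L. \<forall>y\<in>L. br x y \<in> L)"

definition lie_iso_between ::
  "('a::field^'n \<Rightarrow> 'a^'n \<Rightarrow> 'a^'n) \<Rightarrow> ('a^'n) set \<Rightarrow> ('a^'n) set \<Rightarrow> ('a^'n \<Rightarrow> 'a^'n) \<Rightarrow> bool" where
  "lie_iso_between br L M \<theta> \<longleftrightarrow> bij_betw \<theta> L M \<and>
     (\<forall>x\<in>L. \<forall>y\<in>L. \<theta> (x + y) = \<theta> x + \<theta> y) \<and> (\<forall>c. \<forall>x\<in>L. \<theta> (c *s x) = c *s \<theta> x) \<and>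
     (\<forall>x\<in>L. \<forall>y\<in>L. \<theta> (br x y) = br (\<theta> x) (\<theta> y))"

definition lie_aut :: "('a::field^'n \<Rightarrow> 'a^'n \<Rightarrow> 'a^'n) \<Rightarrow> ('a^'n \<Rightarrow> 'a^'n) set" where
  "lie_aut br = {\<phi>. Vector_Spaces.linear (*s) (*s) \<phi> \<and> bij \<phi> \<and> (\<forall>x y. \<phi> (br x y) = br (\<phi> x) (\<phi> y))}"

definition invariant_form ::
  "('a::field^'n \<Rightarrow> 'a^'n \<Rightarrow> 'a^'n) \<Rightarrow> ('a^'n \<Rightarrow> 'a^'n \<Rightarrow> 'a) \<Rightarrow> bool" where
  "invariant_form br B \<longleftrightarrow> bilinear_map (*) B \<and> (\<forall>x y. B x y = B y x) \<and>
     (\<forall>x y z. B (br x y) z = B x (br y z)) \<and> (\<forall>x. (\<forall>y. B x y = 0) \<longrightarrow> x = 0)"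

section \<open>The tensor square\<close>

definition tens :: "'a::field^'n \<Rightarrow> 'a^'n \<Rightarrow> 'a^('n \<times> 'n)" where
  "tens x y = (\<chi> p. x $ fst p * y $ snd p)"

definition wedge :: "'a::field^'n \<Rightarrow> 'a^'n \<Rightarrow> 'a^('n \<times> 'n)" where
  "wedge x y = tens x y - tens y x"

definition flip :: "'a::field^('n::finite \<times> 'n) \<Rightarrow> 'a^('n \<times> 'n)" where
  "flip T = (\<chi> p. T $ (snd p, fst p))"

text \<open>\<open>tmap f g\<close> is \<open>f \<otimes> g\<close>, and \<open>tcontr1 f\<close>, \<open>tcontr2 f\<close> are \<open>f \<otimes> 1\<close>, \<open>1 \<otimes> f\<close> for a linear
  form \<open>f\<close>.\<close>

definition tmap ::
  "('a::field^'n \<Rightarrow> 'a^'n) \<Rightarrow> ('a^'n \<Rightarrow> 'a^'n) \<Rightarrow> 'a^('n \<times> 'n) \<Rightarrow> 'a^('n \<times> 'n)" where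
  "tmap f g T = (\<Sum>i\<in>UNIV. \<Sum>j\<in>UNIV. T $ (i, j) *s tens (f (axis i 1)) (g (axis j 1)))"

definition tcontr1 :: "('a::field^'n \<Rightarrow> 'a) \<Rightarrow> 'a^('n \<times> 'n) \<Rightarrow> 'a^'n" where
  "tcontr1 f T = (\<Sum>i\<in>UNIV. \<Sum>j\<in>UNIV. (T $ (i, j) * f (axis i 1)) *s axis j 1)"

definition tcontr2 :: "('a::field^'n \<Rightarrow> 'a) \<Rightarrow> 'a^('n \<times> 'n) \<Rightarrow> 'a^'n" where
  "tcontr2 f T = (\<Sum>i\<in>UNIV. \<Sum>j\<in>UNIV. (T $ (i, j) * f (axis j 1)) *s axis i 1)"

definition tensor_square :: "('a::field^'n) set \<Rightarrow> ('a^('n \<times> 'n)) set" where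
  "tensor_square U = vec.span {tens x y | x y. x \<in> U \<and> y \<in> U}"

definition cobracket ::
  "('a::field^'n \<Rightarrow> 'a^'n \<Rightarrow> 'a^'n) \<Rightarrow> 'a^('n \<times> 'n) \<Rightarrow> 'a^'n \<Rightarrow> 'a^('n \<times> 'n)" where
  "cobracket br r a = tmap (br a) id r + tmap id (br a) r"

text \<open>The Casimir element is \<open>\<Sum>\<^sub>i e\<^sub>i \<otimes> e\<^sup>i\<close> for bases dual under \<open>B\<close>; its coordinates are the
  inverse Gram matrix.\<close>

definition casimir :: "('a::field^'n \<Rightarrow> 'a^'n \<Rightarrow> 'a) \<Rightarrow> 'a^('n \<times> 'n)" where
  "casimir B = (\<chi> p. matrix_inv (\<chi> i j. B (axis i 1) (axis j 1)) $ fst p $ snd p)"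

section \<open>Roots and pinnings\<close>

definition root_space ::
  "('a::field^'n \<Rightarrow> 'a^'n \<Rightarrow> 'a^'n) \<Rightarrow> ('a^'n) set \<Rightarrow> ('a^'n \<Rightarrow> 'a) \<Rightarrow> ('a^'n) set" where
  "root_space br h \<beta> = {x. \<forall>y\<in>h. br y x = \<beta> y *s x}"

text \<open>\<open>h\<close> is the Lie algebra of a split maximal torus: the algebra is the sum of the weight spaces
  of \<open>h\<close>, and \<open>h\<close> is its own centralizer.\<close>

definition split_cartan ::
  "('a::field^'n \<Rightarrow> 'a^'n \<Rightarrow> 'a^'n) \<Rightarrow> ('a^'n) set \<Rightarrow> bool" where
  "split_cartan br h \<longleftrightarrow> vec.subspace h \<and> root_space br h (\<lambda>y. 0) = h \<and>
     vec.span (\<Union>\<beta>. root_space br h \<beta>) = UNIV"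

text \<open>A linear form on \<open>h\<close> is represented by the function extending it by \<open>0\<close> outside \<open>h\<close>, so that
  equality of roots is equality of functions.\<close>

definition roots ::
  "('a::field^'n \<Rightarrow> 'a^'n \<Rightarrow> 'a^'n) \<Rightarrow> ('a^'n) set \<Rightarrow> ('a^'n \<Rightarrow> 'a) set" where
  "roots br h = {\<beta>. (\<forall>y. y \<notin> h \<longrightarrow> \<beta> y = 0) \<and> \<beta> \<noteq> (\<lambda>y. 0) \<and> root_space br h \<beta> \<noteq> {0}}"

definition zcomb :: "('b \<Rightarrow> int) \<Rightarrow> ('b \<Rightarrow> 'c \<Rightarrow> 'a::field) \<Rightarrow> 'b set \<Rightarrow> 'c \<Rightarrow> 'a" where
  "zcomb c f S = (\<lambda>y. \<Sum>s\<in>S. of_int (c s) * f s y)"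

definition root_base ::
  "('a::field^'n \<Rightarrow> 'a^'n \<Rightarrow> 'a^'n) \<Rightarrow> ('a^'n) set \<Rightarrow> ('a^'n \<Rightarrow> 'a) set \<Rightarrow> bool" where
  "root_base br h \<Gamma> \<longleftrightarrow> \<Gamma> \<subseteq> roots br h \<and>
     (\<forall>c :: _ \<Rightarrow> 'a. (\<forall>y\<in>h. (\<Sum>\<gamma>\<in>\<Gamma>. c \<gamma> * \<gamma> y) = 0) \<longrightarrow> (\<forall>\<gamma>\<in>\<Gamma>. c \<gamma> = 0)) \<and>
     (\<forall>\<beta>\<in>roots br h. \<exists>c. \<beta> = zcomb c id \<Gamma> \<and> ((\<forall>\<gamma>\<in>\<Gamma>. 0 \<le> c \<gamma>) \<or> (\<forall>\<gamma>\<in>\<Gamma>. c \<gamma> \<le> 0)))"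

definition pos_roots ::
  "('a::field^'n \<Rightarrow> 'a^'n \<Rightarrow> 'a^'n) \<Rightarrow> ('a^'n) set \<Rightarrow> ('a^'n \<Rightarrow> 'a) set \<Rightarrow> ('a^'n \<Rightarrow> 'a) set" where
  "pos_roots br h \<Gamma> = {\<beta> \<in> roots br h. \<exists>c. \<beta> = zcomb c id \<Gamma> \<and> (\<forall>\<gamma>\<in>\<Gamma>. 0 \<le> c \<gamma>)}"

definition zspan :: "('a^'n \<Rightarrow> 'a::field) set \<Rightarrow> ('a^'n \<Rightarrow> 'a) set" where
  "zspan S = {\<beta>. \<exists>c. \<beta> = zcomb c id S}"

text \<open>Only the values of \<open>Xr\<close> on the base are constrained by \<open>pinning\<close>; \<open>root_vectors\<close> concerns all
  roots.\<close>

definition pinning ::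
  "('a::field^'n \<Rightarrow> 'a^'n \<Rightarrow> 'a^'n) \<Rightarrow> ('a^'n) set \<Rightarrow> ('a^'n \<Rightarrow> 'a) set \<Rightarrow>
    (('a^'n \<Rightarrow> 'a) \<Rightarrow> 'a^'n) \<Rightarrow> bool" where
  "pinning br h \<Gamma> Xr \<longleftrightarrow> split_cartan br h \<and> root_base br h \<Gamma> \<and>
     (\<forall>\<gamma>\<in>\<Gamma>. Xr \<gamma> \<in> root_space br h \<gamma> \<and> Xr \<gamma> \<noteq> 0)"

definition root_vectors ::
  "('a::field^'n \<Rightarrow> 'a^'n \<Rightarrow> 'a^'n) \<Rightarrow> ('a^'n) set \<Rightarrow> ('a^'n \<Rightarrow> 'a^'n \<Rightarrow> 'a) \<Rightarrow>
    (('a^'n \<Rightarrow> 'a) \<Rightarrow> 'a^'n) \<Rightarrow> bool" where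
  "root_vectors br h B Xr \<longleftrightarrow>
     (\<forall>\<beta>\<in>roots br h. Xr \<beta> \<in> root_space br h \<beta> \<and> B (Xr \<beta>) (Xr (- \<beta>)) = 1)"

text \<open>The split \<open>\<rat>\<close>-form determined by a pinning is the \<open>\<rat>\<close>-Lie algebra generated by the
  Chevalley generators: the \<open>Xr \<gamma>\<close> and the \<open>f\<close> of weight \<open>- \<gamma>\<close> for which \<open>[Xr \<gamma>, f]\<close> is the coroot.\<close>

inductive_set split_Q_form ::
  "('a::field_char_0^'n \<Rightarrow> 'a^'n \<Rightarrow> 'a^'n) \<Rightarrow> ('a^'n) set \<Rightarrow> ('a^'n \<Rightarrow> 'a) set \<Rightarrow>
    (('a^'n \<Rightarrow> 'a) \<Rightarrow> 'a^'n) \<Rightarrow> ('a^'n) set"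
  for br h \<Gamma> Xr where
  pos: "\<gamma> \<in> \<Gamma> \<Longrightarrow> Xr \<gamma> \<in> split_Q_form br h \<Gamma> Xr"
| neg: "\<gamma> \<in> \<Gamma> \<Longrightarrow> f \<in> root_space br h (- \<gamma>) \<Longrightarrow> \<gamma> (br (Xr \<gamma>) f) = 2 \<Longrightarrow> f \<in> split_Q_form br h \<Gamma> Xr"
| add: "x \<in> split_Q_form br h \<Gamma> Xr \<Longrightarrow> y \<in> split_Q_form br h \<Gamma> Xr \<Longrightarrow> x + y \<in> split_Q_form br h \<Gamma> Xr"
| scale: "x \<in> split_Q_form br h \<Gamma> Xr \<Longrightarrow> of_rat q *s x \<in> split_Q_form br h \<Gamma> Xr"
| bracket: "x \<in> split_Q_form br h \<Gamma> Xr \<Longrightarrow> y \<in> split_Q_form br h \<Gamma> Xr \<Longrightarrow> br x y \<in> split_Q_form br h \<Gamma> Xr"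

definition form_from_Q ::
  "('a::field_char_0^'n \<Rightarrow> 'a^'n \<Rightarrow> 'a^'n) \<Rightarrow> ('a^'n) set \<Rightarrow> ('a^'n \<Rightarrow> 'a) set \<Rightarrow>
    (('a^'n \<Rightarrow> 'a) \<Rightarrow> 'a^'n) \<Rightarrow> ('a^'n \<Rightarrow> 'a^'n \<Rightarrow> 'a) \<Rightarrow> bool" where
  "form_from_Q br h \<Gamma> Xr B \<longleftrightarrow>
     (\<forall>x\<in>split_Q_form br h \<Gamma> Xr. \<forall>y\<in>split_Q_form br h \<Gamma> Xr. B x y \<in> \<rat>)"

text \<open>The form on the dual of \<open>h\<close> corresponding to the restriction of \<open>B\<close> to \<open>h\<close>.\<close>

definition dual_elt ::
  "('a::field^'n \<Rightarrow> 'a^'n \<Rightarrow> 'a) \<Rightarrow> ('a^'n) set \<Rightarrow> ('a^'n \<Rightarrow> 'a) \<Rightarrow> 'a^'n" where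
  "dual_elt B h \<beta> = (THE t. t \<in> h \<and> (\<forall>y\<in>h. B t y = \<beta> y))"

definition dual_form ::
  "('a::field^'n \<Rightarrow> 'a^'n \<Rightarrow> 'a) \<Rightarrow> ('a^'n) set \<Rightarrow> ('a^'n \<Rightarrow> 'a) \<Rightarrow> ('a^'n \<Rightarrow> 'a) \<Rightarrow> 'a" where
  "dual_form B h \<beta> \<gamma> = B (dual_elt B h \<beta>) (dual_elt B h \<gamma>)"

definition cartan_int ::
  "('a::field^'n \<Rightarrow> 'a^'n \<Rightarrow> 'a) \<Rightarrow> ('a^'n) set \<Rightarrow> ('a^'n \<Rightarrow> 'a) \<Rightarrow> ('a^'n \<Rightarrow> 'a) \<Rightarrow> 'a" where
  "cartan_int B h \<beta> \<gamma> = 2 * dual_form B h \<beta> \<gamma> / dual_form B h \<gamma> \<gamma>"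

definition diagram_aut ::
  "('a::field^'n \<Rightarrow> 'a^'n \<Rightarrow> 'a) \<Rightarrow> ('a^'n) set \<Rightarrow> ('a^'n \<Rightarrow> 'a) set \<Rightarrow>
    (('a^'n \<Rightarrow> 'a) \<Rightarrow> ('a^'n \<Rightarrow> 'a)) \<Rightarrow> bool" where
  "diagram_aut B h \<Gamma> \<pi> \<longleftrightarrow> bij_betw \<pi> \<Gamma> \<Gamma> \<and>
     (\<forall>\<beta>\<in>\<Gamma>. \<forall>\<gamma>\<in>\<Gamma>. cartan_int B h (\<pi> \<beta>) (\<pi> \<gamma>) = cartan_int B h \<beta> \<gamma>)"

definition is_pi_hat ::
  "('a::field^'n \<Rightarrow> 'a^'n \<Rightarrow> 'a^'n) \<Rightarrow> ('a^'n) set \<Rightarrow> ('a^'n \<Rightarrow> 'a) set \<Rightarrow>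
    (('a^'n \<Rightarrow> 'a) \<Rightarrow> 'a^'n) \<Rightarrow> (('a^'n \<Rightarrow> 'a) \<Rightarrow> ('a^'n \<Rightarrow> 'a)) \<Rightarrow> ('a^'n \<Rightarrow> 'a^'n) \<Rightarrow> bool" where
  "is_pi_hat br h \<Gamma> Xr \<pi> \<phi> \<longleftrightarrow> \<phi> \<in> lie_aut br \<and> \<phi> ` h = h \<and> (\<forall>\<beta>\<in>\<Gamma>. \<phi> (Xr \<beta>) = Xr (\<pi> \<beta>))"

definition is_chevalley_aut ::
  "('a::field^'n \<Rightarrow> 'a^'n \<Rightarrow> 'a^'n) \<Rightarrow> ('a^'n) set \<Rightarrow> ('a^'n \<Rightarrow> 'a) set \<Rightarrow>
    (('a^'n \<Rightarrow> 'a) \<Rightarrow> 'a^'n) \<Rightarrow> ('a^'n \<Rightarrow> 'a^'n) \<Rightarrow> bool" where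
  "is_chevalley_aut br h \<Gamma> Xr \<phi> \<longleftrightarrow> \<phi> \<in> lie_aut br \<and> (\<forall>y\<in>h. \<phi> y = - y) \<and>
     (\<forall>\<beta>\<in>\<Gamma>. \<phi> (Xr \<beta>) = - Xr (- \<beta>) \<and> \<phi> (Xr (- \<beta>)) = - Xr \<beta>)"

section \<open>Belavin--Drinfeld r-matrices\<close>

definition Omega_h ::
  "('a::field^'n \<Rightarrow> 'a^'n \<Rightarrow> 'a^'n) \<Rightarrow> ('a^'n) set \<Rightarrow> ('a^'n \<Rightarrow> 'a^'n \<Rightarrow> 'a) \<Rightarrow>
    (('a^'n \<Rightarrow> 'a) \<Rightarrow> 'a^'n) \<Rightarrow> 'a^('n \<times> 'n)" where
  "Omega_h br h B Xr = casimir B - (\<Sum>\<beta>\<in>roots br h. tens (Xr \<beta>) (Xr (- \<beta>)))"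

text \<open>The partial map \<open>\<tau>\<close> is a total function of which only the values on \<open>\<Gamma>\<^sub>1\<close> matter; in the
  nilpotency condition the least \<open>k\<close> with \<open>(\<tau> ^^ k) \<beta> \<notin> \<Gamma>\<^sub>1\<close> involves no other values. In the last
  condition \<open>\<tau> \<beta>\<close> and \<open>\<beta>\<close> act on \<open>h \<otimes> h\<close>, through any linear forms \<open>f\<close>, \<open>g\<close> extending them from \<open>h\<close>.\<close>

definition admissible_quadruple ::
  "('a::field^'n \<Rightarrow> 'a^'n \<Rightarrow> 'a^'n) \<Rightarrow> ('a^'n) set \<Rightarrow> ('a^'n \<Rightarrow> 'a^'n \<Rightarrow> 'a) \<Rightarrow>
    ('a^'n \<Rightarrow> 'a) set \<Rightarrow> (('a^'n \<Rightarrow> 'a) \<Rightarrow> 'a^'n) \<Rightarrow>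
    ('a^'n \<Rightarrow> 'a) set \<Rightarrow> ('a^'n \<Rightarrow> 'a) set \<Rightarrow> (('a^'n \<Rightarrow> 'a) \<Rightarrow> ('a^'n \<Rightarrow> 'a)) \<Rightarrow>
    'a^('n \<times> 'n) \<Rightarrow> bool" where
  "admissible_quadruple br h B \<Gamma> Xr \<Gamma>\<^sub>1 \<Gamma>\<^sub>2 \<tau> r\<^sub>h \<longleftrightarrow>
     \<Gamma>\<^sub>1 \<subseteq> \<Gamma> \<and> \<Gamma>\<^sub>2 \<subseteq> \<Gamma> \<and> bij_betw \<tau> \<Gamma>\<^sub>1 \<Gamma>\<^sub>2 \<and>
     (\<forall>\<beta>\<in>\<Gamma>\<^sub>1. \<forall>\<gamma>\<in>\<Gamma>\<^sub>1. dual_form B h (\<tau> \<beta>) (\<tau> \<gamma>) = dual_form B h \<beta> \<gamma>) \<and>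
     (\<forall>\<beta>\<in>\<Gamma>\<^sub>1. \<exists>k>0. (\<tau> ^^ k) \<beta> \<notin> \<Gamma>\<^sub>1) \<and>
     r\<^sub>h \<in> tensor_square h \<and> r\<^sub>h + flip r\<^sub>h = Omega_h br h B Xr \<and>
     (\<forall>\<beta>\<in>\<Gamma>\<^sub>1. \<forall>f g. Vector_Spaces.linear (*s) (*) f \<and> Vector_Spaces.linear (*s) (*) g \<and>
        (\<forall>y\<in>h. f y = \<tau> \<beta> y) \<and> (\<forall>y\<in>h. g y = \<beta> y) \<longrightarrow> tcontr1 f r\<^sub>h + tcontr2 g r\<^sub>h = 0)"

text \<open>The additive extension of \<open>\<tau>\<close> to the \<open>\<int>\<close>-span of \<open>\<Gamma>\<^sub>1\<close>, as a relation: \<open>(tau_ext \<Gamma>\<^sub>1 \<tau> ^^ k) \<beta> \<beta>'\<close>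
  means that \<open>\<tau>\<^sup>k(\<beta>)\<close> is defined and equal to \<open>\<beta>'\<close>.\<close>

definition tau_ext ::
  "('a^'n \<Rightarrow> 'a::field) set \<Rightarrow> (('a^'n \<Rightarrow> 'a) \<Rightarrow> ('a^'n \<Rightarrow> 'a)) \<Rightarrow>
    ('a^'n \<Rightarrow> 'a) \<Rightarrow> ('a^'n \<Rightarrow> 'a) \<Rightarrow> bool" where
  "tau_ext \<Gamma>\<^sub>1 \<tau> \<beta> \<beta>' \<longleftrightarrow> (\<exists>c. \<beta> = zcomb c id \<Gamma>\<^sub>1 \<and> \<beta>' = zcomb c \<tau> \<Gamma>\<^sub>1)"

definition tau_compatible ::
  "('a::field^'n \<Rightarrow> 'a^'n \<Rightarrow> 'a^'n) \<Rightarrow> ('a^'n) set \<Rightarrow> (('a^'n \<Rightarrow> 'a) \<Rightarrow> 'a^'n) \<Rightarrow>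
    ('a^'n \<Rightarrow> 'a) set \<Rightarrow> (('a^'n \<Rightarrow> 'a) \<Rightarrow> ('a^'n \<Rightarrow> 'a)) \<Rightarrow> bool" where
  "tau_compatible br h Xr \<Gamma>\<^sub>1 \<tau> \<longleftrightarrow>
     (\<exists>\<theta>. lie_iso_between br
            (lie_subalg br hull (\<Union>\<beta>\<in>\<Gamma>\<^sub>1. {Xr \<beta>, Xr (- \<beta>)}))
            (lie_subalg br hull (\<Union>\<beta>\<in>\<Gamma>\<^sub>1. {Xr (\<tau> \<beta>), Xr (- \<tau> \<beta>)})) \<theta> \<and>
          (\<forall>\<beta>\<in>\<Gamma>\<^sub>1. \<theta> (Xr \<beta>) = Xr (\<tau> \<beta>) \<and> \<theta> (Xr (- \<beta>)) = Xr (- \<tau> \<beta>)) \<and>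
          (\<forall>\<beta>\<in>roots br h. \<forall>\<beta>'. tau_ext \<Gamma>\<^sub>1 \<tau> \<beta> \<beta>' \<longrightarrow> \<theta> (Xr \<beta>) = Xr \<beta>'))"

definition r_BD ::
  "('a::field^'n \<Rightarrow> 'a^'n \<Rightarrow> 'a^'n) \<Rightarrow> ('a^'n) set \<Rightarrow> ('a^'n \<Rightarrow> 'a) set \<Rightarrow>
    (('a^'n \<Rightarrow> 'a) \<Rightarrow> 'a^'n) \<Rightarrow> ('a^'n \<Rightarrow> 'a) set \<Rightarrow> (('a^'n \<Rightarrow> 'a) \<Rightarrow> ('a^'n \<Rightarrow> 'a)) \<Rightarrow>
    'a^('n \<times> 'n) \<Rightarrow> 'a^('n \<times> 'n)" where
  "r_BD br h \<Gamma> Xr \<Gamma>\<^sub>1 \<tau> r\<^sub>h = r\<^sub>h + (\<Sum>\<beta>\<in>pos_roots br h \<Gamma>. tens (Xr \<beta>) (Xr (- \<beta>))) +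
     (\<Sum>(\<beta>, k, \<beta>') \<in> {(\<beta>, k, \<beta>'). \<beta> \<in> pos_roots br h \<Gamma> \<inter> zspan \<Gamma>\<^sub>1 \<and> 0 < k \<and> (tau_ext \<Gamma>\<^sub>1 \<tau> ^^ k) \<beta> \<beta>'}.
        wedge (Xr \<beta>) (Xr (- \<beta>')))"

section \<open>Galois groups and base change\<close>

definition field_subset :: "'l::field set \<Rightarrow> bool" where
  "field_subset F \<longleftrightarrow> 0 \<in> F \<and> 1 \<in> F \<and>
     (\<forall>x\<in>F. \<forall>y\<in>F. x + y \<in> F \<and> x - y \<in> F \<and> x * y \<in> F) \<and> (\<forall>x\<in>F. inverse x \<in> F)"

definition base_field :: "'k::field alg_closure set" where
  "base_field = range to_ac"

definition adjoin :: "'k::field alg_closure \<Rightarrow> 'k alg_closure set" where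
  "adjoin \<alpha> = field_subset hull (insert \<alpha> base_field)"

definition Gal :: "'k::field alg_closure set \<Rightarrow> ('k alg_closure \<Rightarrow> 'k alg_closure) set" where
  "Gal F = {\<gamma>. bij \<gamma> \<and> \<gamma> 1 = 1 \<and> (\<forall>x y. \<gamma> (x + y) = \<gamma> x + \<gamma> y) \<and> (\<forall>x y. \<gamma> (x * y) = \<gamma> x * \<gamma> y) \<and>
     (\<forall>x\<in>F. \<gamma> x = x)}"

text \<open>The Krull topology is the topology of pointwise convergence for the discrete topology on the
  algebraic closure.\<close>

definition krull_topology :: "('k::field alg_closure \<Rightarrow> 'k alg_closure) topology" where
  "krull_topology =
     subtopology (product_topology (\<lambda>_. discrete_topology UNIV) UNIV) (Gal base_field)"

definition map_vec :: "('a \<Rightarrow> 'b) \<Rightarrow> 'a^'n \<Rightarrow> 'b^'n" where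
  "map_vec f x = (\<chi> i. f (x $ i))"

definition bc_bracket ::
  "('k::field^'n \<Rightarrow> 'k^'n \<Rightarrow> 'k^'n) \<Rightarrow>
    'k alg_closure^'n \<Rightarrow> 'k alg_closure^'n \<Rightarrow> 'k alg_closure^'n" where
  "bc_bracket br x y =
     (\<Sum>i\<in>UNIV. \<Sum>j\<in>UNIV. (x $ i * y $ j) *s map_vec to_ac (br (axis i 1) (axis j 1)))"

definition bc_map ::
  "('k::field^'n \<Rightarrow> 'k^'n) \<Rightarrow> 'k alg_closure^'n \<Rightarrow> 'k alg_closure^'n" where
  "bc_map f x = (\<Sum>i\<in>UNIV. x $ i *s map_vec to_ac (f (axis i 1)))"

definition gal_conj ::
  "('l \<Rightarrow> 'l) \<Rightarrow> ('l^'n \<Rightarrow> 'l^'n) \<Rightarrow> 'l^'n \<Rightarrow> 'l^'n" where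
  "gal_conj \<gamma> \<phi> = map_vec \<gamma> \<circ> \<phi> \<circ> map_vec (inv_into UNIV \<gamma>)"

section \<open>Cohomology\<close>

text \<open>Cocycles are functions on the Galois group, undefined outside it. The action of the group on
  the coefficients is a parameter.\<close>

type_synonym ('k, 'n) gal_action = "('k alg_closure \<Rightarrow> 'k alg_closure) \<Rightarrow>
  ('k alg_closure^'n \<Rightarrow> 'k alg_closure^'n) \<Rightarrow> 'k alg_closure^'n \<Rightarrow> 'k alg_closure^'n"

type_synonym ('k, 'n) gal_cochain = "('k alg_closure \<Rightarrow> 'k alg_closure) \<Rightarrow>
  'k alg_closure^'n \<Rightarrow> 'k alg_closure^'n"

definition cocycles ::
  "('k::field, 'n) gal_action \<Rightarrow> ('k alg_closure^'n \<Rightarrow> 'k alg_closure^'n) set \<Rightarrow>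
    ('k, 'n) gal_cochain set" where
  "cocycles act A = {u \<in> Gal base_field \<rightarrow>\<^sub>E A.
     continuous_map krull_topology (discrete_topology A) u \<and>
     (\<forall>\<gamma>\<in>Gal base_field. \<forall>\<eta>\<in>Gal base_field. u (\<gamma> \<circ> \<eta>) = u \<gamma> \<circ> act \<gamma> (u \<eta>))}"

definition cohomologous ::
  "('k::field, 'n) gal_action \<Rightarrow> ('k alg_closure^'n \<Rightarrow> 'k alg_closure^'n) set \<Rightarrow>
    ('k, 'n) gal_cochain set \<Rightarrow> (('k, 'n) gal_cochain \<times> ('k, 'n) gal_cochain) set" where
  "cohomologous act A Z = {(u, w). u \<in> Z \<and> w \<in> Z \<and>
     (\<exists>\<rho>\<in>A. \<forall>\<gamma>\<in>Gal base_field. w \<gamma> = inv_into UNIV \<rho> \<circ> u \<gamma> \<circ> act \<gamma> \<rho>)}"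

definition cohomology ::
  "('k::field, 'n) gal_action \<Rightarrow> ('k alg_closure^'n \<Rightarrow> 'k alg_closure^'n) set \<Rightarrow>
    ('k, 'n) gal_cochain set \<Rightarrow> ('k, 'n) gal_cochain set set" where
  "cohomology act A Z = Z // cohomologous act A Z"

text \<open>The group of points over the algebraic closure of the automorphism group scheme of
  \<open>(\<gg>, \<partial>r)\<close>.\<close>

definition A_BD ::
  "('k::field^'n \<Rightarrow> 'k^'n \<Rightarrow> 'k^'n) \<Rightarrow> 'k^('n \<times> 'n) \<Rightarrow>
    ('k alg_closure^'n \<Rightarrow> 'k alg_closure^'n) set" where
  "A_BD br r = {\<phi> \<in> lie_aut (bc_bracket br). \<forall>a.
     tmap \<phi> \<phi> (cobracket (bc_bracket br) (map_vec to_ac r) a) =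
     cobracket (bc_bracket br) (map_vec to_ac r) (\<phi> a)}"

definition Zbar ::
  "('k::field^'n \<Rightarrow> 'k^'n \<Rightarrow> 'k^'n) \<Rightarrow> 'k^('n \<times> 'n) \<Rightarrow> 'k alg_closure \<Rightarrow>
    ('k, 'n) gal_cochain set" where
  "Zbar br r \<alpha> = {u \<in> cocycles gal_conj (lie_aut (bc_bracket br)).
     (\<forall>\<gamma>\<in>Gal (adjoin \<alpha>). tmap (u \<gamma>) (u \<gamma>) (map_vec to_ac r) = map_vec to_ac r) \<and>
     (\<forall>\<gamma>\<in>Gal base_field. \<gamma> \<alpha> = - \<alpha> \<longrightarrow>
        tmap (u \<gamma>) (u \<gamma>) (map_vec to_ac r) = flip (map_vec to_ac r))}"

definition Hbar ::
  "('k::field^'n \<Rightarrow> 'k^'n \<Rightarrow> 'k^'n) \<Rightarrow> 'k^('n \<times> 'n) \<Rightarrow> 'k alg_closure \<Rightarrow>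
    ('k, 'n) gal_cochain set set" where
  "Hbar br r \<alpha> = cohomology gal_conj (A_BD br r) (Zbar br r \<alpha>)"

text \<open>In the following two definitions the second case is that of \<open>\<gamma>(\<alpha>) = - \<alpha>\<close>, because
  \<open>\<alpha>\<^sup>2\<close> lies in the base field.\<close>

definition v_pi ::
  "'k::field alg_closure \<Rightarrow> ('k^'n \<Rightarrow> 'k^'n) \<Rightarrow> ('k^'n \<Rightarrow> 'k^'n) \<Rightarrow> ('k, 'n) gal_action" where
  "v_pi \<alpha> pihat chev \<gamma> \<rho> =
     (if \<gamma> \<in> Gal (adjoin \<alpha>) then \<rho>
      else (bc_map chev \<circ> bc_map pihat) \<circ> \<rho> \<circ> inv_into UNIV (bc_map chev \<circ> bc_map pihat))"

definition hat_cocycle ::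
  "'k::field alg_closure \<Rightarrow> ('k^'n \<Rightarrow> 'k^'n) \<Rightarrow> ('k^'n \<Rightarrow> 'k^'n) \<Rightarrow>
    ('k, 'n) gal_cochain \<Rightarrow> ('k, 'n) gal_cochain" where
  "hat_cocycle \<alpha> pihat chev u = (\<lambda>\<gamma>\<in>Gal base_field.
     if \<gamma> \<in> Gal (adjoin \<alpha>) then u \<gamma> else u \<gamma> \<circ> bc_map pihat \<circ> bc_map chev)"

definition twisted_action ::
  "'k::field alg_closure \<Rightarrow> ('k^'n \<Rightarrow> 'k^'n) \<Rightarrow> ('k^'n \<Rightarrow> 'k^'n) \<Rightarrow> ('k, 'n) gal_action" where
  "twisted_action \<alpha> pihat chev \<gamma> \<rho> = v_pi \<alpha> pihat chev \<gamma> (gal_conj \<gamma> \<rho>)"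

definition Z1_v ::
  "('k::field^'n \<Rightarrow> 'k^'n \<Rightarrow> 'k^'n) \<Rightarrow> 'k^('n \<times> 'n) \<Rightarrow> 'k alg_closure \<Rightarrow>
    ('k^'n \<Rightarrow> 'k^'n) \<Rightarrow> ('k^'n \<Rightarrow> 'k^'n) \<Rightarrow> ('k, 'n) gal_cochain set" where
  "Z1_v br r \<alpha> pihat chev = cocycles (twisted_action \<alpha> pihat chev) (A_BD br r)"

definition H1_v ::
  "('k::field^'n \<Rightarrow> 'k^'n \<Rightarrow> 'k^'n) \<Rightarrow> 'k^('n \<times> 'n) \<Rightarrow> 'k alg_closure \<Rightarrow>
    ('k^'n \<Rightarrow> 'k^'n) \<Rightarrow> ('k^'n \<Rightarrow> 'k^'n) \<Rightarrow> ('k, 'n) gal_cochain set set" where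
  "H1_v br r \<alpha> pihat chev =
     cohomology (twisted_action \<alpha> pihat chev) (A_BD br r) (Z1_v br r \<alpha> pihat chev)"

end

theory Submission
  imports Defs
begin

unbundle no fps_syntax

text \<open>
  Let \<open>\<psi> = \<chi>\<pi>\<close> denote the composite of the Chevalley and the diagram automorphism. Everything rests on two
  facts over the base field: \<open>\<chi>\<close> and \<open>\<pi>\<close> are commuting involutions, and \<open>(\<psi> \<otimes> \<psi>)(r) = r\<^sup>2\<^sup>1\<close>. The Galois
  group fixes \<open>\<psi>\<close>, so multiplying a cocycle by \<open>\<psi>\<close> on the nontrivial coset turns the condition
  \<open>(u \<otimes> u)(r) = r\<^sup>2\<^sup>1\<close> into \<open>(u \<otimes> u)(r) = r\<close> and the cocycle condition into the twisted one, and the same \<open>\<rho>\<close>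
  realises equivalence on both sides.

  The equality \<open>(\<psi> \<otimes> \<psi>)(r) = r\<^sup>2\<^sup>1\<close> is a comparison of scalars: \<open>\<psi>\<close> sends \<open>X\<^sub>\<beta>\<close> to a multiple \<open>c\<^sub>\<beta>\<close> of a root
  vector, \<open>c\<^sub>\<beta> c\<^sub>-\<^sub>\<beta> = 1\<close> because the form is a multiple of the Killing form, and \<open>c\<close> is constant along
  \<open>\<tau>\<close>-orbits because conjugation by \<open>\<psi>\<close> inverts the isomorphism attached to \<open>\<tau>\<close>. The structure theory this
  takes is obtained cheaply: the expression of the Casimir element through the chosen root vectors makes
  the root spaces one-dimensional, and vanishing of the trace of a commutator on a stable sum of root spaces
  replaces root strings.
\<close>

section \<open>Linear maps\<close>

text \<open>The field is any field of characteristic zero, so it has no ordering to support the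
  usual positivity arguments. Rationality replaces it: \<open>B\<close> is rational on the split
  rational form, so roots take rational values on the vectors \<open>t \<gamma>\<close> with
  \<gamma> simple, and on \<open>h\<close> the Killing form is the sum over the roots of the
  products of their values. On integer combinations of the \<open>t \<gamma>\<close> it is thus a
  sum of rational squares. This yields that the Killing form is a nonzero multiple of
  \<open>B\<close>, and that the root vector of any root in the span of a set \<open>S\<close> of
  simple roots lies in \<open>gen S\<close>, the subalgebra that the simple root vectors of
  \<open>S\<close> and their opposites generate. The latter matters because the isomorphism \<theta>
  attached to \<tau> lives on \<open>gen \<Gamma>\<^sub>1\<close> only. Compatibility gives
  \<open>\<theta> (Xr \<beta>) = Xr \<beta>'\<close>, but not that \<beta>' is a root, and
  \<open>Xr\<close> is arbitrary off the roots; a grading of \<open>gen \<Gamma>\<^sub>1\<close> by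
  integer coefficients over \<open>\<Gamma>\<^sub>1\<close> closes this gap.\<close>

lemma linear_vec_iff:
  fixes f :: "'a::field^'n \<Rightarrow> 'a^'m"
  shows "Vector_Spaces.linear (*s) (*s) f \<longleftrightarrow>
    (\<forall>x y. f (x + y) = f x + f y) \<and> (\<forall>c x. f (c *s x) = c *s f x)"
  by (auto simp: Vector_Spaces.linear_def module_hom_def module_hom_axioms_def
      vec.vector_space_axioms vec.module_axioms)

lemma linear_form_iff:
  fixes f :: "'a::field^'n \<Rightarrow> 'a"
  shows "Vector_Spaces.linear (*s) (*) f \<longleftrightarrow>
    (\<forall>x y. f (x + y) = f x + f y) \<and> (\<forall>c x. f (c *s x) = c * f x)"
proof -
  have "vector_space ((*) :: 'a \<Rightarrow> 'a \<Rightarrow> 'a)"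
    by unfold_locales (auto simp: algebra_simps)
  then show ?thesis
    by (auto simp: Vector_Spaces.linear_def module_hom_def module_hom_axioms_def
        vec.vector_space_axioms vec.module_axioms module_iff_vector_space)
qed

lemma vector_sum_scale: "(c::'a::field) *s (\<Sum>i\<in>A. f i) = (\<Sum>i\<in>A. c *s f i)"
  by (simp add: vec.scale_sum_right)

lemma linear_vec_sum:
  fixes f :: "'a::field^'n \<Rightarrow> 'a^'m"
  assumes "Vector_Spaces.linear (*s) (*s) f"
  shows "f (\<Sum>i\<in>A. g i) = (\<Sum>i\<in>A. f (g i))"
proof -
  have "f 0 = 0" using assms unfolding linear_vec_iff by (metis add_cancel_right_right)
  then show ?thesis using assms unfolding linear_vec_iff
    by (induction A rule: infinite_finite_induct) auto
qed

lemma linear_form_sum: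
  fixes f :: "'a::field^'n \<Rightarrow> 'a"
  assumes "Vector_Spaces.linear (*s) (*) f"
  shows "f (\<Sum>i\<in>A. g i) = (\<Sum>i\<in>A. f (g i))"
proof -
  have "f 0 = 0" using assms unfolding linear_form_iff by (metis add_cancel_right_right)
  then show ?thesis using assms unfolding linear_form_iff
    by (induction A rule: infinite_finite_induct) auto
qed

lemma linear_vec_ident [simp]: "Vector_Spaces.linear (*s) (*s) (\<lambda>x::'a::field^'n. x)"
  "Vector_Spaces.linear (*s) (*s) (id :: 'a::field^'n \<Rightarrow> 'a^'n)"
  by (simp_all add: linear_vec_iff)

lemma linear_vec_comp:
  fixes f :: "'a::field^'n \<Rightarrow> 'a^'m" and g :: "'a^'l \<Rightarrow> 'a^'n"
  assumes "Vector_Spaces.linear (*s) (*s) f" "Vector_Spaces.linear (*s) (*s) g"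
  shows "Vector_Spaces.linear (*s) (*s) (f \<circ> g)"
  using assms by (simp add: linear_vec_iff)

lemma linear_vec_expand:
  fixes f :: "'a::field^'n \<Rightarrow> 'a^'m"
  assumes "Vector_Spaces.linear (*s) (*s) f"
  shows "f x = (\<Sum>i\<in>UNIV. x $ i *s f (axis i 1))"
proof -
  have "f x = f (\<Sum>i\<in>UNIV. x $ i *s axis i 1)" by (simp add: basis_expansion)
  also have "\<dots> = (\<Sum>i\<in>UNIV. x $ i *s f (axis i 1))"
    using assms by (simp add: linear_vec_sum linear_vec_iff)
  finally show ?thesis .
qed

lemma linear_form_expand:
  fixes f :: "'a::field^'n \<Rightarrow> 'a"
  assumes "Vector_Spaces.linear (*s) (*) f"
  shows "f x = (\<Sum>i\<in>UNIV. x $ i * f (axis i 1))"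
proof -
  have "f x = f (\<Sum>i\<in>UNIV. x $ i *s axis i 1)" by (simp add: basis_expansion)
  also have "\<dots> = (\<Sum>i\<in>UNIV. x $ i * f (axis i 1))"
    using assms by (simp add: linear_form_sum linear_form_iff)
  finally show ?thesis .
qed

lemma linear_vec_eqI:
  fixes f g :: "'a::field^'n \<Rightarrow> 'a^'m"
  assumes "Vector_Spaces.linear (*s) (*s) f" "Vector_Spaces.linear (*s) (*s) g"
    and "\<And>i. f (axis i 1) = g (axis i 1)"
  shows "f = g"
proof
  fix x
  show "f x = g x"
    unfolding linear_vec_expand[OF assms(1), of x] linear_vec_expand[OF assms(2), of x] assms(3) ..
qed

lemma linear_vec_inv:
  fixes f :: "'a::field^'n \<Rightarrow> 'a^'n"
  assumes "Vector_Spaces.linear (*s) (*s) f" "bij f"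
  shows "Vector_Spaces.linear (*s) (*s) (inv_into UNIV f)"
  unfolding linear_vec_iff
proof (intro conjI allI)
  fix x y c
  have s: "f (inv_into UNIV f z) = z" for z using assms(2) by (simp add: bij_is_surj surj_f_inv_f)
  have i: "inv_into UNIV f (f z) = z" for z using assms(2) by (simp add: bij_is_inj)
  have "inv_into UNIV f (x + y) = inv_into UNIV f (f (inv_into UNIV f x + inv_into UNIV f y))" using assms(1) by (simp add: linear_vec_iff s)
  then show "inv_into UNIV f (x + y) = inv_into UNIV f x + inv_into UNIV f y" by (simp add: i)
  have "inv_into UNIV f (c *s x) = inv_into UNIV f (f (c *s inv_into UNIV f x))" using assms(1) by (simp add: linear_vec_iff s)
  then show "inv_into UNIV f (c *s x) = c *s inv_into UNIV f x" by (simp add: i)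
qed

lemma linear_span_subspace:
  fixes f :: "'a::field^'n \<Rightarrow> 'a^'m"
  assumes "Vector_Spaces.linear (*s) (*s) f" "vec.subspace U" "\<And>x. x \<in> S \<Longrightarrow> f x \<in> U"
    and "x \<in> vec.span S"
  shows "f x \<in> U"
  using assms(4)
proof (induction rule: vec.span_induct)
  case base
  have "f 0 = 0" using assms(1) unfolding linear_vec_iff by (metis add_cancel_right_right)
  then show ?case using assms(1,2) by (auto simp: vec.subspace_def linear_vec_iff)
next
  case (step x)
  then show ?case by (rule assms(3))
qed

lemma linear_vec_diff:
  fixes f :: "'a::field^'n \<Rightarrow> 'a^'m"
  assumes "Vector_Spaces.linear (*s) (*s) f" shows "f (x - y) = f x - f y"
proof -
  have "f (x + (- 1) *s y) = f x + (- 1) *s f y" using assms unfolding linear_vec_iff by (simp only:)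
  then show ?thesis by simp
qed

section \<open>Tensors\<close>

lemma tens_nth [simp]: "tens x y $ (i, j) = x $ i * y $ j"
  by (simp add: tens_def)

lemma flip_nth [simp]: "flip T $ (i, j) = T $ (j, i)"
  by (simp add: flip_def)

lemma vec_prod_eqI: "(\<And>i j. S $ (i, j) = T $ (i, j)) \<Longrightarrow> S = T"
  by (simp add: vec_eq_iff)

lemma tens_scale_left: "tens (c *s x) y = c *s tens x y"
  and tens_scale_right: "tens x (c *s y) = c *s tens x y"
  and tens_minus_left: "tens (- x) y = - tens x y"
  and tens_minus_right: "tens x (- y) = - tens x y"
  by (auto intro!: vec_prod_eqI simp: algebra_simps)

lemma tens_sum_left: "tens (\<Sum>i\<in>A. f i) y = (\<Sum>i\<in>A. tens (f i) y)"
  and tens_sum_right: "tens x (\<Sum>i\<in>A. g i) = (\<Sum>i\<in>A. tens x (g i))"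
  by (auto intro!: vec_prod_eqI simp: sum_distrib_left sum_distrib_right)

lemma flip_tens [simp]: "flip (tens x y) = tens y x"
  by (auto intro!: vec_prod_eqI)

lemma flip_flip [simp]: "flip (flip T) = T"
  by (auto intro!: vec_prod_eqI)

lemma linear_flip: "Vector_Spaces.linear (*s) (*s) (flip :: 'a::field^('n::finite \<times> 'n) \<Rightarrow> _)"
  unfolding linear_vec_iff by (auto intro!: vec_prod_eqI)

lemma tens_expansion:
  fixes T :: "'a::field^('n::finite \<times> 'n)"
  shows "T = (\<Sum>i\<in>UNIV. \<Sum>j\<in>UNIV. T $ (i, j) *s tens (axis i 1) (axis j 1))"
proof (rule vec_prod_eqI)
  fix k l
  have "(\<Sum>j\<in>UNIV. T $ (i, j) * (axis i 1 $ k * axis j 1 $ l)) = (if i = k then T $ (k, l) else 0)" for i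
  proof -
    have "(\<Sum>j\<in>UNIV. T $ (i, j) * (axis i 1 $ k * axis j 1 $ l)) =
      (\<Sum>j\<in>UNIV. if j = l then (if i = k then T $ (k, l) else 0) else 0)"
      by (intro sum.cong) (auto simp: axis_def)
    then show ?thesis by simp
  qed
  then show "T $ (k, l) = (\<Sum>i\<in>UNIV. \<Sum>j\<in>UNIV. T $ (i, j) *s tens (axis i 1) (axis j 1)) $ (k, l)"
    by simp
qed

lemma linear_tens_eqI:
  fixes f g :: "'a::field^('n::finite \<times> 'n) \<Rightarrow> 'a^'m"
  assumes "Vector_Spaces.linear (*s) (*s) f" "Vector_Spaces.linear (*s) (*s) g"
    and "\<And>x y. f (tens x y) = g (tens x y)"
  shows "f T = g T"
proof -
  have "f T = f (\<Sum>i\<in>UNIV. \<Sum>j\<in>UNIV. T $ (i, j) *s tens (axis i 1) (axis j 1))"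
    by (rule arg_cong[OF tens_expansion])
  also have "\<dots> = g (\<Sum>i\<in>UNIV. \<Sum>j\<in>UNIV. T $ (i, j) *s tens (axis i 1) (axis j 1))"
    using assms by (simp add: linear_vec_sum) (simp add: linear_vec_iff)
  also have "\<dots> = g T"
    by (rule arg_cong[OF tens_expansion[symmetric]])
  finally show ?thesis .
qed

lemma linear_tmap: "Vector_Spaces.linear (*s) (*s) (tmap f g)"
  unfolding linear_vec_iff tmap_def
  by (simp add: vec.scale_left_distrib sum.distrib vector_sum_scale)

lemma tmap_tens:
  fixes f g :: "'a::field^'n \<Rightarrow> 'a^'n"
  assumes "Vector_Spaces.linear (*s) (*s) f" "Vector_Spaces.linear (*s) (*s) g"
  shows "tmap f g (tens x y) = tens (f x) (g y)"
proof -
  have "tens (f x) (g y) =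
    (\<Sum>j\<in>UNIV. \<Sum>i\<in>UNIV. y $ j *s (x $ i *s tens (f (axis i 1)) (g (axis j 1))))"
    unfolding linear_vec_expand[OF assms(1), of x] linear_vec_expand[OF assms(2), of y]
    by (simp only: tens_sum_left tens_sum_right tens_scale_left tens_scale_right vector_sum_scale)
  also have "\<dots> = (\<Sum>i\<in>UNIV. \<Sum>j\<in>UNIV. y $ j *s (x $ i *s tens (f (axis i 1)) (g (axis j 1))))"
    by (rule sum.swap)
  finally show ?thesis by (simp add: tmap_def mult.commute)
qed

lemma tmap_comp:
  fixes f g f' g' :: "'a::field^'n \<Rightarrow> 'a^'n"
  assumes "Vector_Spaces.linear (*s) (*s) f" "Vector_Spaces.linear (*s) (*s) g"
    and "Vector_Spaces.linear (*s) (*s) f'" "Vector_Spaces.linear (*s) (*s) g'"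
  shows "tmap (f \<circ> f') (g \<circ> g') T = tmap f g (tmap f' g' T)"
proof -
  have "tmap (f \<circ> f') (g \<circ> g') T = (tmap f g \<circ> tmap f' g') T"
  proof (rule linear_tens_eqI[of "tmap (f \<circ> f') (g \<circ> g')"])
    show "Vector_Spaces.linear (*s) (*s) (tmap f g \<circ> tmap f' g')"
      by (intro linear_vec_comp linear_tmap)
  qed (simp_all add: linear_tmap tmap_tens linear_vec_comp assms)
  then show ?thesis by simp
qed

lemma tmap_id [simp]: "tmap id id T = T"
proof -
  have "tmap id id T = id T"
    by (rule linear_tens_eqI) (auto intro: linear_tmap simp: tmap_tens)
  then show ?thesis by simp
qed

lemma tmap_flip:
  fixes f g :: "'a::field^'n \<Rightarrow> 'a^'n"
  assumes "Vector_Spaces.linear (*s) (*s) f" "Vector_Spaces.linear (*s) (*s) g"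
  shows "tmap f g (flip T) = flip (tmap g f T)"
proof -
  have "(tmap f g \<circ> flip) T = (flip \<circ> tmap g f) T"
  proof (rule linear_tens_eqI[of "tmap f g \<circ> flip"])
    show "Vector_Spaces.linear (*s) (*s) (tmap f g \<circ> flip)"
      "Vector_Spaces.linear (*s) (*s) (flip \<circ> tmap g f)"
      by (intro linear_vec_comp linear_tmap linear_flip)+
  qed (simp add: tmap_tens assms)
  then show ?thesis by simp
qed

lemma linear_tcontr1: "Vector_Spaces.linear (*s) (*s) (tcontr1 f)"
  unfolding linear_vec_iff tcontr1_def
  by (simp add: vec.scale_left_distrib sum.distrib vector_sum_scale distrib_right mult.assoc)

lemma tcontr1_tens:
  fixes f :: "'a::field^'n \<Rightarrow> 'a"
  assumes "Vector_Spaces.linear (*s) (*) f"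
  shows "tcontr1 f (tens x y) = f x *s y"
proof -
  have "tcontr1 f (tens x y) = (\<Sum>i\<in>UNIV. (x $ i * f (axis i 1)) *s (\<Sum>j\<in>UNIV. y $ j *s axis j 1))"
    by (simp add: tcontr1_def vector_sum_scale mult_ac)
  also have "\<dots> = f x *s y"
    by (simp add: basis_expansion linear_form_expand[OF assms, of x] vec.scale_sum_left)
  finally show ?thesis .
qed

section \<open>Automorphisms\<close>

lemma lie_autD:
  assumes "\<phi> \<in> lie_aut br"
  shows "Vector_Spaces.linear (*s) (*s) \<phi>" "bij \<phi>" "\<phi> (br x y) = br (\<phi> x) (\<phi> y)"
  using assms by (auto simp: lie_aut_def)

lemma lie_aut_id: "id \<in> lie_aut br"
  by (simp add: lie_aut_def)

lemma lie_aut_comp: "\<phi> \<in> lie_aut br \<Longrightarrow> \<psi> \<in> lie_aut br \<Longrightarrow> \<phi> \<circ> \<psi> \<in> lie_aut br"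
  by (auto simp: lie_aut_def linear_vec_comp bij_comp)

lemma lie_aut_inv:
  assumes "\<phi> \<in> lie_aut br"
  shows "inv_into UNIV \<phi> \<in> lie_aut br"
proof -
  have s: "\<phi> (inv_into UNIV \<phi> z) = z" for z using lie_autD(2)[OF assms] by (simp add: bij_is_surj surj_f_inv_f)
  have i: "inv_into UNIV \<phi> (\<phi> z) = z" for z using lie_autD(2)[OF assms] by (simp add: bij_is_inj)
  have "inv_into UNIV \<phi> (br x y) = br (inv_into UNIV \<phi> x) (inv_into UNIV \<phi> y)" for x y
  proof -
    have "inv_into UNIV \<phi> (br x y) = inv_into UNIV \<phi> (\<phi> (br (inv_into UNIV \<phi> x) (inv_into UNIV \<phi> y)))"
      using lie_autD(3)[OF assms] by (simp add: s)
    then show ?thesis by (simp add: i)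
  qed
  then show ?thesis
    using lie_autD[OF assms] by (simp add: lie_aut_def linear_vec_inv bij_imp_bij_inv)
qed

lemma bilinear_vecD:
  fixes br :: "'a::field^'n \<Rightarrow> 'a^'n \<Rightarrow> 'a^'n"
  assumes "bilinear_map (*s) br"
  shows "Vector_Spaces.linear (*s) (*s) (br x)" "Vector_Spaces.linear (*s) (*s) (\<lambda>x. br x y)"
  using assms by (auto simp: bilinear_map_def)

text \<open>An automorphism satisfies
  \<open>\<phi> \<circ> br a = br (\<phi> a) \<circ> \<phi>\<close>, and this passes through either
  tensor factor. Hence an automorphism fixing a tensor fixes its cobracket, which is how values of
  cocycles are recognised as elements of \<open>A_BD\<close>.\<close>

lemma cobracket_tmap:
  fixes br :: "'a::field^'n \<Rightarrow> 'a^'n \<Rightarrow> 'a^'n"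
  assumes \<phi>: "\<phi> \<in> lie_aut br" and br: "\<And>x. Vector_Spaces.linear (*s) (*s) (br x)"
  shows "tmap \<phi> \<phi> (cobracket br r a) = cobracket br (tmap \<phi> \<phi> r) (\<phi> a)"
proof -
  note l = lie_autD(1)[OF \<phi>]
  have e: "\<phi> \<circ> br a = br (\<phi> a) \<circ> \<phi>" using lie_autD(3)[OF \<phi>] by auto
  have "tmap \<phi> \<phi> (cobracket br r a) = tmap (\<phi> \<circ> br a) (\<phi> \<circ> id) r + tmap (\<phi> \<circ> id) (\<phi> \<circ> br a) r"
    unfolding cobracket_def using linear_tmap[of \<phi> \<phi>] l br
    by (subst (1 2) tmap_comp) (auto simp: linear_vec_iff)
  also have "\<dots> = tmap (br (\<phi> a) \<circ> \<phi>) (id \<circ> \<phi>) r + tmap (id \<circ> \<phi>) (br (\<phi> a) \<circ> \<phi>) r"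
    by (simp add: e)
  also have "\<dots> = cobracket br (tmap \<phi> \<phi> r) (\<phi> a)"
    unfolding cobracket_def using l br by (subst (1 2) tmap_comp) auto
  finally show ?thesis .
qed

section \<open>Base change\<close>

lemma map_vec_nth [simp]: "map_vec f x $ i = f (x $ i)"
  by (simp add: map_vec_def)

lemma map_vec_to_ac_simps:
  "map_vec to_ac (x + y) = map_vec to_ac x + map_vec to_ac y"
  "map_vec to_ac (c *s x) = to_ac c *s map_vec to_ac x"
  "map_vec to_ac (\<Sum>i\<in>A. g i) = (\<Sum>i\<in>A. map_vec to_ac (g i))"
  "map_vec to_ac (tens a b) = tens (map_vec to_ac a) (map_vec to_ac b)"
  "map_vec to_ac (flip T) = flip (map_vec to_ac T)"
  "map_vec to_ac (axis i 1) = axis i 1"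
  by (auto simp: vec_eq_iff to_ac_sum axis_def)

lemma linear_bc_map: "Vector_Spaces.linear (*s) (*s) (bc_map f)"
  unfolding linear_vec_iff bc_map_def
  by (simp add: vec.scale_left_distrib sum.distrib vector_sum_scale)

lemma bc_map_axis [simp]: "bc_map f (axis i 1) = map_vec to_ac (f (axis i 1))"
  unfolding bc_map_def by (simp add: axis_def if_distrib[of "\<lambda>c. c *s _"] cong: if_cong)

lemma bc_map_map_vec:
  fixes f :: "'k::field^'n \<Rightarrow> 'k^'n"
  assumes "Vector_Spaces.linear (*s) (*s) f"
  shows "bc_map f (map_vec to_ac x) = map_vec to_ac (f x)"
  unfolding linear_vec_expand[OF assms, of x] bc_map_def by (simp add: map_vec_to_ac_simps)

lemma bc_map_comp:
  fixes f g :: "'k::field^'n \<Rightarrow> 'k^'n"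
  assumes "Vector_Spaces.linear (*s) (*s) f"
  shows "bc_map (f \<circ> g) = bc_map f \<circ> bc_map g"
  by (rule linear_vec_eqI) (auto intro: linear_vec_comp linear_bc_map simp: bc_map_map_vec[OF assms])

lemma bc_map_id [simp]: "bc_map id = id"
  by (rule linear_vec_eqI) (auto simp: linear_bc_map map_vec_to_ac_simps)

lemma tmap_bc_map:
  fixes f g :: "'k::field^'n \<Rightarrow> 'k^'n"
  shows "tmap (bc_map f) (bc_map g) (map_vec to_ac T) = map_vec to_ac (tmap f g T)"
  by (simp add: tmap_def map_vec_to_ac_simps)

lemma linear_bc_bracket:
  "Vector_Spaces.linear (*s) (*s) (bc_bracket br x)"
  "Vector_Spaces.linear (*s) (*s) (\<lambda>x. bc_bracket br x y)"
  unfolding linear_vec_iff bc_bracket_def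
  by (simp_all add: vec.scale_left_distrib sum.distrib vector_sum_scale algebra_simps)

lemma bc_bracket_map_vec:
  fixes br :: "'k::field^'n \<Rightarrow> 'k^'n \<Rightarrow> 'k^'n"
  assumes "bilinear_map (*s) br"
  shows "bc_bracket br (map_vec to_ac x) (map_vec to_ac y) = map_vec to_ac (br x y)"
proof -
  have "br x y = (\<Sum>i\<in>UNIV. x $ i *s br (axis i 1) y)"
    using linear_vec_expand[OF bilinear_vecD(2)[OF assms]] .
  also have "\<dots> = (\<Sum>i\<in>UNIV. x $ i *s (\<Sum>j\<in>UNIV. y $ j *s br (axis i 1) (axis j 1)))"
    by (subst linear_vec_expand[OF bilinear_vecD(1)[OF assms], of _ y]) simp
  finally show ?thesis
    by (simp add: bc_bracket_def map_vec_to_ac_simps vector_sum_scale)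
qed

lemma bilinear_vec_eqI:
  fixes f g :: "'a::field^'n \<Rightarrow> 'a^'n \<Rightarrow> 'a^'n"
  assumes "\<And>x. Vector_Spaces.linear (*s) (*s) (f x)" "\<And>y. Vector_Spaces.linear (*s) (*s) (\<lambda>x. f x y)"
    and "\<And>x. Vector_Spaces.linear (*s) (*s) (g x)" "\<And>y. Vector_Spaces.linear (*s) (*s) (\<lambda>x. g x y)"
    and eq: "\<And>i j. f (axis i 1) (axis j 1) = g (axis i 1) (axis j 1)"
  shows "f x y = g x y"
proof -
  have "f (axis i 1) = g (axis i 1)" for i
    by (rule linear_vec_eqI) (auto simp: assms)
  then have "(\<lambda>x. f x y) = (\<lambda>x. g x y)"
    by (intro linear_vec_eqI) (auto simp: assms)
  then show ?thesis by meson
qed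

lemma bc_map_lie_aut:
  fixes br :: "'k::field^'n \<Rightarrow> 'k^'n \<Rightarrow> 'k^'n"
  assumes br: "bilinear_map (*s) br" and \<phi>: "\<phi> \<in> lie_aut br"
  shows "bc_map \<phi> \<in> lie_aut (bc_bracket br)"
proof -
  note l = lie_autD(1)[OF \<phi>]
  have i: "\<phi> \<circ> inv_into UNIV \<phi> = id" "inv_into UNIV \<phi> \<circ> \<phi> = id" using lie_autD(2)[OF \<phi>]
    by (auto simp: fun_eq_iff bij_is_inj bij_is_surj surj_f_inv_f)
  have "bc_map \<phi> \<circ> bc_map (inv_into UNIV \<phi>) = id" "bc_map (inv_into UNIV \<phi>) \<circ> bc_map \<phi> = id"
    using l linear_vec_inv[OF l lie_autD(2)[OF \<phi>]] i by (simp_all flip: bc_map_comp)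
  then have "bij (bc_map \<phi>)" using o_bij by blast
  moreover have "bc_map \<phi> (bc_bracket br x y) = bc_bracket br (bc_map \<phi> x) (bc_map \<phi> y)" for x y
  proof (rule bilinear_vec_eqI[of "\<lambda>x y. bc_map \<phi> (bc_bracket br x y)"
        "\<lambda>x y. bc_bracket br (bc_map \<phi> x) (bc_map \<phi> y)"])
    \<comment> \<open>Both sides are bilinear, so basis vectors suffice, and these come from basis
      vectors over the base field, where \<phi> is multiplicative.\<close>
    fix i j
    have "bc_map \<phi> (bc_bracket br (map_vec to_ac (axis i 1)) (map_vec to_ac (axis j 1))) =
      bc_bracket br (bc_map \<phi> (map_vec to_ac (axis i 1))) (bc_map \<phi> (map_vec to_ac (axis j 1)))"
      by (simp add: bc_bracket_map_vec[OF br] bc_map_map_vec[OF l] lie_autD(3)[OF \<phi>])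
    then show "bc_map \<phi> (bc_bracket br (axis i 1) (axis j 1)) =
      bc_bracket br (bc_map \<phi> (axis i 1)) (bc_map \<phi> (axis j 1))"
      by (simp add: map_vec_to_ac_simps)
  qed (use linear_bc_bracket[of br] linear_bc_map[of \<phi>] in \<open>auto simp: linear_vec_iff\<close>)
  ultimately show ?thesis by (simp add: lie_aut_def linear_bc_map)
qed

section \<open>Lie algebras with a pinning\<close>

text \<open>Since \<open>Omega_h\<close> is by definition what remains of the Casimir element, its
  lying in the tensor square of \<open>h\<close> is information; the last two assumptions supply
  it.\<close>

locale pinned_lie =
  fixes br :: "'k::field_char_0^'n \<Rightarrow> 'k^'n \<Rightarrow> 'k^'n"
    and B :: "'k^'n \<Rightarrow> 'k^'n \<Rightarrow> 'k"
    and h :: "('k^'n) set"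
    and \<Gamma> :: "('k^'n \<Rightarrow> 'k) set"
    and Xr :: "('k^'n \<Rightarrow> 'k) \<Rightarrow> 'k^'n"
    and r\<^sub>h :: "'k^('n \<times> 'n)"
  assumes simple: "simple_lie br"
    and pin: "pinning br h \<Gamma> Xr"
    and inv_form: "invariant_form br B"
    and Q_form: "form_from_Q br h \<Gamma> Xr B"
    and root_vecs: "root_vectors br h B Xr"
    and rh_tensor: "r\<^sub>h \<in> tensor_square h"
    and rh_Omega: "r\<^sub>h + flip r\<^sub>h = Omega_h br h B Xr"
begin

abbreviation "R \<equiv> roots br h"
abbreviation "g \<equiv> root_space br h"

lemma lie: "lie_bracket br" and nonabelian: "\<exists>x y. br x y \<noteq> 0"
  and ideal_trivial: "lie_ideal br I \<Longrightarrow> I = {0} \<or> I = UNIV"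
  using simple by (auto simp: simple_lie_def)

lemma br_lin: "Vector_Spaces.linear (*s) (*s) (br x)" "Vector_Spaces.linear (*s) (*s) (\<lambda>x. br x y)"
  using lie by (auto simp: lie_bracket_def bilinear_map_def)

lemma br_simps:
  "br x (y + z) = br x y + br x z" "br (x + y) z = br x z + br y z"
  "br x (c *s y) = c *s br x y" "br (c *s x) y = c *s br x y"
  using br_lin[unfolded linear_vec_iff] by simp_all

lemma br_zero [simp]: "br x 0 = 0" "br 0 x = 0"
  using br_simps(3)[of x 0 0] br_simps(4)[of 0 0 x] by simp_all

lemma br_minus: "br x (- y) = - br x y" "br (- x) y = - br x y"
  using br_simps(3)[of x "-1" y] br_simps(4)[of "-1" x y] by simp_all

lemma br_sum_right: "br x (\<Sum>i\<in>A. f i) = (\<Sum>i\<in>A. br x (f i))"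
  using linear_vec_sum[OF br_lin(1)] .

lemma br_self [simp]: "br x x = 0"
  using lie by (simp add: lie_bracket_def)

lemma br_anti: "br x y = - br y x"
proof -
  have "br (x + y) x = br y x" "br (x + y) y = br x y" by (simp_all add: br_simps(2))
  then have "br (x + y) (x + y) = br y x + br x y" by (simp only: br_simps(1))
  then show ?thesis by (simp add: eq_neg_iff_add_eq_0 add.commute)
qed

lemma jacobi: "br x (br y z) = br (br x y) z + br y (br x z)"
proof -
  have "br x (br y z) + br y (br z x) + br z (br x y) = 0"
    using lie by (simp add: lie_bracket_def)
  moreover have "br y (br z x) = - br y (br x z)"
    using br_anti[of z x] by (simp add: br_minus)
  moreover have "br z (br x y) = - br (br x y) z" by (rule br_anti)
  ultimately show ?thesis by (simp add: algebra_simps)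
qed

lemma B_lin: "Vector_Spaces.linear (*s) (*) (B x)" "Vector_Spaces.linear (*s) (*) (\<lambda>x. B x y)"
  using inv_form by (auto simp: invariant_form_def bilinear_map_def)

lemma B_simps:
  "B x (y + z) = B x y + B x z" "B (x + y) z = B x z + B y z"
  "B x (c *s y) = c * B x y" "B (c *s x) y = c * B x y"
  using B_lin[unfolded linear_form_iff] by simp_all

lemma B_zero [simp]: "B x 0 = 0" "B 0 x = 0"
  using B_simps(3)[of x 0 0] B_simps(4)[of 0 0 x] by simp_all

lemma B_minus: "B x (- y) = - B x y" "B (- x) y = - B x y"
  using B_simps(3)[of x "-1" y] B_simps(4)[of "-1" x y] by simp_all

lemma B_diff: "B x (y - z) = B x y - B x z" "B (x - y) z = B x z - B y z"
  using B_simps(1)[of x y "- z"] B_simps(2)[of x "- y" z] by (simp_all add: B_minus)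

lemma B_sum_right: "B x (\<Sum>i\<in>A. f i) = (\<Sum>i\<in>A. B x (f i))"
  using linear_form_sum[OF B_lin(1)] .

lemma B_sum_left: "B (\<Sum>i\<in>A. f i) y = (\<Sum>i\<in>A. B (f i) y)"
  using linear_form_sum[OF B_lin(2)] .

lemma B_sym: "B x y = B y x"
  and B_inv: "B (br x y) z = B x (br y z)"
  and B_nondeg: "(\<And>y. B x y = 0) \<Longrightarrow> x = 0"
  using inv_form by (auto simp: invariant_form_def)

lemma h_subspace: "vec.subspace h" and h_zero: "g (\<lambda>y. 0) = h"
  and span_weights: "vec.span (\<Union>\<beta>. g \<beta>) = UNIV"
  and base: "root_base br h \<Gamma>"
  using pin by (auto simp: pinning_def split_cartan_def)

lemma h_comm: "y \<in> h \<Longrightarrow> z \<in> h \<Longrightarrow> br y z = 0"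
  using h_zero by (auto simp: root_space_def)

lemma weightD: "x \<in> g \<beta> \<Longrightarrow> y \<in> h \<Longrightarrow> br y x = \<beta> y *s x"
  by (simp add: root_space_def)

lemma weight_space_subspace: "vec.subspace (g \<beta>)"
  unfolding vec.subspace_def root_space_def by (auto simp: br_simps vec.scale_right_distrib mult.commute)

lemma weight_br:
  assumes "x \<in> g \<beta>" "z \<in> g \<delta>" shows "br x z \<in> g (\<lambda>y. \<beta> y + \<delta> y)"
  using assms unfolding root_space_def
  by (auto simp: jacobi[of _ x z] br_simps vec.scale_left_distrib)

lemma weight_cong: "(\<And>y. y \<in> h \<Longrightarrow> \<beta> y = \<delta> y) \<Longrightarrow> g \<beta> = g \<delta>"
  by (auto simp: root_space_def)

lemma root_outside: "\<beta> \<in> R \<Longrightarrow> y \<notin> h \<Longrightarrow> \<beta> y = 0"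
  and root_nonzero: "\<beta> \<in> R \<Longrightarrow> \<beta> \<noteq> (\<lambda>y. 0)"
  by (auto simp: roots_def)

lemma Xr_weight: "\<beta> \<in> R \<Longrightarrow> Xr \<beta> \<in> g \<beta>"
  and Xr_pair: "\<beta> \<in> R \<Longrightarrow> B (Xr \<beta>) (Xr (- \<beta>)) = 1"
  using root_vecs by (auto simp: root_vectors_def)

lemma B_weights:
  assumes "x \<in> g \<beta>" "z \<in> g \<delta>" "y \<in> h" "\<beta> y + \<delta> y \<noteq> 0" shows "B x z = 0"
proof -
  have "\<beta> y * B x z = B (br y x) z" using assms by (simp add: weightD B_simps)
  also have "\<dots> = - B (br x y) z" by (subst br_anti) (simp add: B_minus)
  also have "\<dots> = - (\<delta> y * B x z)" using assms by (simp add: B_inv weightD B_simps)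
  finally have "(\<beta> y + \<delta> y) * B x z = 0" by (simp add: distrib_right)
  with assms(4) show ?thesis by simp
qed

lemma contract_casimir: "tcontr1 (\<lambda>y. B y x) (casimir B) = x"
proof -
  \<comment> \<open>The coordinates of the Casimir element form the inverse of this Gram matrix, and
    contraction with \<open>x\<close> multiplies them by \<open>G *v x\<close>. Nondegeneracy makes
    \<open>G\<close> injective, hence invertible; symmetry of \<open>B\<close> reconciles the
    transposed order of indices.\<close>
  define G where "G = (\<chi> i j. B (axis i 1) (axis j 1))"
  have Gv: "(G *v x) $ i = B (axis i 1) x" for x i
    using linear_form_expand[OF B_lin(1), of "axis i 1" x]
    by (simp add: G_def matrix_vector_mult_def mult.commute)
  have "x = 0" if "G *v x = 0" for x
  proof (rule B_nondeg)
    fix y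
    have "B y x = (\<Sum>i\<in>UNIV. y $ i * B (axis i 1) x)" by (rule linear_form_expand[OF B_lin(2)])
    then show "B x y = 0" using that by (simp add: B_sym[of x y] flip: Gv)
  qed
  then have "invertible G" by (simp add: invertible_left_inverse matrix_left_invertible_ker)
  then have 1: "G ** matrix_inv G = mat 1"
    unfolding invertible_def matrix_inv_def by (metis (mono_tags, lifting) someI_ex)
  have "transpose G = G" by (simp add: G_def transpose_def vec_eq_iff B_sym)
  with 1 have 2: "transpose (matrix_inv G) ** G = mat 1"
    by (metis matrix_transpose_mul transpose_mat)
  have "tcontr1 (\<lambda>y. B y x) (casimir B) $ j = x $ j" for j
  proof -
    have "tcontr1 (\<lambda>y. B y x) (casimir B) $ j =
      (\<Sum>i\<in>UNIV. \<Sum>k\<in>UNIV. if k = j then matrix_inv G $ i $ j * B (axis i 1) x else 0)"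
      unfolding tcontr1_def casimir_def G_def[symmetric]
      by (auto intro!: sum.cong simp: axis_def[of _ "1 :: 'k"] sum_component if_distrib
          cong: if_cong)
    also have "\<dots> = (\<Sum>i\<in>UNIV. matrix_inv G $ i $ j * (G *v x) $ i)" by (simp add: Gv)
    also have "\<dots> = (transpose (matrix_inv G) *v (G *v x)) $ j"
      by (simp add: matrix_vector_mult_def transpose_def)
    also have "\<dots> = x $ j" by (simp add: matrix_vector_mul_assoc 2)
    finally show ?thesis .
  qed
  then show ?thesis by (simp add: vec_eq_iff)
qed

lemma tcontr1_tensor_square:
  assumes f: "Vector_Spaces.linear (*s) (*) f" and T: "T \<in> tensor_square h"
  shows "tcontr1 f T \<in> h"
  using T unfolding tensor_square_def
  by (rule linear_span_subspace[OF linear_tcontr1 h_subspace, rotated])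
    (auto simp: tcontr1_tens[OF f] intro: vec.subspace_scale[OF h_subspace])

lemma flip_tensor_square: assumes T: "T \<in> tensor_square h" shows "flip T \<in> tensor_square h"
  using T unfolding tensor_square_def
proof (rule linear_span_subspace[OF linear_flip vec.subspace_span, rotated])
  fix S assume "S \<in> {tens x y |x y. x \<in> h \<and> y \<in> h}"
  then obtain x y where "S = tens x y" "x \<in> h" "y \<in> h" by blast
  then have "flip S \<in> {tens x y |x y. x \<in> h \<and> y \<in> h}" by (metis (mono_tags, lifting) flip_tens mem_Collect_eq)
  then show "flip S \<in> vec.span {tens x y |x y. x \<in> h \<and> y \<in> h}" by (rule vec.span_base)
qed

text \<open>Contract the Casimir element with \<open>x\<close>: the part
  \<open>r\<^sub>h + flip r\<^sub>h\<close> contributes a vector of \<open>h\<close>, and each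
  \<open>tens (Xr \<beta>) (Xr (- \<beta>))\<close> a multiple of one root vector.\<close>

lemma decomposition_neg: "\<exists>x0\<in>h. x = x0 + (\<Sum>\<beta>\<in>R. B (Xr \<beta>) x *s Xr (- \<beta>))"
proof -
  let ?c = "tcontr1 (\<lambda>y. B y x)"
  note c = linear_tcontr1[of "\<lambda>y. B y x"]
  have "casimir B = (r\<^sub>h + flip r\<^sub>h) + (\<Sum>\<beta>\<in>R. tens (Xr \<beta>) (Xr (- \<beta>)))"
    by (simp add: rh_Omega Omega_h_def)
  then have "?c (casimir B) = ?c (r\<^sub>h + flip r\<^sub>h) + (\<Sum>\<beta>\<in>R. B (Xr \<beta>) x *s Xr (- \<beta>))"
    using c by (simp add: linear_vec_iff linear_vec_sum tcontr1_tens B_lin)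
  moreover have "?c (r\<^sub>h + flip r\<^sub>h) \<in> h"
    by (rule tcontr1_tensor_square[OF B_lin(2)])
      (use rh_tensor flip_tensor_square[OF rh_tensor] in \<open>auto simp: tensor_square_def intro: vec.span_add\<close>)
  ultimately show ?thesis by (auto simp: contract_casimir)
qed

lemma finite_roots: "finite R"
proof (rule ccontr)
  assume "infinite R"
  \<comment> \<open>A sum over an infinite set is \<open>0\<close> by convention, so the
    decomposition would put the whole algebra into \<open>h\<close>.\<close>
  then have "x \<in> h" for x using decomposition_neg[of x] by auto
  then show False using nonabelian h_comm by metis
qed

lemma neg_neg [simp]: "- (- \<beta>) = (\<beta> :: 'k^'n \<Rightarrow> 'k)"
  by (simp add: fun_eq_iff)

lemma Xr_nonzero: assumes "\<beta> \<in> R" shows "Xr \<beta> \<noteq> 0" "Xr (- \<beta>) \<noteq> 0"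
  using Xr_pair[OF assms] by auto

text \<open>\<open>Xr (- \<beta>)\<close> is known to be a weight vector only once
  \<open>- \<beta>\<close> is a root. Its nonzero pairing with \<open>Xr \<beta>\<close> is
  therefore moved to some weight vector \<open>z\<close>, which exists because the weight spaces
  span; orthogonality then forces the weight of \<open>z\<close> to be \<open>- \<beta>\<close> on
  \<open>h\<close>.\<close>

lemma root_neg: assumes "\<beta> \<in> R" shows "- \<beta> \<in> R"
proof -
  have "\<exists>\<delta> z. z \<in> g \<delta> \<and> B (Xr \<beta>) z \<noteq> 0"
  proof (rule ccontr)
    assume "\<nexists>\<delta> z. z \<in> g \<delta> \<and> B (Xr \<beta>) z \<noteq> 0"
    then have "(\<Union>\<beta>. g \<beta>) \<subseteq> {z. B (Xr \<beta>) z = 0}" by auto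
    then have "vec.span (\<Union>\<beta>. g \<beta>) \<subseteq> {z. B (Xr \<beta>) z = 0}"
      by (rule vec.span_minimal) (auto simp: vec.subspace_def B_simps)
    then have "Xr (- \<beta>) \<in> {z. B (Xr \<beta>) z = 0}" using span_weights by blast
    then show False using Xr_pair[OF assms] by simp
  qed
  then obtain \<delta> z where z: "z \<in> g \<delta>" "B (Xr \<beta>) z \<noteq> 0" by auto
  then have "\<beta> y + \<delta> y = 0" if "y \<in> h" for y
    using B_weights[OF Xr_weight[OF assms] z(1) that] by auto
  then have "g \<delta> = g (- \<beta>)" by (intro weight_cong) (simp add: eq_neg_iff_add_eq_0 add.commute)
  with z have "z \<in> g (- \<beta>)" "z \<noteq> 0" by auto
  then show ?thesis using root_outside[OF assms] root_nonzero[OF assms] unfolding roots_def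
    by (auto simp: fun_eq_iff)
qed

lemma Xr_pair': "\<beta> \<in> R \<Longrightarrow> B (Xr (- \<beta>)) (Xr \<beta>) = 1"
  using Xr_pair B_sym by simp

lemma decomposition: "\<exists>x0\<in>h. x = x0 + (\<Sum>\<beta>\<in>R. B (Xr (- \<beta>)) x *s Xr \<beta>)"
proof -
  have "(\<Sum>\<beta>\<in>R. B (Xr \<beta>) x *s Xr (- \<beta>)) = (\<Sum>\<beta>\<in>R. B (Xr (- \<beta>)) x *s Xr \<beta>)"
    by (rule sum.reindex_bij_witness[of _ uminus uminus]) (auto simp: root_neg)
  then show ?thesis using decomposition_neg[of x] by simp
qed

text \<open>Weights are compared as functions on the whole space, so the convention of vanishing
  outside \<open>h\<close> is carried along for \<delta>; on \<open>h\<close> the nonzero pairing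
  forces equality.\<close>

lemma B_weight_eq:
  assumes "\<beta> \<in> R" "\<And>y. y \<notin> h \<Longrightarrow> \<delta> y = 0" "x \<in> g \<delta>" "B (Xr (- \<beta>)) x \<noteq> 0"
  shows "\<delta> = \<beta>"
proof
  fix y
  show "\<delta> y = \<beta> y"
    using B_weights[OF Xr_weight[OF root_neg[OF assms(1)]] assms(3), of y] assms(2)[of y] assms(4)
      root_outside[OF assms(1), of y] by (cases "y \<in> h") auto
qed

text \<open>Only the term of \<delta> survives in the decomposition of \<open>x\<close>. The
  component in \<open>h\<close> then also has weight \<delta>, yet \<open>h\<close> kills it, and
  \<delta> is nonzero somewhere on \<open>h\<close>.\<close>

lemma weight_space_root: assumes "x \<in> g \<delta>" "\<delta> \<in> R" shows "x = B (Xr (- \<delta>)) x *s Xr \<delta>"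
proof -
  obtain x0 where x0: "x0 \<in> h" "x = x0 + (\<Sum>\<beta>\<in>R. B (Xr (- \<beta>)) x *s Xr \<beta>)"
    using decomposition by blast
  have "(\<Sum>\<beta>\<in>R. B (Xr (- \<beta>)) x *s Xr \<beta>) = (\<Sum>\<beta>\<in>R. if \<beta> = \<delta> then B (Xr (- \<beta>)) x *s Xr \<beta> else 0)"
    by (intro sum.cong) (use B_weight_eq[OF _ root_outside[OF assms(2)] assms(1)] in auto)
  also have "\<dots> = B (Xr (- \<delta>)) x *s Xr \<delta>" using assms(2) finite_roots by simp
  finally have e: "x = x0 + B (Xr (- \<delta>)) x *s Xr \<delta>" using x0(2) by simp
  then have "x0 = x - B (Xr (- \<delta>)) x *s Xr \<delta>" by (metis add_diff_cancel_right')
  then have "x0 \<in> g \<delta>" using assms Xr_weight[OF assms(2)] weight_space_subspace[of \<delta>]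
    by (auto intro: vec.subspace_diff vec.subspace_scale)
  obtain y where y: "\<delta> y \<noteq> 0" using root_nonzero[OF assms(2)] by blast
  then have "y \<in> h" using root_outside[OF assms(2)] by blast
  then have "x0 = 0" using weightD[OF \<open>x0 \<in> g \<delta>\<close>] h_comm[OF _ x0(1)] y
    by (metis vec.scale_eq_0_iff)
  with e show ?thesis by simp
qed

lemma weight_space_nonroot:
  assumes "x \<in> g \<delta>" "\<delta> \<notin> R" "\<And>y. y \<notin> h \<Longrightarrow> \<delta> y = 0" "\<delta> \<noteq> (\<lambda>y. 0)" shows "x = 0"
  using assms by (auto simp: roots_def)

text \<open>This vector represents \<beta> under \<open>B\<close>, see \<open>B_t\<close>; the
  coroot is \<open>2 / \<beta> (t \<beta>)\<close> times it.\<close>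

definition t :: "('k^'n \<Rightarrow> 'k) \<Rightarrow> 'k^'n" where "t \<beta> = br (Xr \<beta>) (Xr (- \<beta>))"

lemma t_in_h: assumes "\<beta> \<in> R" shows "t \<beta> \<in> h"
proof -
  have "t \<beta> \<in> g (\<lambda>y. \<beta> y + (- \<beta>) y)" unfolding t_def
    using assms by (intro weight_br Xr_weight root_neg)
  then show ?thesis by (simp add: h_zero)
qed

lemma B_t: assumes "\<beta> \<in> R" "y \<in> h" shows "B (t \<beta>) y = \<beta> y"
proof -
  have "B (t \<beta>) y = B (Xr \<beta>) (br (Xr (- \<beta>)) y)" by (simp add: t_def B_inv)
  also have "br (Xr (- \<beta>)) y = \<beta> y *s Xr (- \<beta>)"
    using weightD[OF Xr_weight[OF root_neg[OF assms(1)]] assms(2)] by (subst br_anti) simp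
  finally show ?thesis by (simp add: B_simps Xr_pair assms)
qed

lemma centre_trivial: assumes "\<And>x. br z x = 0" shows "z = 0"
proof -
  let ?I = "{z. \<forall>x. br z x = 0}"
  have "lie_ideal br ?I" unfolding lie_ideal_def vec.subspace_def
  proof (intro conjI allI ballI)
    fix x y assume "y \<in> ?I"
    then have "br x y = 0" by (subst br_anti) simp
    then show "br x y \<in> ?I" by simp
  qed (auto simp: br_simps)
  then have "?I = {0}" using ideal_trivial nonabelian by auto
  then show ?thesis using assms by auto
qed

text \<open>By the decomposition such a \<open>y\<close> commutes with everything, and a simple
  algebra has trivial centre.\<close>

lemma roots_separate: assumes "y \<in> h" "\<And>\<beta>. \<beta> \<in> R \<Longrightarrow> \<beta> y = 0" shows "y = 0"
proof (rule centre_trivial)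
  fix x
  obtain x0 where "x0 \<in> h" "x = x0 + (\<Sum>\<beta>\<in>R. B (Xr (- \<beta>)) x *s Xr \<beta>)"
    using decomposition by blast
  then have "br y x = (\<Sum>\<beta>\<in>R. B (Xr (- \<beta>)) x *s br y (Xr \<beta>))"
    using h_comm[OF assms(1)] by (metis (no_types, lifting) add_0 br_simps(1,3) br_sum_right sum.cong)
  also have "\<dots> = 0" by (intro sum.neutral) (simp add: weightD[OF Xr_weight assms(1)] assms(2))
  finally show "br y x = 0" .
qed

lemma roots_nonempty: "R \<noteq> {}"
proof
  assume "R = {}"
  then have "x \<in> h" for x using decomposition[of x] by auto
  then show False using nonabelian h_comm by metis
qed

end

section \<open>Traces and the Killing form\<close>

context pinned_lie begin

text \<open>The sum is the trace of the commutator \<open>ad [X\<^sub>\<gamma>, X\<^sub>-\<^sub>\<gamma>]\<close> on the span of the root vectors of \<open>N\<close>.\<close>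

lemma trace_coroot_zero:
  assumes N: "N \<subseteq> R" and \<gamma>: "\<gamma> \<in> R"
    and up: "\<And>\<beta>. \<beta> \<in> N \<Longrightarrow> br (Xr \<gamma>) (Xr \<beta>) \<noteq> 0 \<Longrightarrow> (\<lambda>y. \<beta> y + \<gamma> y) \<in> N"
    and down: "\<And>\<beta>. \<beta> \<in> N \<Longrightarrow> br (Xr (- \<gamma>)) (Xr \<beta>) \<noteq> 0 \<Longrightarrow> (\<lambda>y. \<beta> y - \<gamma> y) \<in> N"
  shows "(\<Sum>\<beta>\<in>N. \<beta> (t \<gamma>)) = 0"
proof -
  \<comment> \<open>Moving one factor across the invariant form shows that
    \<open>- T1 \<beta>\<close> and \<open>- T2 \<beta>\<close> are the diagonal entries at \<beta>
    of the two products of \<open>br (Xr \<gamma>)\<close> and \<open>br (Xr (- \<gamma>))\<close>,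
    the former with \<open>br (Xr (- \<gamma>))\<close> applied first.\<close>
  define T1 where "T1 \<beta> = B (br (Xr (- \<gamma>)) (Xr \<beta>)) (br (Xr \<gamma>) (Xr (- \<beta>)))" for \<beta>
  define T2 where "T2 \<beta> = B (br (Xr \<gamma>) (Xr \<beta>)) (br (Xr (- \<gamma>)) (Xr (- \<beta>)))" for \<beta>
  let ?u = "\<lambda>\<beta> y. \<beta> y + \<gamma> y" and ?d = "\<lambda>\<beta> y. \<beta> y - \<gamma> y"
  have fN: "finite N" using N finite_roots finite_subset by blast
  have eq: "\<beta> (t \<gamma>) = T2 \<beta> - T1 \<beta>" if "\<beta> \<in> N" for \<beta>
  proof -
    have b: "\<beta> \<in> R" using that N by auto
    have swap: "B (br (Xr \<delta>) z) w = - B z (br (Xr \<delta>) w)" for \<delta> z w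
      by (subst br_anti) (simp add: B_minus B_inv)
    have "\<beta> (t \<gamma>) = B (br (t \<gamma>) (Xr \<beta>)) (Xr (- \<beta>))"
      using weightD[OF Xr_weight[OF b] t_in_h[OF \<gamma>]] by (simp add: B_simps Xr_pair[OF b])
    also have "br (t \<gamma>) (Xr \<beta>) = br (Xr \<gamma>) (br (Xr (- \<gamma>)) (Xr \<beta>)) - br (Xr (- \<gamma>)) (br (Xr \<gamma>) (Xr \<beta>))"
      unfolding t_def jacobi[of "Xr \<gamma>"] by simp
    finally show ?thesis unfolding T1_def T2_def B_diff swap
      by (simp only: minus_minus diff_minus_eq_add) (simp only: diff_conv_add_uminus add.commute)
  qed
  \<comment> \<open>Both sides are, up to two cancelling signs, the product of the same two
    structure constants, those of the step between \<open>\<beta> - \<gamma>\<close> and \<beta>.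
    Steps leaving \<open>N\<close> contribute nothing, so the two sums agree.\<close>
  have shift: "T2 (?d \<beta>) = T1 \<beta>" if b: "\<beta> \<in> N" "?d \<beta> \<in> N" for \<beta>
  proof -
    have R: "\<beta> \<in> R" "- \<beta> \<in> R" "?d \<beta> \<in> R" "- ?d \<beta> \<in> R" "- \<gamma> \<in> R"
      using N b \<gamma> root_neg by auto
    have m: "(\<lambda>y. \<beta> y - \<gamma> y) = (\<lambda>y. (- \<gamma>) y + \<beta> y)" "(- ?d \<beta>) = (\<lambda>y. \<gamma> y + (- \<beta>) y)"
      "\<beta> = (\<lambda>y. \<gamma> y + ?d \<beta> y)" "- \<beta> = (\<lambda>y. (- \<gamma>) y + (- ?d \<beta>) y)" by (auto simp: fun_eq_iff)
    have 1: "br (Xr (- \<gamma>)) (Xr \<beta>) = B (Xr (- ?d \<beta>)) (br (Xr (- \<gamma>)) (Xr \<beta>)) *s Xr (?d \<beta>)"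
      using weight_space_root[OF _ R(3)] weight_br[OF Xr_weight[OF R(5)] Xr_weight[OF R(1)]] m(1)
      by metis
    have 2: "br (Xr \<gamma>) (Xr (- \<beta>)) = B (Xr (?d \<beta>)) (br (Xr \<gamma>) (Xr (- \<beta>))) *s Xr (- ?d \<beta>)"
      using weight_space_root[OF _ R(4)] weight_br[OF Xr_weight[OF \<gamma>] Xr_weight[OF R(2)]] m(2)
      by (metis neg_neg)
    have 3: "br (Xr \<gamma>) (Xr (?d \<beta>)) = B (Xr (- \<beta>)) (br (Xr \<gamma>) (Xr (?d \<beta>))) *s Xr \<beta>"
      using weight_space_root[OF _ R(1)] weight_br[OF Xr_weight[OF \<gamma>] Xr_weight[OF R(3)]] m(3)
      by metis
    have 4: "br (Xr (- \<gamma>)) (Xr (- ?d \<beta>)) = B (Xr \<beta>) (br (Xr (- \<gamma>)) (Xr (- ?d \<beta>))) *s Xr (- \<beta>)"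
      using weight_space_root[OF _ R(2)] weight_br[OF Xr_weight[OF R(5)] Xr_weight[OF R(4)]] m(4)
      by (metis neg_neg)
    have swap: "B x (br y z) = - B z (br y x)" for x y z
      by (subst B_sym, subst br_anti) (simp add: B_minus B_inv)
    show ?thesis unfolding T1_def T2_def
      by (subst 1, subst 2, subst 3, subst 4)
        (simp add: B_simps B_minus Xr_pair[OF R(1)] Xr_pair[OF R(3)] swap[of "Xr (- ?d \<beta>)"]
          swap[of "Xr (?d \<beta>)"])
  qed
  have z1: "T1 \<beta> = 0" if "\<beta> \<in> N" "?d \<beta> \<notin> N" for \<beta>
    using down[OF that(1)] that(2) unfolding T1_def by (metis B_zero(2))
  have z2: "T2 \<beta> = 0" if "\<beta> \<in> N" "?u \<beta> \<notin> N" for \<beta>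
    using up[OF that(1)] that(2) unfolding T2_def by (metis B_zero(2))
  have "(\<Sum>\<beta>\<in>N. T1 \<beta>) = (\<Sum>\<beta>\<in>{\<beta>\<in>N. ?d \<beta> \<in> N}. T1 \<beta>)"
    by (rule sum.mono_neutral_right[OF fN]) (use z1 in auto)
  also have "\<dots> = (\<Sum>\<beta>\<in>{\<beta>\<in>N. ?u \<beta> \<in> N}. T2 \<beta>)"
    by (rule sum.reindex_bij_witness[of _ ?u ?d]) (auto simp: shift)
  also have "\<dots> = (\<Sum>\<beta>\<in>N. T2 \<beta>)"
    by (rule sum.mono_neutral_left[OF fN]) (use z2 in auto)
  finally show ?thesis by (simp add: eq sum_subtractf)
qed

lemma br_Xr_weight_cases:
  assumes "\<beta> \<in> R" "\<delta> \<in> R" "br (Xr \<beta>) (Xr \<delta>) \<noteq> 0"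
  shows "(\<lambda>y. \<delta> y + \<beta> y) \<in> R \<or> \<delta> = - \<beta>"
proof -
  have w: "br (Xr \<beta>) (Xr \<delta>) \<in> g (\<lambda>y. \<delta> y + \<beta> y)"
    using weight_br[OF Xr_weight[OF assms(1)] Xr_weight[OF assms(2)]] by (simp add: add.commute)
  show ?thesis
  proof (cases "(\<lambda>y. \<delta> y + \<beta> y) = (\<lambda>y. 0)")
    case True
    then have "\<delta> y + \<beta> y = 0" for y by meson
    then show ?thesis by (simp add: fun_eq_iff eq_neg_iff_add_eq_0)
  next
    case False
    show ?thesis
    proof (rule ccontr)
      assume "\<not> ?thesis"
      then have "br (Xr \<beta>) (Xr \<delta>) = 0"
        by (intro weight_space_nonroot[OF w _ _ False]) (simp_all add: root_outside assms(1,2))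
      then show False using assms(3) by simp
    qed
  qed
qed

text \<open>If \<gamma> vanishes on \<open>t \<gamma>\<close>, all roots of the string through
  \<beta> take the value \<open>\<beta> (t \<gamma>)\<close> there. The vanishing trace is then
  \<open>card ?N\<close> times this value, which is \<open>0\<close> in characteristic zero. So
  every root kills \<open>t \<gamma>\<close>, which forces \<open>t \<gamma> = 0\<close> and
  \<gamma> to vanish.\<close>

lemma root_norm_nonzero: assumes \<gamma>: "\<gamma> \<in> R" shows "\<gamma> (t \<gamma>) \<noteq> 0"
proof
  assume z: "\<gamma> (t \<gamma>) = 0"
  have "\<beta> (t \<gamma>) = 0" if \<beta>: "\<beta> \<in> R" for \<beta>
  proof (cases "\<exists>n::int. \<forall>y. \<beta> y = of_int n * \<gamma> y")
    case True
    then show ?thesis using z by auto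
  next
    case False
    let ?N = "{\<delta>\<in>R. \<exists>n::int. \<forall>y. \<delta> y = \<beta> y + of_int n * \<gamma> y}"
    \<comment> \<open>The string has to avoid \<gamma> and \<open>- \<gamma>\<close>: their root
      vectors can be bracketed into \<open>h\<close>, outside the span of the root vectors.\<close>
    have no: "\<delta> \<noteq> \<gamma>" "\<delta> \<noteq> - \<gamma>" if d: "\<delta> \<in> ?N" for \<delta>
    proof -
      obtain n :: int where n: "\<delta> y = \<beta> y + of_int n * \<gamma> y" for y using d by auto
      show "\<delta> \<noteq> \<gamma>"
      proof
        assume "\<delta> = \<gamma>"
        then have "\<forall>y. \<beta> y = of_int (1 - n) * \<gamma> y" using n by (metis add_diff_cancel_right' left_diff_distrib mult_1 of_int_1 of_int_diff)
        with False show False by blast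
      qed
      show "\<delta> \<noteq> - \<gamma>"
      proof
        assume "\<delta> = - \<gamma>"
        then have "\<beta> y = of_int (- 1 - n) * \<gamma> y" for y using n[of y] by (simp add: algebra_simps)
        with False show False by blast
      qed
    qed
    have "(\<Sum>\<delta>\<in>?N. \<delta> (t \<gamma>)) = 0"
    proof (rule trace_coroot_zero[OF _ \<gamma>])
      fix \<delta> assume d: "\<delta> \<in> ?N"
      then obtain n :: int where n: "\<delta> y = \<beta> y + of_int n * \<gamma> y" for y by auto
      show "(\<lambda>y. \<delta> y + \<gamma> y) \<in> ?N" if "br (Xr \<gamma>) (Xr \<delta>) \<noteq> 0"
        using br_Xr_weight_cases[OF \<gamma> _ that] no[OF d] d n
        by (auto intro!: exI[of _ "n + 1"] simp: algebra_simps)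
      show "(\<lambda>y. \<delta> y - \<gamma> y) \<in> ?N" if "br (Xr (- \<gamma>)) (Xr \<delta>) \<noteq> 0"
        using br_Xr_weight_cases[OF root_neg[OF \<gamma>] _ that] no[OF d] d n
        by (auto intro!: exI[of _ "n - 1"] simp: algebra_simps)
    qed auto
    moreover have "(\<Sum>\<delta>\<in>?N. \<delta> (t \<gamma>)) = (\<Sum>\<delta>\<in>?N. \<beta> (t \<gamma>))"
      by (rule sum.cong) (use z in auto)
    ultimately have "of_nat (card ?N) * \<beta> (t \<gamma>) = 0" by simp
    moreover have "\<beta> \<in> ?N" using \<beta> by (auto intro!: exI[of _ 0])
    then have "card ?N \<noteq> 0" using finite_roots by (auto simp: card_eq_0_iff)
    ultimately show ?thesis by simp
  qed
  then have "t \<gamma> = 0" by (rule roots_separate[OF t_in_h[OF \<gamma>]])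
  then have "\<gamma> y = 0" for y using B_t[OF \<gamma>, of y] root_outside[OF \<gamma>, of y] by (cases "y \<in> h") auto
  then show False using root_nonzero[OF \<gamma>] by auto
qed

text \<open>The \<open>f \<gamma>\<close> below is the negative Chevalley generator, so the split
  rational form contains it, \<open>Xr \<gamma>\<close>, and their bracket, the coroot. Rationality
  of \<open>B (Xr \<gamma>) (f \<gamma>)\<close> gives that of \<open>\<gamma> (t \<gamma>)\<close>,
  and pairing two coroots gives the mixed values.\<close>

lemma base_pairing_rational:
  assumes "\<gamma> \<in> \<Gamma>" "\<delta> \<in> \<Gamma>" shows "\<gamma> (t \<delta>) \<in> \<rat>"
proof -
  have R: "\<Gamma> \<subseteq> R" using base by (simp add: root_base_def)
  define f where "f \<gamma> = (2 / \<gamma> (t \<gamma>)) *s Xr (- \<gamma>)" for \<gamma>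
  have Q: "Xr \<gamma> \<in> split_Q_form br h \<Gamma> Xr" "f \<gamma> \<in> split_Q_form br h \<Gamma> Xr"
    "br (Xr \<gamma>) (f \<gamma>) = (2 / \<gamma> (t \<gamma>)) *s t \<gamma>" "B (Xr \<gamma>) (f \<gamma>) = 2 / \<gamma> (t \<gamma>)" if "\<gamma> \<in> \<Gamma>" for \<gamma>
  proof -
    have g: "\<gamma> \<in> R" using that R by auto
    show "Xr \<gamma> \<in> split_Q_form br h \<Gamma> Xr" by (rule split_Q_form.pos[OF that])
    show e: "br (Xr \<gamma>) (f \<gamma>) = (2 / \<gamma> (t \<gamma>)) *s t \<gamma>" by (simp add: f_def br_simps t_def)
    have lin: "\<gamma> (c *s y) = c * \<gamma> y" if "y \<in> h" for c y
      using B_t[OF g] that h_subspace by (metis B_simps(3) vec.subspace_scale)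
    show "f \<gamma> \<in> split_Q_form br h \<Gamma> Xr"
    proof (rule split_Q_form.neg[OF that])
      show "f \<gamma> \<in> g (- \<gamma>)" unfolding f_def
        by (intro vec.subspace_scale weight_space_subspace Xr_weight root_neg g)
      show "\<gamma> (br (Xr \<gamma>) (f \<gamma>)) = 2"
        using root_norm_nonzero[OF g] by (simp add: e lin t_in_h[OF g])
    qed
    show "B (Xr \<gamma>) (f \<gamma>) = 2 / \<gamma> (t \<gamma>)" by (simp add: f_def B_simps Xr_pair[OF g])
  qed
  have rat: "B x y \<in> \<rat>" if "x \<in> split_Q_form br h \<Gamma> Xr" "y \<in> split_Q_form br h \<Gamma> Xr" for x y
    using Q_form that by (auto simp: form_from_Q_def)
  have norm: "\<gamma> (t \<gamma>) \<in> \<rat>" if "\<gamma> \<in> \<Gamma>" for \<gamma>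
  proof -
    have "2 / \<gamma> (t \<gamma>) \<in> \<rat>" using rat[OF Q(1,2)[OF that]] Q(4)[OF that] by simp
    then have "2 / (2 / \<gamma> (t \<gamma>)) \<in> \<rat>" by (rule Rats_divide[rotated]) simp
    then show ?thesis by simp
  qed
  have g: "\<gamma> \<in> R" "\<delta> \<in> R" using assms R by auto
  have "B ((2 / \<gamma> (t \<gamma>)) *s t \<gamma>) ((2 / \<delta> (t \<delta>)) *s t \<delta>) \<in> \<rat>"
    using rat[OF split_Q_form.bracket[OF Q(1,2)[OF assms(1)]] split_Q_form.bracket[OF Q(1,2)[OF assms(2)]]]
      Q(3) assms by simp
  then have "(2 / \<gamma> (t \<gamma>)) * ((2 / \<delta> (t \<delta>)) * \<gamma> (t \<delta>)) \<in> \<rat>"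
    by (simp only: B_simps B_t[OF g(1) t_in_h[OF g(2)]] mult.left_commute)
  then have "(\<gamma> (t \<gamma>) / 2) * ((\<delta> (t \<delta>) / 2) * ((2 / \<gamma> (t \<gamma>)) * ((2 / \<delta> (t \<delta>)) * \<gamma> (t \<delta>)))) \<in> \<rat>"
    by (intro Rats_mult[OF Rats_divide[OF norm[OF assms(1)]]]
        Rats_mult[OF Rats_divide[OF norm[OF assms(2)]]]) (assumption | simp)+
  then show ?thesis using root_norm_nonzero[OF g(1)] root_norm_nonzero[OF g(2)] by simp
qed

section \<open>The Killing form\<close>

definition killing :: "'k^'n \<Rightarrow> 'k^'n \<Rightarrow> 'k" where
  "killing x y = trace (matrix (br x) ** matrix (br y))"

lemma matrix_br: "matrix (br x \<circ> br y) = matrix (br x) ** matrix (br y)"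
  by (rule matrix_compose_gen) (use br_lin in \<open>auto simp: linear_vec_iff intro!: br_lin\<close>)

lemma matrix_simps:
  "matrix (\<lambda>x. f x + f' x) = matrix f + matrix f'" "matrix (\<lambda>x. f x - f' x) = matrix f - matrix f'"
  "matrix (\<lambda>x. c *s f x) = (\<chi> i j. c * matrix f $ i $ j)"
  by (auto simp: matrix_def vec_eq_iff)

lemma trace_matrix_scale: "trace ((\<chi> i j. c * A $ i $ j) ** C) = c * trace (A ** (C :: 'k^'n^'n))"
  by (simp add: trace_def matrix_matrix_mult_def sum_distrib_left mult.assoc)

lemma matrix_add_rdistrib: "(A + A') ** C = A ** C + A' ** (C :: 'k^'n^'n)"
  and matrix_diff_rdistrib: "(A - A') ** C = A ** C - A' ** (C :: 'k^'n^'n)"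
  and matrix_diff_ldistrib: "C ** (A - A') = C ** A - C ** (A' :: 'k^'n^'n)"
  by (simp_all add: vec_eq_iff matrix_matrix_mult_def algebra_simps sum.distrib sum_subtractf)

lemma killing_sym: "killing x y = killing y x"
  unfolding killing_def by (rule trace_mul_sym)

lemma killing_simps:
  "killing (x + y) z = killing x z + killing y z" "killing (c *s x) z = c * killing x z"
  "killing x (y + z) = killing x y + killing x z" "killing x (c *s y) = c * killing x y"
proof -
  have b: "br (x + y) = (\<lambda>z. br x z + br y z)" "br (c *s x) = (\<lambda>z. c *s br x z)" for x y c
    by (auto simp: br_simps)
  show l: "killing (x + y) z = killing x z + killing y z" "killing (c *s x) z = c * killing x z" for x y z c
    unfolding killing_def b matrix_simps
    by (simp_all add: matrix_add_rdistrib trace_add trace_matrix_scale)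
  show "killing x (y + z) = killing x y + killing x z" "killing x (c *s y) = c * killing x y"
    using l killing_sym by metis+
qed

lemma matrix_br_br: "matrix (br (br x y)) = matrix (br x) ** matrix (br y) - matrix (br y) ** matrix (br x)"
proof -
  have "br (br x y) = (\<lambda>z. (br x \<circ> br y) z - (br y \<circ> br x) z)"
    using jacobi[of x y] by (auto simp: fun_eq_iff)
  then show ?thesis by (simp only: matrix_simps matrix_br)
qed

lemma killing_inv: "killing (br x y) z = killing x (br y z)"
proof -
  let ?x = "matrix (br x)" and ?y = "matrix (br y)" and ?z = "matrix (br z)"
  have "trace (?y ** ?x ** ?z) = trace (?x ** (?z ** ?y))"
    by (subst matrix_mul_assoc[symmetric], subst trace_mul_sym) (simp only: matrix_mul_assoc)
  then show ?thesis
    by (simp add: killing_def matrix_br_br matrix_diff_rdistrib matrix_diff_ldistrib trace_sub matrix_mul_assoc)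
qed

lemma killing_aut: assumes "\<phi> \<in> lie_aut br" shows "killing (\<phi> x) (\<phi> y) = killing x y"
proof -
  note l = lie_autD(1)[OF assms]
  note li = linear_vec_inv[OF l lie_autD(2)[OF assms]]
  let ?i = "inv_into UNIV \<phi>"
  have i: "?i \<circ> \<phi> = id" "\<phi> \<circ> ?i = id" using lie_autD(2)[OF assms]
    by (auto simp: fun_eq_iff bij_is_inj bij_is_surj surj_f_inv_f)
  have b: "br (\<phi> x) = \<phi> \<circ> br x \<circ> ?i" for x
  proof
    fix z
    have "br (\<phi> x) z = br (\<phi> x) (\<phi> (?i z))" using i(2) by (metis comp_apply id_apply)
    then show "br (\<phi> x) z = (\<phi> \<circ> br x \<circ> ?i) z" by (simp add: lie_autD(3)[OF assms])
  qed
  have "killing (\<phi> x) (\<phi> y) = trace (matrix (br (\<phi> x) \<circ> br (\<phi> y)))"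
    by (simp add: killing_def matrix_br)
  also have "br (\<phi> x) \<circ> br (\<phi> y) = \<phi> \<circ> ((br x \<circ> br y) \<circ> ?i)"
    unfolding b using i by (auto simp: fun_eq_iff)
  also have "trace (matrix \<dots>) = trace (matrix \<phi> ** (matrix (br x \<circ> br y) ** matrix ?i))"
    by (simp only: matrix_compose_gen[OF li linear_vec_comp[OF br_lin(1) br_lin(1)]]
        matrix_compose_gen[OF linear_vec_comp[OF linear_vec_comp[OF br_lin(1) br_lin(1)] li] l])
  also have "\<dots> = trace (matrix (br x \<circ> br y) ** (matrix ?i ** matrix \<phi>))"
    by (subst trace_mul_sym) (simp only: matrix_mul_assoc)
  also have "matrix ?i ** matrix \<phi> = mat 1"
    unfolding matrix_compose_gen[OF l li, symmetric] i by (rule matrix_id_mat_1)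
  finally show ?thesis unfolding killing_def by (simp only: matrix_br matrix_mul_rid)
qed

text \<open>By the decomposition, \<open>br y \<circ> br z\<close> is a combination of the operators
  \<open>\<lambda>x. B (Xr (- \<beta>)) x *s Xr \<beta>\<close>, each of rank one and trace
  \<open>1\<close>, with coefficients \<open>\<beta> y * \<beta> z\<close>.\<close>

lemma killing_h:
  assumes "y \<in> h" "z \<in> h" shows "killing y z = (\<Sum>\<beta>\<in>R. \<beta> y * \<beta> z)"
proof -
  have e: "br y (br z x) = (\<Sum>\<beta>\<in>R. (\<beta> y * \<beta> z) *s (B (Xr (- \<beta>)) x *s Xr \<beta>))" for x
  proof -
    obtain x0 where x: "x0 \<in> h" "x = x0 + (\<Sum>\<beta>\<in>R. B (Xr (- \<beta>)) x *s Xr \<beta>)"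
      using decomposition by blast
    have "br y (br z x) = br y (br z (\<Sum>\<beta>\<in>R. B (Xr (- \<beta>)) x *s Xr \<beta>))"
      by (subst x(2)) (simp add: br_simps h_comm[OF assms(2) x(1)])
    also have "\<dots> = (\<Sum>\<beta>\<in>R. (\<beta> y * \<beta> z) *s (B (Xr (- \<beta>)) x *s Xr \<beta>))"
      by (simp add: br_sum_right br_simps weightD[OF Xr_weight] assms mult_ac)
    finally show ?thesis .
  qed
  have "killing y z = (\<Sum>i\<in>UNIV. br y (br z (axis i 1)) $ i)"
    unfolding killing_def matrix_br[symmetric] by (simp add: trace_def matrix_def)
  also have "\<dots> = (\<Sum>\<beta>\<in>R. \<Sum>i\<in>UNIV. (\<beta> y * \<beta> z) * (Xr \<beta> $ i * B (Xr (- \<beta>)) (axis i 1)))"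
    unfolding e by (simp add: sum_component mult_ac) (rule sum.swap)
  also have "\<dots> = (\<Sum>\<beta>\<in>R. (\<beta> y * \<beta> z) * B (Xr (- \<beta>)) (Xr \<beta>))"
    by (simp add: linear_form_expand[OF B_lin(1), of _ "Xr _"] sum_distrib_left)
  also have "\<dots> = (\<Sum>\<beta>\<in>R. \<beta> y * \<beta> z)" by (simp add: Xr_pair')
  finally show ?thesis .
qed

end

text \<open>The field need not be ordered, but the values come from the rationals, which
  are.\<close>

lemma sum_squares_rational_zero:
  fixes f :: "'b \<Rightarrow> 'a::field_char_0"
  assumes "finite A" "\<And>a. a \<in> A \<Longrightarrow> f a \<in> \<rat>" "(\<Sum>a\<in>A. f a * f a) = 0" "a \<in> A"
  shows "f a = 0"
proof -
  have "\<forall>a\<in>A. \<exists>q. f a = of_rat q" using assms(2) by (auto elim: Rats_cases)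
  then obtain q where q: "\<And>a. a \<in> A \<Longrightarrow> f a = of_rat (q a)" by (auto dest: bchoice)
  have "of_rat (\<Sum>a\<in>A. q a * q a) = (\<Sum>a\<in>A. f a * f a)"
    by (simp add: of_rat_sum of_rat_mult q)
  then have "(\<Sum>a\<in>A. q a * q a) = 0" using assms(3) by simp
  then have "q a * q a = 0" using assms(1,4) by (subst (asm) sum_nonneg_eq_0_iff) auto
  then show ?thesis using q[OF assms(4)] by simp
qed

section \<open>Integer combinations\<close>

lemma zcomb_add: "zcomb (\<lambda>s. c s + d s) f S y = zcomb c f S y + zcomb d f S y"
  by (simp add: zcomb_def distrib_right sum.distrib)

lemma zcomb_neg: "zcomb (\<lambda>s. - c s) f S = - zcomb c f S"
  by (simp add: zcomb_def fun_eq_iff sum_negf)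

lemma zcomb_single:
  assumes "finite S" "s \<in> S" shows "zcomb (\<lambda>x. if x = s then n else 0) f S y = of_int n * f s y"
  using assms by (simp add: zcomb_def if_distrib[of of_int] if_distrib[of "\<lambda>c. c * _"] cong: if_cong)

lemma zcomb_cong: "(\<And>s. s \<in> S \<Longrightarrow> c s = d s) \<Longrightarrow> zcomb c f S = zcomb d f S"
  by (simp add: zcomb_def)

lemma zcomb_fun_cong: "(\<And>s. s \<in> S \<Longrightarrow> f s = f' s) \<Longrightarrow> zcomb c f S = zcomb c f' S"
  by (simp add: zcomb_def)

lemma zcomb_extend:
  assumes "finite T" "S \<subseteq> T"
  shows "zcomb c f S = zcomb (\<lambda>s. if s \<in> S then c s else 0) f T"
  unfolding zcomb_def
  by (rule ext, rule sum.mono_neutral_cong_left) (use assms in auto)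

lemma zcomb_reindex:
  assumes "bij_betw f A A'" shows "zcomb (\<lambda>x. c (f x)) (\<lambda>x. F (f x)) A = zcomb c F A'"
  unfolding zcomb_def by (rule ext) (rule sum.reindex_bij_betw[OF assms])

lemma zcomb_reindex_inv:
  assumes "bij_betw f A A'" shows "zcomb c (\<lambda>x. F (f x)) A = zcomb (\<lambda>x. c (inv_into A f x)) F A'"
  using zcomb_reindex[OF assms, of "\<lambda>x. c (inv_into A f x)" F]
    bij_betw_inv_into_left[OF assms] by (simp cong: zcomb_cong)

lemma lie_subalg_hull: "lie_subalg br (lie_subalg br hull S)"
proof (rule hull_in)
  show "lie_subalg br (\<Inter> T)" if "Ball T (lie_subalg br)" for T
    using that unfolding lie_subalg_def vec.subspace_def by auto
qed

context pinned_lie begin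

section \<open>Proportionality of the Killing form and \<open>B\<close>\<close>

lemma killing_weights:
  assumes "x \<in> g \<beta>" "z \<in> g \<delta>" "y \<in> h" "\<beta> y + \<delta> y \<noteq> 0" shows "killing x z = 0"
proof -
  have neg: "killing (- u) w = - killing u w" for u w using killing_simps(2)[of "-1" u w] by simp
  have "\<beta> y * killing x z = killing (br y x) z" using assms by (simp add: weightD killing_simps)
  also have "\<dots> = - killing (br x y) z" by (subst br_anti) (simp add: neg)
  also have "\<dots> = - (\<delta> y * killing x z)" using assms by (simp add: killing_inv weightD killing_simps)
  finally have "(\<beta> y + \<delta> y) * killing x z = 0" by (simp add: distrib_right)
  with assms(4) show ?thesis by simp
qed

lemma base_roots: "\<Gamma> \<subseteq> R" and finite_base: "finite \<Gamma>"
  using base finite_roots finite_subset by (auto simp: root_base_def)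

lemma base_indep:
  assumes "\<And>y. y \<in> h \<Longrightarrow> (\<Sum>\<gamma>\<in>\<Gamma>. c \<gamma> * \<gamma> y) = 0" "\<gamma> \<in> \<Gamma>" shows "c \<gamma> = 0"
proof -
  have "\<forall>c :: _ \<Rightarrow> 'k. (\<forall>y\<in>h. (\<Sum>\<gamma>\<in>\<Gamma>. c \<gamma> * \<gamma> y) = 0) \<longrightarrow> (\<forall>\<gamma>\<in>\<Gamma>. c \<gamma> = 0)"
    using base by (simp add: root_base_def)
  then show ?thesis using assms by blast
qed

lemma base_coeffs:
  assumes "\<beta> \<in> R"
  obtains c where "\<beta> = zcomb c id \<Gamma>" "(\<forall>\<gamma>\<in>\<Gamma>. 0 \<le> c \<gamma>) \<or> (\<forall>\<gamma>\<in>\<Gamma>. c \<gamma> \<le> 0)"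
  using base assms unfolding root_base_def by blast

text \<open>The integers embed into a field of characteristic zero, so independence of the base over
  the field determines integer coefficients.\<close>

lemma zcomb_eqD:
  assumes S: "S \<subseteq> \<Gamma>" and eq: "\<And>y. y \<in> h \<Longrightarrow> zcomb c id S y = zcomb d id S y" and "\<gamma> \<in> S"
  shows "c \<gamma> = d \<gamma>"
proof -
  let ?e = "\<lambda>s. if s \<in> S then c s - d s else 0"
  have "(\<Sum>\<gamma>\<in>\<Gamma>. of_int (?e \<gamma>) * \<gamma> y) = 0" if "y \<in> h" for y
  proof -
    have "zcomb ?e id \<Gamma> y = zcomb (\<lambda>s. c s + - d s) id S y"
      using zcomb_extend[OF finite_base S, of "\<lambda>s. c s - d s" id] by simp
    also have "\<dots> = zcomb c id S y - zcomb d id S y"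
      unfolding zcomb_add zcomb_neg by simp
    finally show ?thesis using eq[OF that] by (simp add: zcomb_def)
  qed
  then have "of_int (?e \<gamma>) = (0 :: 'k)"
    using assms(3) S by (intro base_indep[of "\<lambda>\<gamma>. of_int (?e \<gamma>)"]) auto
  then show ?thesis using assms(3) by simp
qed

lemma zcomb_outside:
  assumes "S \<subseteq> \<Gamma>" "y \<notin> h" shows "zcomb c id S y = 0"
  using assms base_roots root_outside by (auto simp: zcomb_def intro!: sum.neutral)

text \<open>The definition of \<open>roots\<close> speaks of arbitrary functions; linearity on
  \<open>h\<close> is read off from the representing vector \<open>t \<beta>\<close>.\<close>

lemma root_lin: assumes "\<beta> \<in> R"
  shows "y \<in> h \<Longrightarrow> \<beta> (c *s y) = c * \<beta> y" "(\<And>i. i \<in> A \<Longrightarrow> f i \<in> h) \<Longrightarrow> \<beta> (\<Sum>i\<in>A. f i) = (\<Sum>i\<in>A. \<beta> (f i))"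
  using h_subspace
  by (simp_all flip: B_t[OF assms] add: vec.subspace_scale vec.subspace_sum B_simps B_sum_right)

lemma root_t_rational: assumes "\<beta> \<in> R" "\<gamma> \<in> \<Gamma>" shows "\<beta> (t \<gamma>) \<in> \<rat>"
proof -
  obtain c where "\<beta> = zcomb c id \<Gamma>" using base_coeffs[OF assms(1)] by metis
  then show ?thesis using base_pairing_rational[OF _ assms(2)]
    by (auto simp: zcomb_def intro!: Rats_sum Rats_mult)
qed

lemma base_nonempty: "\<Gamma> \<noteq> {}"
proof
  assume e: "\<Gamma> = {}"
  obtain \<beta> where b: "\<beta> \<in> R" using roots_nonempty by blast
  then obtain c where "\<beta> = zcomb c id \<Gamma>" using base_coeffs by metis
  then show False using root_nonzero[OF b] e by (simp add: zcomb_def)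
qed

text \<open>For any scalar \<open>s\<close>, the \<open>x\<close> with
  \<open>killing x y = s * B x y\<close> for all \<open>y\<close> form an ideal. With
  \<open>s\<close> taken from one opposite pair of root vectors this ideal contains a root vector,
  so by simplicity it is everything. If \<open>s\<close> were \<open>0\<close>, the squares of the
  rational numbers \<open>\<beta> (t \<gamma>)\<close> would add up to \<open>0\<close>, against
  \<open>\<gamma> (t \<gamma>) \<noteq> 0\<close>.\<close>

lemma killing_B: "\<exists>s. s \<noteq> 0 \<and> (\<forall>x y. killing x y = s * B x y)"
proof -
  obtain \<beta> where b: "\<beta> \<in> R" using roots_nonempty by blast
  let ?s = "killing (Xr \<beta>) (Xr (- \<beta>))"
  let ?I = "{x. \<forall>y. killing x y = ?s * B x y}"
  have "lie_ideal br ?I" unfolding lie_ideal_def vec.subspace_def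
  proof (intro conjI allI ballI)
    show "0 \<in> ?I" using killing_simps(2)[of 0] by simp
    fix x y assume y: "y \<in> ?I"
    have neg: "killing (- u) w = - killing u w" for u w using killing_simps(2)[of "-1" u w] by simp
    show "br x y \<in> ?I"
    proof (intro CollectI allI)
      fix z
      have "killing (br x y) z = - killing y (br x z)"
        by (subst br_anti) (simp add: neg killing_inv)
      also have "\<dots> = - (?s * B y (br x z))" using y by simp
      also have "\<dots> = ?s * B (br x y) z" by (subst (2) br_anti) (simp add: B_minus B_inv)
      finally show "killing (br x y) z = ?s * B (br x y) z" .
    qed
  qed (auto simp: killing_simps B_simps distrib_left)
  moreover have "Xr \<beta> \<in> ?I"
  proof (intro CollectI allI)
    fix y
    obtain y0 where y: "y0 \<in> h" "y = y0 + (\<Sum>\<delta>\<in>R. B (Xr (- \<delta>)) y *s Xr \<delta>)"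
      using decomposition by blast
    obtain z where z: "\<beta> z \<noteq> 0" using root_nonzero[OF b] by blast
    then have zh: "z \<in> h" using root_outside[OF b] by blast
    have ksum: "killing (Xr \<beta>) (\<Sum>\<delta>\<in>A. f \<delta>) = (\<Sum>\<delta>\<in>A. killing (Xr \<beta>) (f \<delta>))" for A :: "('k^'n \<Rightarrow> 'k) set" and f
      using killing_simps(4)[of "Xr \<beta>" 0 0]
      by (induction A rule: infinite_finite_induct) (auto simp: killing_simps)
    have "killing (Xr \<beta>) y0 = 0"
      by (rule killing_weights[OF Xr_weight[OF b] _ zh, of _ "\<lambda>y. 0"]) (use y(1) z h_zero in auto)
    then have "killing (Xr \<beta>) y = (\<Sum>\<delta>\<in>R. B (Xr (- \<delta>)) y * killing (Xr \<beta>) (Xr \<delta>))"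
      by (subst y(2)) (simp add: killing_simps ksum)
    also have "\<dots> = (\<Sum>\<delta>\<in>R. if \<delta> = - \<beta> then B (Xr \<beta>) y * ?s else 0)"
    proof (rule sum.cong)
      fix \<delta> assume d: "\<delta> \<in> R"
      show "B (Xr (- \<delta>)) y * killing (Xr \<beta>) (Xr \<delta>) = (if \<delta> = - \<beta> then B (Xr \<beta>) y * ?s else 0)"
      proof (cases "\<delta> = - \<beta>")
        case False
        then obtain w where w: "\<beta> w + \<delta> w \<noteq> 0" by (metis add_eq_0_iff ext uminus_apply)
        then have "w \<in> h" using root_outside[OF b] root_outside[OF d] by (cases "w \<in> h") auto
        then have "killing (Xr \<beta>) (Xr \<delta>) = 0"
          using killing_weights[OF Xr_weight[OF b] Xr_weight[OF d]] w by blast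
        with False show ?thesis by simp
      qed simp
    qed simp
    also have "\<dots> = ?s * B (Xr \<beta>) y" using root_neg[OF b] finite_roots by simp
    finally show "killing (Xr \<beta>) y = ?s * B (Xr \<beta>) y" .
  qed
  ultimately have "?I = UNIV" using ideal_trivial Xr_nonzero(1)[OF b] by blast
  then have s: "killing x y = ?s * B x y" for x y by blast
  obtain \<gamma> where \<gamma>: "\<gamma> \<in> \<Gamma>" using base_nonempty by blast
  then have gR: "\<gamma> \<in> R" using base_roots by blast
  have "?s \<noteq> 0"
  proof
    assume "?s = 0"
    then have "(\<Sum>\<beta>\<in>R. \<beta> (t \<gamma>) * \<beta> (t \<gamma>)) = 0"
      using s[of "t \<gamma>" "t \<gamma>"] killing_h[OF t_in_h[OF gR] t_in_h[OF gR]] by simp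
    then have "\<gamma> (t \<gamma>) = 0"
      using sum_squares_rational_zero[of R "\<lambda>\<beta>. \<beta> (t \<gamma>)" \<gamma>] finite_roots root_t_rational[OF _ \<gamma>] gR
      by auto
    then show False using root_norm_nonzero[OF gR] by simp
  qed
  with s show ?thesis by blast
qed

lemma B_aut: assumes "\<phi> \<in> lie_aut br" shows "B (\<phi> x) (\<phi> y) = B x y"
proof -
  obtain s where "s \<noteq> 0" "\<And>x y. killing x y = s * B x y" using killing_B by blast
  then show ?thesis using killing_aut[OF assms, of x y] by simp
qed

text \<open>Up to a nonzero factor, \<open>B v v\<close> is the sum of the squares of the values
  \<open>\<beta> v\<close>, which are rational because the coefficients of \<open>v\<close> are
  integers. So all roots vanish on \<open>v\<close>, whence \<open>v = 0\<close>, and independence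
  of the base concludes.\<close>

lemma base_combination_anisotropic:
  assumes S: "S \<subseteq> \<Gamma>" and v: "v = (\<Sum>\<gamma>\<in>S. of_int (n \<gamma>) *s t \<gamma>)" and "B v v = 0" and \<gamma>: "\<gamma> \<in> S"
  shows "n \<gamma> = 0"
proof -
  have tS: "t \<gamma> \<in> h" if "\<gamma> \<in> S" for \<gamma> using that S base_roots t_in_h by blast
  have vh: "v \<in> h" unfolding v using h_subspace tS by (intro vec.subspace_sum vec.subspace_scale)
  obtain s where "s \<noteq> 0" and s: "\<And>x y. killing x y = s * B x y" using killing_B by blast
  then have "(\<Sum>\<beta>\<in>R. \<beta> v * \<beta> v) = 0" using killing_h[OF vh vh] assms(3) by simp
  moreover have "\<beta> v \<in> \<rat>" if b: "\<beta> \<in> R" for \<beta>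
  proof -
    have "\<beta> v = (\<Sum>\<gamma>\<in>S. of_int (n \<gamma>) * \<beta> (t \<gamma>))"
      unfolding v using tS by (simp add: root_lin[OF b] vec.subspace_scale[OF h_subspace])
    then show ?thesis using root_t_rational[OF b] S by (auto intro!: Rats_sum Rats_mult)
  qed
  ultimately have "\<beta> v = 0" if "\<beta> \<in> R" for \<beta>
    using sum_squares_rational_zero[OF finite_roots, of "\<lambda>\<beta>. \<beta> v"] that by blast
  then have v0: "v = 0" by (rule roots_separate[OF vh])
  have "zcomb n id S y = zcomb (\<lambda>_. 0) id S y" if y: "y \<in> h" for y
  proof -
    have "zcomb n id S y = B v y"
      unfolding v zcomb_def B_sum_left B_simps using S base_roots B_t[OF _ y] by (intro sum.cong) auto
    then show ?thesis by (simp add: v0 zcomb_def)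
  qed
  then show ?thesis by (rule zcomb_eqD[OF S _ \<gamma>])
qed

end

section \<open>The Chevalley automorphism and generated subalgebras\<close>

locale pinned_lie_chev = pinned_lie br B h \<Gamma> Xr r\<^sub>h
  for br :: "'k::field_char_0^'n \<Rightarrow> 'k^'n \<Rightarrow> 'k^'n" and B h \<Gamma> Xr r\<^sub>h +
  fixes chev :: "'k^'n \<Rightarrow> 'k^'n"
  assumes chev: "is_chevalley_aut br h \<Gamma> Xr chev"
begin

lemma chev_aut: "chev \<in> lie_aut br" and chev_h: "y \<in> h \<Longrightarrow> chev y = - y"
  and chev_base: "\<gamma> \<in> \<Gamma> \<Longrightarrow> chev (Xr \<gamma>) = - Xr (- \<gamma>)" "\<gamma> \<in> \<Gamma> \<Longrightarrow> chev (Xr (- \<gamma>)) = - Xr \<gamma>"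
  using chev by (auto simp: is_chevalley_aut_def)

lemma lie_aut_simps:
  assumes "\<phi> \<in> lie_aut br"
  shows "\<phi> (x + y) = \<phi> x + \<phi> y" "\<phi> (c *s x) = c *s \<phi> x" "\<phi> (- x) = - \<phi> x" "\<phi> (br x y) = br (\<phi> x) (\<phi> y)"
    "\<phi> 0 = 0" "\<phi> x = 0 \<longleftrightarrow> x = 0"
proof -
  note l = lie_autD(1)[OF assms, unfolded linear_vec_iff]
  show a: "\<phi> (x + y) = \<phi> x + \<phi> y" "\<phi> (c *s x) = c *s \<phi> x" for x y c using l by auto
  show "\<phi> (- x) = - \<phi> x" using a(2)[of "-1" x] by simp
  show z: "\<phi> 0 = 0" using a(2)[of 0 0] by simp
  show "\<phi> x = 0 \<longleftrightarrow> x = 0" using lie_autD(2)[OF assms] z by (metis bij_is_inj injD)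
qed (rule lie_autD(3)[OF assms])

lemma chev_weight: assumes "x \<in> g \<beta>" shows "chev x \<in> g (- \<beta>)"
proof -
  have "br y (chev x) = - \<beta> y *s chev x" if "y \<in> h" for y
  proof -
    have "- y \<in> h" using h_subspace that by (rule vec.subspace_neg)
    then have "chev (- y) = y" by (simp add: chev_h)
    then have "br y (chev x) = chev (br (- y) x)" by (simp add: lie_aut_simps[OF chev_aut])
    also have "br (- y) x = (- \<beta> y) *s x" using weightD[OF assms that] by (simp add: br_minus)
    finally show ?thesis by (simp only: lie_aut_simps[OF chev_aut])
  qed
  then show ?thesis by (simp add: root_space_def)
qed

lemma lie_subalgD:
  assumes "lie_subalg br L"
  shows "x \<in> L \<Longrightarrow> y \<in> L \<Longrightarrow> x + y \<in> L" "x \<in> L \<Longrightarrow> c *s x \<in> L" "x \<in> L \<Longrightarrow> y \<in> L \<Longrightarrow> br x y \<in> L" "0 \<in> L"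
  "x \<in> L \<Longrightarrow> - x \<in> L"
  using assms by (auto simp: lie_subalg_def vec.subspace_def vec.subspace_neg)

text \<open>For \<open>\<Gamma>\<^sub>1\<close> this is the domain of the isomorphism in
  \<open>tau_compatible\<close>.\<close>

definition gen :: "('k^'n \<Rightarrow> 'k) set \<Rightarrow> ('k^'n) set" where
  "gen S = lie_subalg br hull (\<Union>\<beta>\<in>S. {Xr \<beta>, Xr (- \<beta>)})"

lemma gen_subalg: "lie_subalg br (gen S)"
  and gen_base: "\<gamma> \<in> S \<Longrightarrow> Xr \<gamma> \<in> gen S" "\<gamma> \<in> S \<Longrightarrow> Xr (- \<gamma>) \<in> gen S"
  unfolding gen_def by (auto simp: lie_subalg_hull intro!: hull_inc)

lemma gen_induct [consumes 1, case_names pos neg add scale br]: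
  assumes x: "x \<in> gen S"
    and "\<And>\<gamma>. \<gamma> \<in> S \<Longrightarrow> P (Xr \<gamma>)" "\<And>\<gamma>. \<gamma> \<in> S \<Longrightarrow> P (Xr (- \<gamma>))"
    and add: "\<And>x y. x \<in> gen S \<Longrightarrow> y \<in> gen S \<Longrightarrow> P x \<Longrightarrow> P y \<Longrightarrow> P (x + y)"
    and scale: "\<And>c x. x \<in> gen S \<Longrightarrow> P x \<Longrightarrow> P (c *s x)"
    and "\<And>x y. x \<in> gen S \<Longrightarrow> y \<in> gen S \<Longrightarrow> P x \<Longrightarrow> P y \<Longrightarrow> P (br x y)"
    and "S \<noteq> {}"
  shows "P x"
proof -
  obtain \<gamma> where "\<gamma> \<in> S" using assms(7) by blast
  \<comment> \<open>Zero has no case of its own: it is a generator scaled by \<open>0\<close>,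
    whence the condition \<open>S \<noteq> {}\<close>.\<close>
  then have "P 0" using scale[of "Xr \<gamma>" 0] gen_base(1) assms(2) by simp
  then have "gen S \<subseteq> {x \<in> gen S. P x}"
    unfolding gen_def using assms(2-6) gen_base lie_subalgD[OF gen_subalg]
    by (intro hull_minimal) (auto simp: lie_subalg_def vec.subspace_def gen_def[symmetric])
  then show ?thesis using x by blast
qed

end

section \<open>Generation by simple root vectors\<close>

context pinned_lie_chev begin

lemma weight_br_Xr:
  assumes "\<beta> \<in> R" "\<delta> \<in> R" "\<epsilon> \<in> R" "\<And>y. \<epsilon> y = \<beta> y + \<delta> y"
  shows "br (Xr \<beta>) (Xr \<delta>) = B (Xr (- \<epsilon>)) (br (Xr \<beta>) (Xr \<delta>)) *s Xr \<epsilon>"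
proof (rule weight_space_root[OF _ assms(3)])
  have "\<epsilon> = (\<lambda>y. \<beta> y + \<delta> y)" using assms(4) by blast
  then show "br (Xr \<beta>) (Xr \<delta>) \<in> g \<epsilon>" using weight_br[OF Xr_weight Xr_weight] assms by simp
qed

lemma gen_chev: assumes "x \<in> gen S" "S \<subseteq> \<Gamma>" "S \<noteq> {}" shows "chev x \<in> gen S"
  using assms(1)
  by (induction rule: gen_induct)
    (use assms(2,3) chev_base gen_base lie_subalgD[OF gen_subalg] in
      \<open>auto simp: lie_aut_simps[OF chev_aut] subset_iff\<close>)

text \<open>The Chevalley automorphism preserves \<open>gen S\<close>, as it permutes the generators
  up to sign, and since root spaces are one-dimensional it sends \<open>Xr \<beta>\<close> to a
  nonzero multiple of \<open>Xr (- \<beta>)\<close>.\<close>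

lemma gen_neg: assumes "S \<subseteq> \<Gamma>" "S \<noteq> {}" "\<beta> \<in> R" "Xr \<beta> \<in> gen S" shows "Xr (- \<beta>) \<in> gen S"
proof -
  have "chev (Xr \<beta>) = B (Xr \<beta>) (chev (Xr \<beta>)) *s Xr (- \<beta>)"
    using weight_space_root[OF chev_weight[OF Xr_weight] root_neg] assms(3) by simp
  moreover have "chev (Xr \<beta>) \<noteq> 0" using lie_aut_simps(6)[OF chev_aut] Xr_nonzero[OF assms(3)] by simp
  ultimately obtain a where a: "chev (Xr \<beta>) = a *s Xr (- \<beta>)" "a \<noteq> 0" by (metis vec.scale_zero_left)
  then have "Xr (- \<beta>) = (1 / a) *s chev (Xr \<beta>)" by simp
  then show ?thesis using gen_chev[OF assms(4,1,2)] lie_subalgD(2)[OF gen_subalg] by metis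
qed

text \<open>By invariance of \<open>B\<close>, the structure constants of
  \<open>br (Xr \<gamma>) (Xr \<beta>)\<close> and \<open>br (Xr \<gamma>) (Xr (- \<delta>))\<close>
  are opposite. The second bracket lies in \<open>gen S\<close>, so \<open>Xr (- \<beta>)\<close>
  does too. Read contrapositively: not lying in \<open>gen S\<close> propagates from \<beta> to
  \<delta>.\<close>

lemma gen_step:
  assumes S: "S \<subseteq> \<Gamma>" "S \<noteq> {}" and R: "\<beta> \<in> R" "\<gamma> \<in> R" "\<delta> \<in> R" "\<And>y. \<delta> y = \<gamma> y + \<beta> y"
    and nz: "br (Xr \<gamma>) (Xr \<beta>) \<noteq> 0" and L: "Xr \<gamma> \<in> gen S" "Xr \<delta> \<in> gen S"
  shows "Xr \<beta> \<in> gen S"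
proof -
  let ?b = "B (Xr (- \<delta>)) (br (Xr \<gamma>) (Xr \<beta>))" and ?a = "B (Xr \<beta>) (br (Xr \<gamma>) (Xr (- \<delta>)))"
  have "br (Xr \<gamma>) (Xr \<beta>) = ?b *s Xr \<delta>" by (rule weight_br_Xr) (use R in auto)
  then have b: "?b \<noteq> 0" using nz by (metis vec.scale_zero_left)
  have "?b = - ?a" by (subst B_inv[symmetric], subst br_anti) (simp add: B_minus B_sym)
  then have a: "?a \<noteq> 0" using b by simp
  have e: "br (Xr \<gamma>) (Xr (- \<delta>)) = B (Xr (- (- \<beta>))) (br (Xr \<gamma>) (Xr (- \<delta>))) *s Xr (- \<beta>)"
    by (rule weight_br_Xr) (use R root_neg in auto)
  then obtain a where "br (Xr \<gamma>) (Xr (- \<delta>)) = a *s Xr (- \<beta>)" "a \<noteq> 0" using a by (metis neg_neg)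
  then have "Xr (- \<beta>) = (1 / a) *s br (Xr \<gamma>) (Xr (- \<delta>))" by simp
  moreover have "br (Xr \<gamma>) (Xr (- \<delta>)) \<in> gen S"
    using L gen_neg[OF S R(3)] lie_subalgD(3)[OF gen_subalg] by blast
  ultimately have "Xr (- \<beta>) \<in> gen S" using lie_subalgD(2)[OF gen_subalg] by metis
  then show ?thesis using gen_neg[OF S root_neg[OF R(1)]] by simp
qed

text \<open>Let \<open>N\<close> be the set of counterexamples. By \<open>gen_step\<close> it is
  closed under those steps by \<open>\<gamma>\<close> and \<open>- \<gamma>\<close>, with \<gamma>
  in \<open>S\<close>, along which the bracket is nonzero, so the values of its members on
  \<open>t \<gamma>\<close> sum to zero. The vector representing the sum of \<open>N\<close> is then
  isotropic, hence has zero coefficients; as sums of nonnegative integers, these vanish term by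
  term, and \<beta> would be zero. This takes the place of an induction on height.\<close>

lemma Xr_in_gen_pos:
  assumes S: "S \<subseteq> \<Gamma>" and \<beta>: "\<beta> \<in> R" "\<beta> = zcomb c id S" "\<And>\<gamma>. \<gamma> \<in> S \<Longrightarrow> 0 \<le> c \<gamma>"
  shows "Xr \<beta> \<in> gen S"
proof (rule ccontr)
  assume no: "Xr \<beta> \<notin> gen S"
  have S0: "S \<noteq> {}" using root_nonzero[OF \<beta>(1)] \<beta>(2) by (auto simp: zcomb_def)
  have fS: "finite S" using S finite_base finite_subset by blast
  let ?P = "\<lambda>\<delta> d. \<delta> = zcomb d id S \<and> (\<forall>\<gamma>\<in>S. 0 \<le> d \<gamma>)"
  define N where "N = {\<delta>\<in>R. (\<exists>d. ?P \<delta> d) \<and> Xr \<delta> \<notin> gen S}"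
  have \<beta>N: "\<beta> \<in> N" using \<beta> no by (auto simp: N_def)
  have sum0: "(\<Sum>\<delta>\<in>N. \<delta> (t \<gamma>)) = 0" if \<gamma>: "\<gamma> \<in> S" for \<gamma>
  proof (rule trace_coroot_zero)
    show "N \<subseteq> R" by (auto simp: N_def)
    show gR: "\<gamma> \<in> R" using \<gamma> S base_roots by blast
    let ?s = "\<lambda>x. if x = \<gamma> then 1 else 0 :: int"
    fix \<delta> assume d: "\<delta> \<in> N"
    then obtain d where d: "\<delta> \<in> R" "\<delta> = zcomb d id S" "\<forall>\<gamma>\<in>S. 0 \<le> d \<gamma>" "Xr \<delta> \<notin> gen S"
      by (auto simp: N_def)
    have dg: "\<delta> \<noteq> \<gamma>" "\<delta> \<noteq> - \<gamma>" using gen_base[OF \<gamma>] d(4) by auto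
    show "(\<lambda>y. \<delta> y + \<gamma> y) \<in> N" if nz: "br (Xr \<gamma>) (Xr \<delta>) \<noteq> 0"
    proof -
      let ?\<epsilon> = "\<lambda>y. \<delta> y + \<gamma> y"
      have e: "?\<epsilon> \<in> R" using br_Xr_weight_cases[OF gR d(1) nz] dg by blast
      have "?\<epsilon> = zcomb (\<lambda>x. d x + ?s x) id S"
        by (rule ext) (simp add: zcomb_add zcomb_single[OF fS \<gamma>] d(2))
      moreover have "Xr ?\<epsilon> \<notin> gen S"
        using gen_step[OF S S0 d(1) gR e _ nz gen_base(1)[OF \<gamma>]] d(4) by (auto simp: add.commute)
      moreover have "\<forall>x\<in>S. 0 \<le> d x + ?s x" using d(3) by auto
      ultimately show ?thesis using e unfolding N_def by blast
    qed
    show "(\<lambda>y. \<delta> y - \<gamma> y) \<in> N" if nz: "br (Xr (- \<gamma>)) (Xr \<delta>) \<noteq> 0"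
    proof -
      let ?\<epsilon> = "\<lambda>y. \<delta> y - \<gamma> y" and ?d = "\<lambda>x. d x + - ?s x"
      have e: "?\<epsilon> \<in> R" using br_Xr_weight_cases[OF root_neg[OF gR] d(1) nz] dg by auto
      have e1: "?\<epsilon> = zcomb ?d id S"
        unfolding zcomb_add zcomb_neg
        by (rule ext) (simp add: zcomb_add zcomb_neg zcomb_single[OF fS \<gamma>] d(2) del: add_uminus_conv_diff)
      have "Xr ?\<epsilon> \<notin> gen S"
        using gen_step[OF S S0 d(1) root_neg[OF gR] e _ nz gen_base(2)[OF \<gamma>]] d(4) by auto
      \<comment> \<open>The coefficients of a root have one sign. If those of
        \<open>\<delta> - \<gamma>\<close> were nonpositive, \<delta> would be \<gamma> with factor
        \<open>0\<close> or \<open>1\<close>, hence \<open>0\<close> or \<gamma> itself, and both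
        are excluded.\<close>
      moreover have "\<forall>x\<in>S. 0 \<le> ?d x"
      proof -
        let ?D = "\<lambda>x. if x \<in> S then ?d x else 0"
        obtain c where c: "?\<epsilon> = zcomb c id \<Gamma>" "(\<forall>\<gamma>\<in>\<Gamma>. 0 \<le> c \<gamma>) \<or> (\<forall>\<gamma>\<in>\<Gamma>. c \<gamma> \<le> 0)"
          by (rule base_coeffs[OF e])
        have "c x = ?D x" if "x \<in> \<Gamma>" for x
          by (rule zcomb_eqD[OF order_refl _ that])
            (simp only: c(1)[symmetric] e1 zcomb_extend[OF finite_base S, symmetric])
        then have cx: "c x = ?d x" if "x \<in> S" for x using that S by auto
        show ?thesis using c(2)
        proof
          assume "\<forall>\<gamma>\<in>\<Gamma>. 0 \<le> c \<gamma>" then show ?thesis using cx S by (metis subsetD)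
        next
          assume "\<forall>\<gamma>\<in>\<Gamma>. c \<gamma> \<le> 0"
          then have le: "d x \<le> ?s x" if "x \<in> S" for x using cx[OF that] that S by force
          have dx: "d x = (if x = \<gamma> then d \<gamma> else 0)" if "x \<in> S" for x
            using le[OF that] d(3) that by (auto split: if_splits intro: order_antisym)
          have "\<delta> y = of_int (d \<gamma>) * \<gamma> y" for y
            unfolding d(2) zcomb_cong[OF dx, of S "\<lambda>x. x", simplified] zcomb_single[OF fS \<gamma>] by simp
          moreover have "d \<gamma> = 0 \<or> d \<gamma> = 1" using le[OF \<gamma>] d(3) \<gamma> by force
          ultimately have "\<delta> = (\<lambda>y. 0) \<or> \<delta> = \<gamma>" by (auto simp: fun_eq_iff)
          then show ?thesis using dg root_nonzero[OF d(1)] by blast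
        qed
      qed
      ultimately show ?thesis using e e1 unfolding N_def by blast
    qed
  qed
  have "\<forall>\<delta>\<in>N. \<exists>d. ?P \<delta> d" unfolding N_def by blast
  from bchoice[OF this] obtain C where C: "\<forall>\<delta>\<in>N. ?P \<delta> (C \<delta>)" ..
  \<comment> \<open>\<open>n\<close> collects the coefficients of the sum of all roots in
    \<open>N\<close>; \<open>v\<close> below represents that sum under \<open>B\<close>.\<close>
  define n where "n \<gamma> = (\<Sum>\<delta>\<in>N. C \<delta> \<gamma>)" for \<gamma>
  have fN: "finite N" using finite_roots by (auto simp: N_def)
  define v where "v = (\<Sum>\<gamma>\<in>S. of_int (n \<gamma>) *s t \<gamma>)"
  have "B v (t \<gamma>) = 0" if \<gamma>: "\<gamma> \<in> S" for \<gamma>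
  proof -
    have gR: "\<gamma> \<in> R" using \<gamma> S base_roots by blast
    have "B v (t \<gamma>) = (\<Sum>\<epsilon>\<in>S. of_int (n \<epsilon>) * \<epsilon> (t \<gamma>))"
      unfolding v_def B_sum_left B_simps using S base_roots B_t[OF _ t_in_h[OF gR]] by (intro sum.cong) auto
    also have "\<dots> = (\<Sum>\<delta>\<in>N. \<Sum>\<epsilon>\<in>S. of_int (C \<delta> \<epsilon>) * \<epsilon> (t \<gamma>))"
      by (subst sum.swap) (simp add: n_def sum_distrib_right)
    also have "\<dots> = (\<Sum>\<delta>\<in>N. \<delta> (t \<gamma>))"
    proof (rule sum.cong)
      fix \<delta> assume "\<delta> \<in> N"
      then have "\<delta> = zcomb (C \<delta>) id S" using C by blast
      then have "\<delta> (t \<gamma>) = zcomb (C \<delta>) id S (t \<gamma>)" by metis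
      then show "(\<Sum>\<epsilon>\<in>S. of_int (C \<delta> \<epsilon>) * \<epsilon> (t \<gamma>)) = \<delta> (t \<gamma>)" by (simp add: zcomb_def)
    qed simp
    finally show ?thesis using sum0[OF \<gamma>] by simp
  qed
  then have "B v v = 0" by (subst (2) v_def) (simp add: B_sum_right B_simps)
  then have n0: "n \<gamma> = 0" if "\<gamma> \<in> S" for \<gamma> using base_combination_anisotropic[OF S v_def] that by blast
  have "C \<beta> \<gamma> = 0" if "\<gamma> \<in> S" for \<gamma>
    using n0[OF that] C that \<beta>N unfolding n_def by (subst (asm) sum_nonneg_eq_0_iff) (auto simp: fN)
  then have "\<beta> = zcomb (\<lambda>_. 0) id S" using bspec[OF C \<beta>N] zcomb_cong[of S "C \<beta>" "\<lambda>_. 0" id] by metis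
  then show False using root_nonzero[OF \<beta>(1)] by (simp add: zcomb_def)
qed

lemma root_coeffs_sign:
  assumes S: "S \<subseteq> \<Gamma>" and \<beta>: "\<beta> \<in> R" "\<beta> = zcomb c id S"
  shows "(\<forall>\<gamma>\<in>S. 0 \<le> c \<gamma>) \<or> (\<forall>\<gamma>\<in>S. c \<gamma> \<le> 0)"
proof -
  obtain d where d: "\<beta> = zcomb d id \<Gamma>" "(\<forall>\<gamma>\<in>\<Gamma>. 0 \<le> d \<gamma>) \<or> (\<forall>\<gamma>\<in>\<Gamma>. d \<gamma> \<le> 0)"
    by (rule base_coeffs[OF \<beta>(1)])
  have "d x = (if x \<in> S then c x else 0)" if "x \<in> \<Gamma>" for x
    by (rule zcomb_eqD[OF order_refl _ that])
      (simp only: d(1)[symmetric] \<beta>(2) zcomb_extend[OF finite_base S, symmetric])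
  then have "d x = c x" if "x \<in> S" for x using that S by auto
  then show ?thesis using d(2) S by (metis subsetD)
qed

lemma Xr_in_gen:
  assumes S: "S \<subseteq> \<Gamma>" and \<beta>: "\<beta> \<in> R" "\<beta> = zcomb c id S"
  shows "Xr \<beta> \<in> gen S"
  using root_coeffs_sign[OF assms]
proof
  assume "\<forall>\<gamma>\<in>S. 0 \<le> c \<gamma>"
  then show ?thesis using Xr_in_gen_pos[OF S \<beta>] by blast
next
  assume n: "\<forall>\<gamma>\<in>S. c \<gamma> \<le> 0"
  have S0: "S \<noteq> {}" using root_nonzero[OF \<beta>(1)] \<beta>(2) by (auto simp: zcomb_def)
  have "Xr (- \<beta>) \<in> gen S"
    by (rule Xr_in_gen_pos[OF S root_neg[OF \<beta>(1)], of "\<lambda>x. - c x"]) (use n \<beta>(2) in \<open>auto simp: zcomb_neg\<close>)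
  then show ?thesis using gen_neg[OF S S0 root_neg[OF \<beta>(1)]] by simp
qed

text \<open>\<open>gen \<Gamma>\<close> contains all root vectors and is stable under
  \<open>h\<close>, its generators being eigenvectors. By the decomposition of an arbitrary vector
  it is then a nonzero ideal; that it contains \<open>h\<close> comes out as a consequence.\<close>

lemma gen_base_UNIV: "gen \<Gamma> = UNIV"
proof -
  have X: "Xr \<beta> \<in> gen \<Gamma>" if "\<beta> \<in> R" for \<beta>
    using base_coeffs[OF that] Xr_in_gen[OF order_refl that] by metis
  have hstable: "br y x \<in> gen \<Gamma>" if y: "y \<in> h" and x: "x \<in> gen \<Gamma>" for y x
    using x
  proof (induction rule: gen_induct)
    case (pos \<gamma>)
    then show ?case using weightD[OF Xr_weight y, of \<gamma>] base_roots gen_base lie_subalgD(2)[OF gen_subalg]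
      by (auto simp: subset_iff)
  next
    case (neg \<gamma>)
    then show ?case
      using weightD[OF Xr_weight y, of "- \<gamma>"] base_roots root_neg gen_base(2)[OF neg] lie_subalgD(2)[OF gen_subalg]
      by (metis subsetD)
  next
    case (br x z)
    then have "br (br y x) z \<in> gen \<Gamma>" "br x (br y z) \<in> gen \<Gamma>"
      by (simp_all add: lie_subalgD(3)[OF gen_subalg])
    then show ?case unfolding jacobi[of y x z] by (rule lie_subalgD(1)[OF gen_subalg])
  qed (use base_nonempty lie_subalgD[OF gen_subalg] in \<open>auto simp: br_simps\<close>)
  have "lie_ideal br (gen \<Gamma>)" unfolding lie_ideal_def
  proof (intro conjI allI ballI)
    show sub: "vec.subspace (gen \<Gamma>)" using gen_subalg by (simp add: lie_subalg_def)
    fix x z assume z: "z \<in> gen \<Gamma>"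
    obtain x0 where x: "x0 \<in> h" "x = x0 + (\<Sum>\<beta>\<in>R. B (Xr (- \<beta>)) x *s Xr \<beta>)"
      using decomposition by blast
    have "(\<Sum>\<beta>\<in>R. B (Xr (- \<beta>)) x *s Xr \<beta>) \<in> gen \<Gamma>"
      by (intro vec.subspace_sum sub lie_subalgD(2)[OF gen_subalg] X)
    then show "br x z \<in> gen \<Gamma>"
      using hstable[OF x(1) z] z lie_subalgD[OF gen_subalg] by (subst x(2)) (simp add: br_simps(2))
  qed
  moreover obtain \<gamma> where "\<gamma> \<in> \<Gamma>" using base_nonempty by blast
  then have "Xr \<gamma> \<in> gen \<Gamma>" "Xr \<gamma> \<noteq> 0" using gen_base base_roots Xr_nonzero by auto
  ultimately show ?thesis using ideal_trivial by blast
qed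

text \<open>Agreement spreads from the generators to \<open>gen \<Gamma>\<close>, which is
  everything. The relations between \<open>chev\<close> and \<open>pihat\<close> are verified in
  this way.\<close>

lemma lie_aut_eqI:
  assumes "\<phi> \<in> lie_aut br" "\<psi> \<in> lie_aut br"
    and "\<And>\<gamma>. \<gamma> \<in> \<Gamma> \<Longrightarrow> \<phi> (Xr \<gamma>) = \<psi> (Xr \<gamma>)" "\<And>\<gamma>. \<gamma> \<in> \<Gamma> \<Longrightarrow> \<phi> (Xr (- \<gamma>)) = \<psi> (Xr (- \<gamma>))"
  shows "\<phi> = \<psi>"
proof
  fix x
  have "x \<in> gen \<Gamma>" using gen_base_UNIV by simp
  then show "\<phi> x = \<psi> x"
    by (induction rule: gen_induct)
      (use assms base_nonempty in \<open>auto simp: lie_aut_simps[OF assms(1)] lie_aut_simps[OF assms(2)]\<close>)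
qed

end

section \<open>The action on the r-matrix\<close>

locale bd_setup = pinned_lie_chev br B h \<Gamma> Xr r\<^sub>h chev
  for br :: "'k::field_char_0^'n \<Rightarrow> 'k^'n \<Rightarrow> 'k^'n" and B h \<Gamma> Xr r\<^sub>h chev +
  fixes \<Gamma>\<^sub>1 \<Gamma>\<^sub>2 :: "('k^'n \<Rightarrow> 'k) set" and \<tau> \<pi> :: "('k^'n \<Rightarrow> 'k) \<Rightarrow> ('k^'n \<Rightarrow> 'k)"
    and pihat :: "'k^'n \<Rightarrow> 'k^'n"
  assumes sub: "\<Gamma>\<^sub>1 \<subseteq> \<Gamma>" "\<Gamma>\<^sub>2 \<subseteq> \<Gamma>" and \<tau>_bij: "bij_betw \<tau> \<Gamma>\<^sub>1 \<Gamma>\<^sub>2"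
    and compatible: "tau_compatible br h Xr \<Gamma>\<^sub>1 \<tau>"
    and \<pi>_bij: "bij_betw \<pi> \<Gamma> \<Gamma>" and \<pi>_invol: "\<And>\<beta>. \<beta> \<in> \<Gamma> \<Longrightarrow> \<pi> (\<pi> \<beta>) = \<beta>"
    and pihat: "is_pi_hat br h \<Gamma> Xr \<pi> pihat"
    and swap: "\<pi> ` \<Gamma>\<^sub>1 = \<Gamma>\<^sub>2" "\<pi> ` \<Gamma>\<^sub>2 = \<Gamma>\<^sub>1"
    and conj: "\<And>\<beta>. \<beta> \<in> \<Gamma>\<^sub>2 \<Longrightarrow> \<pi> (\<tau> (inv_into \<Gamma> \<pi> \<beta>)) = inv_into \<Gamma>\<^sub>1 \<tau> \<beta>"
    and cartan_part: "tmap pihat pihat r\<^sub>h = flip r\<^sub>h"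
begin

lemma pihat_aut: "pihat \<in> lie_aut br" and pihat_h: "pihat ` h = h"
  and pihat_base: "\<gamma> \<in> \<Gamma> \<Longrightarrow> pihat (Xr \<gamma>) = Xr (\<pi> \<gamma>)"
  using pihat by (auto simp: is_pi_hat_def)

text \<open>The action of \<open>pihat\<close> on weights. It extends to all roots the map \<pi>,
  which is meaningful on the base only.\<close>

definition \<sigma> :: "('k^'n \<Rightarrow> 'k) \<Rightarrow> ('k^'n \<Rightarrow> 'k)" where "\<sigma> \<beta> = (\<lambda>y. \<beta> (inv_into UNIV pihat y))"

lemma inv_pihat: "inv_into UNIV pihat (pihat y) = y" "pihat (inv_into UNIV pihat y) = y"
  using lie_autD(2)[OF pihat_aut] by (simp_all add: bij_is_inj bij_is_surj surj_f_inv_f)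

lemma inv_pihat_h: "inv_into UNIV pihat y \<in> h \<longleftrightarrow> y \<in> h"
proof
  assume "inv_into UNIV pihat y \<in> h"
  then have "pihat (inv_into UNIV pihat y) \<in> h" using pihat_h by blast
  then show "y \<in> h" by (simp add: inv_pihat)
next
  assume "y \<in> h"
  then obtain z where "z \<in> h" "y = pihat z" using pihat_h by blast
  then show "inv_into UNIV pihat y \<in> h" by (simp add: inv_pihat)
qed

lemma pihat_weight: assumes "x \<in> g \<beta>" shows "pihat x \<in> g (\<sigma> \<beta>)"
proof -
  have "br y (pihat x) = \<sigma> \<beta> y *s pihat x" if "y \<in> h" for y
  proof -
    let ?z = "inv_into UNIV pihat y"
    have "br y (pihat x) = pihat (br ?z x)" by (simp add: lie_aut_simps[OF pihat_aut] inv_pihat)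
    also have "br ?z x = \<beta> ?z *s x" using weightD[OF assms] that inv_pihat_h by blast
    finally show ?thesis by (simp add: lie_aut_simps[OF pihat_aut] \<sigma>_def)
  qed
  then show ?thesis by (simp add: root_space_def)
qed

lemma \<sigma>_outside: assumes "\<beta> \<in> R" "y \<notin> h" shows "\<sigma> \<beta> y = 0"
  using root_outside[OF assms(1)] assms(2) inv_pihat_h by (simp add: \<sigma>_def)

lemma \<sigma>_root: assumes "\<beta> \<in> R" shows "\<sigma> \<beta> \<in> R"
proof -
  obtain z where "\<beta> z \<noteq> 0" using root_nonzero[OF assms] by blast
  then have "\<sigma> \<beta> (pihat z) \<noteq> 0" by (simp add: \<sigma>_def inv_pihat)
  then have "\<sigma> \<beta> \<noteq> (\<lambda>y. 0)" by metis
  moreover have "pihat (Xr \<beta>) \<in> g (\<sigma> \<beta>)" "pihat (Xr \<beta>) \<noteq> 0"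
    using pihat_weight[OF Xr_weight[OF assms]] lie_aut_simps(6)[OF pihat_aut] Xr_nonzero[OF assms] by auto
  ultimately show ?thesis using \<sigma>_outside[OF assms] by (auto simp: roots_def)
qed

lemma \<pi>_base: "\<gamma> \<in> \<Gamma> \<Longrightarrow> \<pi> \<gamma> \<in> \<Gamma>" using \<pi>_bij by (rule bij_betw_apply)

text \<open>\<open>Xr (\<pi> \<gamma>)\<close> is the image of \<open>Xr \<gamma>\<close>, so it has
  weight \<open>\<sigma> \<gamma>\<close> as well as \<open>\<pi> \<gamma>\<close>.\<close>

lemma \<sigma>_base: assumes "\<gamma> \<in> \<Gamma>" shows "\<sigma> \<gamma> = \<pi> \<gamma>"
proof (rule B_weight_eq)
  have g: "\<gamma> \<in> R" "\<pi> \<gamma> \<in> R" using assms base_roots \<pi>_base by auto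
  show "\<pi> \<gamma> \<in> R" by (rule g)
  show "\<sigma> \<gamma> y = 0" if "y \<notin> h" for y using \<sigma>_outside[OF g(1) that] .
  show "Xr (\<pi> \<gamma>) \<in> g (\<sigma> \<gamma>)"
    using pihat_weight[OF Xr_weight[OF g(1)]] by (simp add: pihat_base[OF assms])
  show "B (Xr (- \<pi> \<gamma>)) (Xr (\<pi> \<gamma>)) \<noteq> 0" using Xr_pair'[OF g(2)] by simp
qed

lemma \<sigma>_neg: "\<sigma> (- \<beta>) = - \<sigma> \<beta>" by (simp add: \<sigma>_def fun_eq_iff)

lemma \<sigma>_zcomb: "\<sigma> (zcomb c f S) = zcomb c (\<lambda>s. \<sigma> (f s)) S" by (simp add: \<sigma>_def zcomb_def)

lemma \<sigma>_\<sigma>: assumes "\<beta> \<in> R" shows "\<sigma> (\<sigma> \<beta>) = \<beta>"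
proof -
  obtain c where c: "\<beta> = zcomb c id \<Gamma>" using base_coeffs[OF assms] by metis
  have "\<sigma> (\<sigma> (zcomb c id \<Gamma>)) = zcomb c id \<Gamma>"
    unfolding \<sigma>_zcomb by (rule zcomb_fun_cong) (simp add: \<sigma>_base \<pi>_base \<pi>_invol)
  then show ?thesis by (simp only: c)
qed

lemma pos_rootI:
  assumes "S \<subseteq> \<Gamma>" "\<beta> \<in> R" "\<beta> = zcomb c id S" "\<And>\<gamma>. \<gamma> \<in> S \<Longrightarrow> 0 \<le> c \<gamma>"
  shows "\<beta> \<in> pos_roots br h \<Gamma>"
  unfolding pos_roots_def using assms zcomb_extend[OF finite_base assms(1), of c id]
  by (auto intro!: exI[of _ "\<lambda>s. if s \<in> S then c s else 0"])

lemma pos_rootD: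
  assumes "S \<subseteq> \<Gamma>" "\<beta> \<in> pos_roots br h \<Gamma>" "\<beta> = zcomb c id S" "\<gamma> \<in> S"
  shows "0 \<le> c \<gamma>"
proof -
  obtain d where d: "\<beta> = zcomb d id \<Gamma>" "\<forall>\<gamma>\<in>\<Gamma>. 0 \<le> d \<gamma>" using assms(2) by (auto simp: pos_roots_def)
  have "\<gamma> \<in> \<Gamma>" using assms by blast
  then have "d \<gamma> = (if \<gamma> \<in> S then c \<gamma> else 0)"
    by (rule zcomb_eqD[OF order_refl, rotated])
      (simp only: d(1)[symmetric] assms(3) zcomb_extend[OF finite_base assms(1), symmetric])
  then show ?thesis using d(2) assms(4) \<open>\<gamma> \<in> \<Gamma>\<close> by auto
qed

lemma pos_root: "\<beta> \<in> pos_roots br h \<Gamma> \<Longrightarrow> \<beta> \<in> R" by (simp add: pos_roots_def)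

lemma \<sigma>_pos: assumes "\<beta> \<in> pos_roots br h \<Gamma>" shows "\<sigma> \<beta> \<in> pos_roots br h \<Gamma>"
proof -
  obtain c where c: "\<beta> = zcomb c id \<Gamma>" using assms by (auto simp: pos_roots_def)
  have "\<sigma> \<beta> = zcomb c (\<lambda>s. id (\<pi> s)) \<Gamma>" unfolding c \<sigma>_zcomb by (rule zcomb_fun_cong) (simp add: \<sigma>_base)
  also have "\<dots> = zcomb (\<lambda>x. c (inv_into \<Gamma> \<pi> x)) id \<Gamma>" by (rule zcomb_reindex_inv[OF \<pi>_bij])
  finally show ?thesis
    by (rule pos_rootI[OF order_refl \<sigma>_root[OF pos_root[OF assms]]])
      (use pos_rootD[OF order_refl assms c] \<pi>_bij in \<open>auto intro: bij_betw_apply bij_betw_inv_into\<close>)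
qed

text \<open>\<open>is_pi_hat\<close> prescribes images for the positive simple root vectors only.
  Its weight determines the image of a negative one up to a scalar, and preservation of
  \<open>B\<close> determines the scalar.\<close>

lemma pihat_base_neg: assumes "\<gamma> \<in> \<Gamma>" shows "pihat (Xr (- \<gamma>)) = Xr (- \<pi> \<gamma>)"
proof -
  have g: "\<gamma> \<in> R" "\<pi> \<gamma> \<in> R" using assms base_roots \<pi>_base by auto
  have "pihat (Xr (- \<gamma>)) \<in> g (- \<pi> \<gamma>)"
    using pihat_weight[OF Xr_weight[OF root_neg[OF g(1)]]] by (simp add: \<sigma>_neg \<sigma>_base assms)
  then have "pihat (Xr (- \<gamma>)) = B (Xr (\<pi> \<gamma>)) (pihat (Xr (- \<gamma>))) *s Xr (- \<pi> \<gamma>)"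
    using weight_space_root[OF _ root_neg[OF g(2)]] by simp
  also have "B (Xr (\<pi> \<gamma>)) (pihat (Xr (- \<gamma>))) = 1"
    using B_aut[OF pihat_aut, of "Xr \<gamma>" "Xr (- \<gamma>)"] by (simp add: pihat_base[OF assms] Xr_pair[OF g(1)])
  finally show ?thesis by (simp only: vec.scale_one)
qed

lemma chev_chev: "chev \<circ> chev = id"
  by (rule lie_aut_eqI)
    (simp_all add: lie_aut_comp lie_aut_id chev_aut chev_base lie_aut_simps[OF chev_aut])

lemma pihat_pihat: "pihat \<circ> pihat = id"
  by (rule lie_aut_eqI)
    (simp_all add: lie_aut_comp lie_aut_id pihat_aut pihat_base pihat_base_neg \<pi>_base \<pi>_invol)

lemma chev_pihat: "chev \<circ> pihat = pihat \<circ> chev"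
  by (rule lie_aut_eqI)
    (simp_all add: lie_aut_comp chev_aut pihat_aut pihat_base pihat_base_neg chev_base \<pi>_base
      lie_aut_simps[OF pihat_aut])

section \<open>The composite automorphism and its scalars\<close>

definition \<psi> :: "'k^'n \<Rightarrow> 'k^'n" where "\<psi> = chev \<circ> pihat"

lemma \<psi>_aut: "\<psi> \<in> lie_aut br" unfolding \<psi>_def by (intro lie_aut_comp chev_aut pihat_aut)

lemma \<psi>_base: "\<gamma> \<in> \<Gamma> \<Longrightarrow> \<psi> (Xr \<gamma>) = - Xr (- \<pi> \<gamma>)" "\<gamma> \<in> \<Gamma> \<Longrightarrow> \<psi> (Xr (- \<gamma>)) = - Xr (\<pi> \<gamma>)"
  by (simp_all add: \<psi>_def pihat_base pihat_base_neg chev_base \<pi>_base)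

text \<open>The coefficient of \<open>\<psi> (Xr \<beta>)\<close> at
  \<open>Xr (- \<sigma> \<beta>)\<close>, read off by pairing with the partner
  \<open>Xr (\<sigma> \<beta>)\<close>.\<close>

definition cf :: "('k^'n \<Rightarrow> 'k) \<Rightarrow> 'k" where "cf \<beta> = B (Xr (\<sigma> \<beta>)) (\<psi> (Xr \<beta>))"

lemma \<psi>_Xr: assumes "\<beta> \<in> R" shows "\<psi> (Xr \<beta>) = cf \<beta> *s Xr (- \<sigma> \<beta>)"
proof -
  have "\<psi> (Xr \<beta>) \<in> g (- \<sigma> \<beta>)" unfolding \<psi>_def
    using chev_weight[OF pihat_weight[OF Xr_weight[OF assms]]] by simp
  then have "\<psi> (Xr \<beta>) = B (Xr (- (- \<sigma> \<beta>))) (\<psi> (Xr \<beta>)) *s Xr (- \<sigma> \<beta>)"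
    by (rule weight_space_root) (intro root_neg \<sigma>_root assms)
  then show ?thesis by (simp only: neg_neg cf_def)
qed

lemma cf_neg: assumes "\<beta> \<in> R" shows "cf \<beta> * cf (- \<beta>) = 1"
proof -
  have "1 = B (\<psi> (Xr \<beta>)) (\<psi> (Xr (- \<beta>)))" by (simp add: B_aut[OF \<psi>_aut] Xr_pair[OF assms])
  also have "\<dots> = cf \<beta> * (cf (- \<beta>) * B (Xr (- \<sigma> \<beta>)) (Xr (\<sigma> \<beta>)))"
    unfolding \<psi>_Xr[OF assms] \<psi>_Xr[OF root_neg[OF assms]] by (simp add: B_simps \<sigma>_neg)
  finally show ?thesis by (simp add: Xr_pair'[OF \<sigma>_root[OF assms]])
qed

text \<open>Take \<open>conj\<close> at \<open>\<pi> \<gamma>\<close>, a member of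
  \<open>\<Gamma>\<^sub>2\<close>, and cancel the inverses.\<close>

lemma \<tau>\<pi>\<tau>: assumes "\<gamma> \<in> \<Gamma>\<^sub>1" shows "\<tau> (\<pi> (\<tau> \<gamma>)) = \<pi> \<gamma>" "\<pi> (\<tau> \<gamma>) \<in> \<Gamma>\<^sub>1" "\<tau> \<gamma> \<in> \<Gamma>"
proof -
  have p: "\<pi> \<gamma> \<in> \<Gamma>\<^sub>2" using assms swap by blast
  have "inv_into \<Gamma> \<pi> (\<pi> \<gamma>) = \<gamma>" using \<pi>_bij assms sub by (meson bij_betw_inv_into_left subsetD)
  then have "\<pi> (\<tau> \<gamma>) = inv_into \<Gamma>\<^sub>1 \<tau> (\<pi> \<gamma>)" using conj[OF p] by simp
  then show "\<tau> (\<pi> (\<tau> \<gamma>)) = \<pi> \<gamma>" using \<tau>_bij p by (simp add: bij_betw_inv_into_right)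
  have "\<tau> \<gamma> \<in> \<Gamma>\<^sub>2" using \<tau>_bij assms by (rule bij_betw_apply)
  then show "\<pi> (\<tau> \<gamma>) \<in> \<Gamma>\<^sub>1" "\<tau> \<gamma> \<in> \<Gamma>" using swap sub by auto
qed

lemma \<pi>\<tau>_bij: "bij_betw (\<lambda>x. \<pi> (\<tau> x)) \<Gamma>\<^sub>1 \<Gamma>\<^sub>1"
proof -
  have "bij_betw \<pi> \<Gamma>\<^sub>2 \<Gamma>\<^sub>1" by (rule bij_betw_subset[OF \<pi>_bij sub(2) swap(2)])
  then show ?thesis using bij_betw_trans[OF \<tau>_bij] by (simp add: comp_def)
qed

text \<open>Transporting the coefficients of \<beta> along the permutation
  \<open>\<pi> \<circ> \<tau>\<close> of \<open>\<Gamma>\<^sub>1\<close> gives those of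
  \<open>\<sigma> \<beta>'\<close>, and
  \<open>\<tau> (\<pi> (\<tau> \<gamma>)) = \<pi> \<gamma>\<close> identifies their image under
  \<tau> with \<open>\<sigma> \<beta>\<close>. So \<sigma> turns chains of \<tau> around.\<close>

lemma tau_ext_reverse: assumes "tau_ext \<Gamma>\<^sub>1 \<tau> \<beta> \<beta>'" shows "tau_ext \<Gamma>\<^sub>1 \<tau> (\<sigma> \<beta>') (\<sigma> \<beta>)"
proof -
  obtain c where c: "\<beta> = zcomb c id \<Gamma>\<^sub>1" "\<beta>' = zcomb c \<tau> \<Gamma>\<^sub>1" using assms by (auto simp: tau_ext_def)
  let ?d = "\<lambda>x. c (inv_into \<Gamma>\<^sub>1 (\<lambda>x. \<pi> (\<tau> x)) x)"
  have "\<sigma> \<beta>' = zcomb c (\<lambda>s. id (\<pi> (\<tau> s))) \<Gamma>\<^sub>1"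
    unfolding c \<sigma>_zcomb by (rule zcomb_fun_cong) (simp add: \<sigma>_base \<tau>\<pi>\<tau>)
  also have "\<dots> = zcomb ?d id \<Gamma>\<^sub>1" by (rule zcomb_reindex_inv[OF \<pi>\<tau>_bij])
  finally have 1: "\<sigma> \<beta>' = zcomb ?d id \<Gamma>\<^sub>1" .
  have "\<sigma> \<beta> = zcomb c (\<lambda>s. \<tau> (\<pi> (\<tau> s))) \<Gamma>\<^sub>1"
    unfolding c \<sigma>_zcomb by (rule zcomb_fun_cong) (use sub in \<open>auto simp: \<sigma>_base \<tau>\<pi>\<tau>\<close>)
  also have "\<dots> = zcomb ?d \<tau> \<Gamma>\<^sub>1" by (rule zcomb_reindex_inv[OF \<pi>\<tau>_bij])
  finally show ?thesis using 1 unfolding tau_ext_def by blast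
qed

lemma tau_ext_neg: assumes "tau_ext \<Gamma>\<^sub>1 \<tau> \<beta> \<beta>'" shows "tau_ext \<Gamma>\<^sub>1 \<tau> (- \<beta>) (- \<beta>')"
proof -
  obtain c where c: "\<beta> = zcomb c id \<Gamma>\<^sub>1" "\<beta>' = zcomb c \<tau> \<Gamma>\<^sub>1" using assms by (auto simp: tau_ext_def)
  have "- \<beta> = zcomb (\<lambda>s. - c s) id \<Gamma>\<^sub>1 \<and> - \<beta>' = zcomb (\<lambda>s. - c s) \<tau> \<Gamma>\<^sub>1"
    unfolding c zcomb_neg by simp
  then show ?thesis unfolding tau_ext_def by (rule exI[of _ "\<lambda>s. - c s"])
qed

section \<open>The isomorphism attached to \<tau>\<close>

definition \<theta> :: "'k^'n \<Rightarrow> 'k^'n" where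
  "\<theta> = (SOME \<theta>. lie_iso_between br (gen \<Gamma>\<^sub>1) (gen \<Gamma>\<^sub>2) \<theta> \<and>
    (\<forall>\<beta>\<in>\<Gamma>\<^sub>1. \<theta> (Xr \<beta>) = Xr (\<tau> \<beta>) \<and> \<theta> (Xr (- \<beta>)) = Xr (- \<tau> \<beta>)) \<and>
    (\<forall>\<beta>\<in>R. \<forall>\<beta>'. tau_ext \<Gamma>\<^sub>1 \<tau> \<beta> \<beta>' \<longrightarrow> \<theta> (Xr \<beta>) = Xr \<beta>'))"

lemma \<theta>: "lie_iso_between br (gen \<Gamma>\<^sub>1) (gen \<Gamma>\<^sub>2) \<theta>"
  "\<And>\<beta>. \<beta> \<in> \<Gamma>\<^sub>1 \<Longrightarrow> \<theta> (Xr \<beta>) = Xr (\<tau> \<beta>)" "\<And>\<beta>. \<beta> \<in> \<Gamma>\<^sub>1 \<Longrightarrow> \<theta> (Xr (- \<beta>)) = Xr (- \<tau> \<beta>)"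
  "\<And>\<beta> \<beta>'. \<beta> \<in> R \<Longrightarrow> tau_ext \<Gamma>\<^sub>1 \<tau> \<beta> \<beta>' \<Longrightarrow> \<theta> (Xr \<beta>) = Xr \<beta>'"
proof -
  have "\<tau> ` \<Gamma>\<^sub>1 = \<Gamma>\<^sub>2" using \<tau>_bij by (simp add: bij_betw_def)
  then have "(\<Union>\<beta>\<in>\<Gamma>\<^sub>1. {Xr (\<tau> \<beta>), Xr (- \<tau> \<beta>)}) = (\<Union>\<beta>\<in>\<Gamma>\<^sub>2. {Xr \<beta>, Xr (- \<beta>)})" by blast
  then have "\<exists>\<theta>. lie_iso_between br (gen \<Gamma>\<^sub>1) (gen \<Gamma>\<^sub>2) \<theta> \<and>
    (\<forall>\<beta>\<in>\<Gamma>\<^sub>1. \<theta> (Xr \<beta>) = Xr (\<tau> \<beta>) \<and> \<theta> (Xr (- \<beta>)) = Xr (- \<tau> \<beta>)) \<and>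
    (\<forall>\<beta>\<in>R. \<forall>\<beta>'. tau_ext \<Gamma>\<^sub>1 \<tau> \<beta> \<beta>' \<longrightarrow> \<theta> (Xr \<beta>) = Xr \<beta>')"
    using compatible by (simp only: tau_compatible_def gen_def)
  from someI_ex[OF this, folded \<theta>_def]
  show "lie_iso_between br (gen \<Gamma>\<^sub>1) (gen \<Gamma>\<^sub>2) \<theta>"
    "\<And>\<beta>. \<beta> \<in> \<Gamma>\<^sub>1 \<Longrightarrow> \<theta> (Xr \<beta>) = Xr (\<tau> \<beta>)" "\<And>\<beta>. \<beta> \<in> \<Gamma>\<^sub>1 \<Longrightarrow> \<theta> (Xr (- \<beta>)) = Xr (- \<tau> \<beta>)"
    "\<And>\<beta> \<beta>'. \<beta> \<in> R \<Longrightarrow> tau_ext \<Gamma>\<^sub>1 \<tau> \<beta> \<beta>' \<Longrightarrow> \<theta> (Xr \<beta>) = Xr \<beta>'" by blast+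
qed

lemma \<theta>_hom:
  "x \<in> gen \<Gamma>\<^sub>1 \<Longrightarrow> y \<in> gen \<Gamma>\<^sub>1 \<Longrightarrow> \<theta> (x + y) = \<theta> x + \<theta> y" "x \<in> gen \<Gamma>\<^sub>1 \<Longrightarrow> \<theta> (c *s x) = c *s \<theta> x"
  "x \<in> gen \<Gamma>\<^sub>1 \<Longrightarrow> y \<in> gen \<Gamma>\<^sub>1 \<Longrightarrow> \<theta> (br x y) = br (\<theta> x) (\<theta> y)" "inj_on \<theta> (gen \<Gamma>\<^sub>1)"
  "x \<in> gen \<Gamma>\<^sub>1 \<Longrightarrow> \<theta> (- x) = - \<theta> x"
proof -
  show a: "x \<in> gen \<Gamma>\<^sub>1 \<Longrightarrow> y \<in> gen \<Gamma>\<^sub>1 \<Longrightarrow> \<theta> (x + y) = \<theta> x + \<theta> y" "x \<in> gen \<Gamma>\<^sub>1 \<Longrightarrow> \<theta> (c *s x) = c *s \<theta> x"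
    "x \<in> gen \<Gamma>\<^sub>1 \<Longrightarrow> y \<in> gen \<Gamma>\<^sub>1 \<Longrightarrow> \<theta> (br x y) = br (\<theta> x) (\<theta> y)" "inj_on \<theta> (gen \<Gamma>\<^sub>1)" for x y c
    using \<theta>(1) by (auto simp: lie_iso_between_def bij_betw_def)
  show "x \<in> gen \<Gamma>\<^sub>1 \<Longrightarrow> \<theta> (- x) = - \<theta> x" using a(2)[of x "-1"] by simp
qed

text \<open>Homogeneous elements whose degree, a family of integers over
  \<open>\<Gamma>\<^sub>1\<close>, is carried by \<theta> along \<tau>. They give the weight of
  \<open>\<theta> (Xr \<beta>)\<close>, which \<open>\<theta> (Xr \<beta>) = Xr \<beta>'\<close>
  does not reveal before \<beta>' is known to be a root.\<close>

definition graded :: "('k^'n) set" where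
  "graded = {y \<in> gen \<Gamma>\<^sub>1. \<exists>c. y \<in> g (zcomb c id \<Gamma>\<^sub>1) \<and> \<theta> y \<in> g (zcomb c \<tau> \<Gamma>\<^sub>1)}"

lemma graded_br: assumes "x \<in> graded" "y \<in> graded" shows "br x y \<in> graded"
proof -
  obtain c d where c: "x \<in> gen \<Gamma>\<^sub>1" "x \<in> g (zcomb c id \<Gamma>\<^sub>1)" "\<theta> x \<in> g (zcomb c \<tau> \<Gamma>\<^sub>1)"
    and d: "y \<in> gen \<Gamma>\<^sub>1" "y \<in> g (zcomb d id \<Gamma>\<^sub>1)" "\<theta> y \<in> g (zcomb d \<tau> \<Gamma>\<^sub>1)"
    using assms by (auto simp: graded_def)
  have e: "zcomb (\<lambda>s. c s + d s) f \<Gamma>\<^sub>1 = (\<lambda>y. zcomb c f \<Gamma>\<^sub>1 y + zcomb d f \<Gamma>\<^sub>1 y)" for f :: "_ \<Rightarrow> 'k^'n \<Rightarrow> 'k"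
    by (rule ext) (rule zcomb_add)
  have "br x y \<in> g (zcomb (\<lambda>s. c s + d s) id \<Gamma>\<^sub>1)" "\<theta> (br x y) \<in> g (zcomb (\<lambda>s. c s + d s) \<tau> \<Gamma>\<^sub>1)"
    unfolding e using weight_br c d \<theta>_hom(3)[OF c(1) d(1)] by auto
  then show ?thesis using lie_subalgD(3)[OF gen_subalg c(1) d(1)] unfolding graded_def by blast
qed

lemma finite_\<Gamma>\<^sub>1: "finite \<Gamma>\<^sub>1" using sub finite_base finite_subset by blast

text \<open>The generators are homogeneous, and degrees add under the bracket on both sides of
  \<theta>.\<close>

lemma gen_graded: assumes "x \<in> gen \<Gamma>\<^sub>1" "\<Gamma>\<^sub>1 \<noteq> {}" shows "x \<in> vec.span graded"
  using assms(1)
proof (induction rule: gen_induct)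
  case (pos \<gamma>)
  let ?c = "\<lambda>x. if x = \<gamma> then 1 else 0 :: int"
  have z: "zcomb ?c f \<Gamma>\<^sub>1 = f \<gamma>" for f :: "_ \<Rightarrow> 'k^'n \<Rightarrow> 'k"
    by (rule ext) (simp add: zcomb_single[OF finite_\<Gamma>\<^sub>1 pos])
  have "Xr \<gamma> \<in> g (zcomb ?c id \<Gamma>\<^sub>1)" "\<theta> (Xr \<gamma>) \<in> g (zcomb ?c \<tau> \<Gamma>\<^sub>1)"
    unfolding z \<theta>(2)[OF pos] using Xr_weight \<tau>\<pi>\<tau>(3)[OF pos] pos sub base_roots by auto
  then show ?case using gen_base(1)[OF pos] by (intro vec.span_base) (auto simp: graded_def)
next
  case (neg \<gamma>)
  let ?c = "\<lambda>x. - (if x = \<gamma> then 1 else 0 :: int)"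
  have z: "zcomb ?c f \<Gamma>\<^sub>1 = - f \<gamma>" for f :: "_ \<Rightarrow> 'k^'n \<Rightarrow> 'k"
    unfolding zcomb_neg by (rule ext) (simp add: zcomb_single[OF finite_\<Gamma>\<^sub>1 neg])
  have "Xr (- \<gamma>) \<in> g (zcomb ?c id \<Gamma>\<^sub>1)" "\<theta> (Xr (- \<gamma>)) \<in> g (zcomb ?c \<tau> \<Gamma>\<^sub>1)"
    unfolding z \<theta>(3)[OF neg] using Xr_weight[OF root_neg] \<tau>\<pi>\<tau>(3)[OF neg] neg sub base_roots by auto
  then show ?case using gen_base(2)[OF neg] unfolding graded_def by (intro vec.span_base) blast
next
  case (br x z)
  \<comment> \<open>Bilinearity in two stages: the second factor runs through the span while the
    first stays homogeneous, then the first runs through the span.\<close>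
  have "br y z \<in> vec.span graded" if y: "y \<in> graded" for y
    by (rule linear_span_subspace[OF br_lin(1) vec.subspace_span _ br(4)]) (intro vec.span_base graded_br y)
  then show ?case
    by (rule linear_span_subspace[OF br_lin(2) vec.subspace_span _ br(3)])
qed (use assms(2) in \<open>auto intro: vec.span_add vec.span_scale\<close>)

text \<open>Homogeneous elements span \<open>gen \<Gamma>\<^sub>1\<close>, so one of them,
  \<open>y\<close>, pairs nontrivially with \<open>Xr (- \<beta>)\<close> and has weight \<beta>.
  Independence of the base makes its degree that of \<beta>. Hence \<open>\<theta> y\<close>,
  nonzero by injectivity, has weight \<beta>'.\<close>

lemma tau_ext_Xr:
  assumes \<beta>: "\<beta> \<in> R" and ext: "tau_ext \<Gamma>\<^sub>1 \<tau> \<beta> \<beta>'"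
  shows "Xr \<beta> \<in> gen \<Gamma>\<^sub>1" "\<Gamma>\<^sub>1 \<noteq> {}" "\<beta>' \<in> R"
proof -
  obtain c where c: "\<beta> = zcomb c id \<Gamma>\<^sub>1" "\<beta>' = zcomb c \<tau> \<Gamma>\<^sub>1" using ext by (auto simp: tau_ext_def)
  show gen: "Xr \<beta> \<in> gen \<Gamma>\<^sub>1" by (rule Xr_in_gen[OF sub(1) \<beta> c(1)])
  show ne: "\<Gamma>\<^sub>1 \<noteq> {}" using root_nonzero[OF \<beta>] c(1) by (auto simp: zcomb_def)
  have "\<exists>y\<in>graded. B (Xr (- \<beta>)) y \<noteq> 0"
  proof (rule ccontr)
    assume "\<not> ?thesis"
    then have "graded \<subseteq> {y. B (Xr (- \<beta>)) y = 0}" by blast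
    then have "vec.span graded \<subseteq> {y. B (Xr (- \<beta>)) y = 0}"
      by (rule vec.span_minimal) (auto simp: vec.subspace_def B_simps)
    then have "B (Xr (- \<beta>)) (Xr \<beta>) = 0" using gen_graded[OF gen ne] by blast
    then show False using Xr_pair'[OF \<beta>] by simp
  qed
  then obtain y d where y: "y \<in> gen \<Gamma>\<^sub>1" "B (Xr (- \<beta>)) y \<noteq> 0" "y \<in> g (zcomb d id \<Gamma>\<^sub>1)" "\<theta> y \<in> g (zcomb d \<tau> \<Gamma>\<^sub>1)"
    by (auto simp: graded_def)
  have "zcomb d id \<Gamma>\<^sub>1 = \<beta>" by (rule B_weight_eq[OF \<beta> zcomb_outside[OF sub(1)] y(3,2)])
  then have dc: "d \<gamma> = c \<gamma>" if "\<gamma> \<in> \<Gamma>\<^sub>1" for \<gamma>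
    by (intro zcomb_eqD[OF sub(1) _ that]) (simp only: c(1))
  then have \<beta>': "zcomb d \<tau> \<Gamma>\<^sub>1 = \<beta>'" unfolding c(2) by (rule zcomb_cong)
  obtain k where k: "y = k *s Xr \<beta>" using weight_space_root[OF _ \<beta>] y(3) \<open>zcomb d id \<Gamma>\<^sub>1 = \<beta>\<close> by metis
  then have "\<theta> y = k *s Xr \<beta>'" using \<theta>_hom(2)[OF gen] \<theta>(4)[OF \<beta> ext] by simp
  moreover have "\<theta> 0 = 0" using \<theta>_hom(2)[OF gen, of 0] by simp
  then have "\<theta> y \<noteq> 0" using inj_onD[OF \<theta>_hom(4), of y 0] y(1,2) lie_subalgD(4)[OF gen_subalg] by auto
  ultimately have w: "\<theta> y \<in> g \<beta>'" "\<theta> y \<noteq> 0" using y(4) \<beta>' by auto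
  have \<beta>'2: "\<beta>' = zcomb (\<lambda>x. c (inv_into \<Gamma>\<^sub>1 \<tau> x)) id \<Gamma>\<^sub>2"
    unfolding c(2) using zcomb_reindex_inv[OF \<tau>_bij, of c id] by simp
  have out: "\<beta>' y = 0" if "y \<notin> h" for y unfolding \<beta>'2 by (rule zcomb_outside[OF sub(2) that])
  \<comment> \<open>Over \<open>\<Gamma>\<^sub>2\<close>, which is independent too, \<beta>' has the
    coefficients of \<beta> transported by \<tau>.\<close>
  have "\<beta>' \<noteq> (\<lambda>y. 0)"
  proof
    assume "\<beta>' = (\<lambda>y. 0)"
    then have z: "zcomb (\<lambda>x. c (inv_into \<Gamma>\<^sub>1 \<tau> x)) id \<Gamma>\<^sub>2 y = zcomb (\<lambda>_. 0) id \<Gamma>\<^sub>2 y" for y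
      unfolding \<beta>'2[symmetric] by (simp add: zcomb_def)
    have "c \<gamma> = 0" if "\<gamma> \<in> \<Gamma>\<^sub>1" for \<gamma>
      using zcomb_eqD[OF sub(2) z, of "\<tau> \<gamma>"] bij_betw_apply[OF \<tau>_bij that]
        bij_betw_inv_into_left[OF \<tau>_bij that] by simp
    then have "\<beta> = zcomb (\<lambda>_. 0) id \<Gamma>\<^sub>1" unfolding c(1) by (rule zcomb_cong)
    then show False using root_nonzero[OF \<beta>] by (simp add: zcomb_def)
  qed
  then show "\<beta>' \<in> R" using weight_space_nonroot[OF w(1) _ out] w(2) by blast
qed

text \<open>On generators this is \<open>\<tau> (\<pi> (\<tau> \<gamma>)) = \<pi> \<gamma>\<close>,
  with sign and negation of roots supplied by the Chevalley automorphism. The membership is proved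
  along with it because \<theta> can be applied again only inside
  \<open>gen \<Gamma>\<^sub>1\<close>.\<close>

lemma \<theta>\<psi>\<theta>:
  assumes "x \<in> gen \<Gamma>\<^sub>1" "\<Gamma>\<^sub>1 \<noteq> {}"
  shows "\<psi> (\<theta> x) \<in> gen \<Gamma>\<^sub>1 \<and> \<theta> (\<psi> (\<theta> x)) = \<psi> x"
  using assms(1)
proof (induction rule: gen_induct)
  case (pos \<gamma>)
  have "\<psi> (\<theta> (Xr \<gamma>)) = - Xr (- \<pi> (\<tau> \<gamma>))" by (simp only: \<theta>(2)[OF pos] \<psi>_base \<tau>\<pi>\<tau>[OF pos])
  moreover have "\<psi> (Xr \<gamma>) = - Xr (- \<pi> \<gamma>)" using \<psi>_base pos sub by blast
  moreover note m = gen_base(2)[OF \<tau>\<pi>\<tau>(2)[OF pos]]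
  ultimately show ?case
    using lie_subalgD(5)[OF gen_subalg m] \<theta>_hom(5)[OF m] \<theta>(3)[OF \<tau>\<pi>\<tau>(2)[OF pos]]
    by (simp only: \<tau>\<pi>\<tau>[OF pos])
next
  case (neg \<gamma>)
  have "\<psi> (\<theta> (Xr (- \<gamma>))) = - Xr (\<pi> (\<tau> \<gamma>))" by (simp only: \<theta>(3)[OF neg] \<psi>_base \<tau>\<pi>\<tau>[OF neg])
  moreover have "\<psi> (Xr (- \<gamma>)) = - Xr (\<pi> \<gamma>)" using \<psi>_base neg sub by blast
  moreover note m = gen_base(1)[OF \<tau>\<pi>\<tau>(2)[OF neg]]
  ultimately show ?case
    using lie_subalgD(5)[OF gen_subalg m] \<theta>_hom(5)[OF m] \<theta>(2)[OF \<tau>\<pi>\<tau>(2)[OF neg]]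
    by (simp only: \<tau>\<pi>\<tau>[OF neg])
qed (use assms(2) lie_subalgD[OF gen_subalg] in \<open>auto simp: \<theta>_hom lie_aut_simps[OF \<psi>_aut]\<close>)

text \<open>Evaluate \<open>\<theta> (\<psi> (\<theta> x)) = \<psi> x\<close> at
  \<open>Xr \<beta>\<close>. The reversed relation, negated, says that \<theta> takes
  \<open>Xr (- \<sigma> \<beta>')\<close> to \<open>Xr (- \<sigma> \<beta>)\<close>, so both sides
  are multiples of the latter vector.\<close>

lemma cf_tau_ext: assumes \<beta>: "\<beta> \<in> R" and ext: "tau_ext \<Gamma>\<^sub>1 \<tau> \<beta> \<beta>'" shows "cf \<beta>' = cf \<beta>"
proof -
  note e = tau_ext_Xr[OF \<beta> ext]
  note ext' = tau_ext_neg[OF tau_ext_reverse[OF ext]]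
  have r: "- \<sigma> \<beta>' \<in> R" by (intro root_neg \<sigma>_root e)
  have "\<theta> (\<psi> (\<theta> (Xr \<beta>))) = \<theta> (cf \<beta>' *s Xr (- \<sigma> \<beta>'))" by (simp only: \<theta>(4)[OF \<beta> ext] \<psi>_Xr[OF e(3)])
  also have "\<dots> = cf \<beta>' *s Xr (- \<sigma> \<beta>)"
    by (simp only: \<theta>_hom(2)[OF tau_ext_Xr(1)[OF r ext']] \<theta>(4)[OF r ext'])
  finally have "cf \<beta>' *s Xr (- \<sigma> \<beta>) = cf \<beta> *s Xr (- \<sigma> \<beta>)"
    using \<theta>\<psi>\<theta>[OF e(1,2)] \<psi>_Xr[OF \<beta>] by auto
  then show ?thesis using Xr_nonzero(2)[OF \<sigma>_root[OF \<beta>]] by (auto simp only: vec.scale_cancel_right)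
qed

lemma tau_ext_pos:
  assumes "\<beta> \<in> pos_roots br h \<Gamma>" "tau_ext \<Gamma>\<^sub>1 \<tau> \<beta> \<beta>'" shows "\<beta>' \<in> pos_roots br h \<Gamma>"
proof -
  obtain c where c: "\<beta> = zcomb c id \<Gamma>\<^sub>1" "\<beta>' = zcomb c \<tau> \<Gamma>\<^sub>1" using assms(2) by (auto simp: tau_ext_def)
  have "\<beta>' = zcomb (\<lambda>x. c (inv_into \<Gamma>\<^sub>1 \<tau> x)) id \<Gamma>\<^sub>2"
    unfolding c(2) using zcomb_reindex_inv[OF \<tau>_bij, of c id] by simp
  then show ?thesis
    by (rule pos_rootI[OF sub(2) tau_ext_Xr(3)[OF pos_root[OF assms(1)] assms(2)]])
      (use pos_rootD[OF sub(1) assms(1) c(1)] \<tau>_bij in \<open>auto intro: bij_betw_apply bij_betw_inv_into\<close>)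
qed

text \<open>The reversed chain must again index a summand of \<open>r_BD\<close>. The last conjunct
  secures this: for \<open>k > 0\<close> the chain leaves from \<open>\<sigma> \<beta>'\<close>,
  which therefore lies in the domain of the extended \<tau>.\<close>

lemma tau_ext_pow:
  assumes "\<beta> \<in> pos_roots br h \<Gamma>" "(tau_ext \<Gamma>\<^sub>1 \<tau> ^^ k) \<beta> \<beta>'"
  shows "\<beta>' \<in> pos_roots br h \<Gamma> \<and> cf \<beta>' = cf \<beta> \<and> (tau_ext \<Gamma>\<^sub>1 \<tau> ^^ k) (\<sigma> \<beta>') (\<sigma> \<beta>) \<and>
    (0 < k \<longrightarrow> \<sigma> \<beta>' \<in> zspan \<Gamma>\<^sub>1)"
  using assms(2)
proof (induction k arbitrary: \<beta>')
  case 0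
  then show ?case using assms(1) by simp
next
  case (Suc k)
  then obtain \<delta> where d: "(tau_ext \<Gamma>\<^sub>1 \<tau> ^^ k) \<beta> \<delta>" "tau_ext \<Gamma>\<^sub>1 \<tau> \<delta> \<beta>'" by auto
  note IH = Suc.IH[OF d(1)]
  have "(tau_ext \<Gamma>\<^sub>1 \<tau> ^^ Suc k) (\<sigma> \<beta>') (\<sigma> \<beta>)"
    using relpowp_Suc_I2[of "tau_ext \<Gamma>\<^sub>1 \<tau>", OF tau_ext_reverse[OF d(2)]] IH by blast
  moreover have "\<sigma> \<beta>' \<in> zspan \<Gamma>\<^sub>1"
    using tau_ext_reverse[OF d(2)] unfolding tau_ext_def zspan_def by blast
  moreover have "\<beta>' \<in> pos_roots br h \<Gamma>" "cf \<beta>' = cf \<beta>"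
    using tau_ext_pos[OF _ d(2)] cf_tau_ext[OF pos_root d(2)] IH by auto
  ultimately show ?case by blast
qed

section \<open>The three summands of the r-matrix\<close>

lemma \<psi>_lin: "Vector_Spaces.linear (*s) (*s) \<psi>" using lie_autD(1)[OF \<psi>_aut] .

lemma tmap_\<psi>_rh: "tmap \<psi> \<psi> r\<^sub>h = flip r\<^sub>h"
proof -
  have "tmap chev chev T = T" if "T \<in> tensor_square h" for T
  proof -
    \<comment> \<open>On pure tensors of \<open>h\<close> the two signs of \<open>chev\<close>
      cancel. Membership in the zero subspace is the form in which this extends to the span.\<close>
    have "tmap chev chev T - T \<in> {0}"
      using that unfolding tensor_square_def
    proof (rule linear_span_subspace[rotated 3, of T _ "\<lambda>T. tmap chev chev T - T"])
      show "Vector_Spaces.linear (*s) (*s) (\<lambda>T. tmap chev chev T - T)"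
        using linear_tmap[of chev chev] unfolding linear_vec_iff by (simp add: vec.scale_right_diff_distrib)
      show "vec.subspace {0 :: 'k^('n \<times> 'n)}" by (simp add: vec.subspace_def)
      show "tmap chev chev S - S \<in> {0}" if "S \<in> {tens x y |x y. x \<in> h \<and> y \<in> h}" for S
        using that by (auto simp: tmap_tens lie_autD(1)[OF chev_aut] chev_h tens_minus_left tens_minus_right)
    qed
    then show ?thesis by simp
  qed
  then have "tmap chev chev (tmap pihat pihat r\<^sub>h) = flip r\<^sub>h"
    by (simp add: cartan_part flip_tensor_square[OF rh_tensor])
  then show ?thesis
    unfolding \<psi>_def by (simp add: tmap_comp lie_autD(1)[OF chev_aut] lie_autD(1)[OF pihat_aut])
qed

lemma tmap_\<psi>_Xr: assumes "\<beta> \<in> R" "\<delta> \<in> R"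
  shows "tmap \<psi> \<psi> (tens (Xr \<beta>) (Xr \<delta>)) = (cf \<beta> * cf \<delta>) *s tens (Xr (- \<sigma> \<beta>)) (Xr (- \<sigma> \<delta>))"
  unfolding tmap_tens[OF \<psi>_lin \<psi>_lin] \<psi>_Xr[OF assms(1)] \<psi>_Xr[OF assms(2)]
  by (simp add: tens_scale_left tens_scale_right)

lemma tmap_\<psi>_r_BD:
  "tmap \<psi> \<psi> (r_BD br h \<Gamma> Xr \<Gamma>\<^sub>1 \<tau> r\<^sub>h) = flip (r_BD br h \<Gamma> Xr \<Gamma>\<^sub>1 \<tau> r\<^sub>h)"
proof -
  let ?T = "tmap \<psi> \<psi>" and ?P = "pos_roots br h \<Gamma>"
  let ?S = "{(\<beta>, k, \<beta>'). \<beta> \<in> ?P \<inter> zspan \<Gamma>\<^sub>1 \<and> 0 < k \<and> (tau_ext \<Gamma>\<^sub>1 \<tau> ^^ k) \<beta> \<beta>'}"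
  \<comment> \<open>This involution of the index set reverses a chain and keeps its length. Since
    flipping a wedge exchanges its factors, the image of the term of a chain is the flipped term of
    the reversed chain.\<close>
  let ?\<Phi> = "\<lambda>(\<beta>, k :: nat, \<beta>'). (\<sigma> \<beta>', k, \<sigma> \<beta>)"
  have "?T (\<Sum>\<beta>\<in>?P. tens (Xr \<beta>) (Xr (- \<beta>))) = (\<Sum>\<beta>\<in>?P. flip (tens (Xr (\<sigma> \<beta>)) (Xr (- \<sigma> \<beta>))))"
    unfolding linear_vec_sum[OF linear_tmap]
    by (rule sum.cong) (simp_all add: tmap_\<psi>_Xr pos_root root_neg cf_neg \<sigma>_neg)
  also have "\<dots> = (\<Sum>\<beta>\<in>?P. flip (tens (Xr \<beta>) (Xr (- \<beta>))))"
    by (rule sum.reindex_bij_witness[of _ \<sigma> \<sigma>]) (simp_all add: \<sigma>_pos \<sigma>_\<sigma> pos_root)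
  finally have 1: "?T (\<Sum>\<beta>\<in>?P. tens (Xr \<beta>) (Xr (- \<beta>))) = flip (\<Sum>\<beta>\<in>?P. tens (Xr \<beta>) (Xr (- \<beta>)))"
    by (simp only: linear_vec_sum[OF linear_flip])
  have \<Phi>: "?\<Phi> x \<in> ?S" "?\<Phi> (?\<Phi> x) = x" if "x \<in> ?S" for x
    using that tau_ext_pow \<sigma>_pos \<sigma>_\<sigma> pos_root by fastforce+
  have w: "?T (wedge (Xr \<beta>) (Xr (- \<beta>'))) = flip (wedge (Xr (\<sigma> \<beta>')) (Xr (- \<sigma> \<beta>)))"
    if "(\<beta>, k, \<beta>') \<in> ?S" for \<beta> k \<beta>'
  proof -
    have b: "\<beta> \<in> R" "\<beta>' \<in> R" "cf \<beta>' = cf \<beta>" using that tau_ext_pow[of \<beta> k \<beta>'] pos_root by auto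
    \<comment> \<open>The factors belong to \<beta> and \<open>- \<beta>'\<close>; constancy along
      the chain makes their product one of opposite roots.\<close>
    have "cf \<beta> * cf (- \<beta>') = 1" using cf_neg[OF b(2)] b(3) by simp
    then show ?thesis
      by (simp add: wedge_def linear_vec_diff[OF linear_tmap] linear_vec_diff[OF linear_flip] tmap_\<psi>_Xr b root_neg \<sigma>_neg mult.commute)
  qed
  have "?T (\<Sum>(\<beta>, k, \<beta>')\<in>?S. wedge (Xr \<beta>) (Xr (- \<beta>'))) =
    (\<Sum>x\<in>?S. (\<lambda>(\<beta>, k, \<beta>'). flip (wedge (Xr \<beta>) (Xr (- \<beta>')))) (?\<Phi> x))"
    unfolding linear_vec_sum[OF linear_tmap] by (rule sum.cong[OF refl]) (use w in auto)
  also have "\<dots> = (\<Sum>x\<in>?S. (\<lambda>(\<beta>, k, \<beta>'). flip (wedge (Xr \<beta>) (Xr (- \<beta>')))) x)"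
    by (rule sum.reindex_bij_witness[of _ ?\<Phi> ?\<Phi>]) (use \<Phi> in auto)
  also have "\<dots> = flip (\<Sum>(\<beta>, k, \<beta>')\<in>?S. wedge (Xr \<beta>) (Xr (- \<beta>')))"
    unfolding linear_vec_sum[OF linear_flip] by (rule sum.cong[OF refl]) auto
  finally have 2: "?T (\<Sum>(\<beta>, k, \<beta>')\<in>?S. wedge (Xr \<beta>) (Xr (- \<beta>'))) =
    flip (\<Sum>(\<beta>, k, \<beta>')\<in>?S. wedge (Xr \<beta>) (Xr (- \<beta>')))" .
  have add: "?T (x + y) = ?T x + ?T y" "flip (x + y) = flip x + flip y" for x y :: "'k^('n \<times> 'n)"
    using linear_tmap linear_flip unfolding linear_vec_iff by blast+
  show ?thesis unfolding r_BD_def add tmap_\<psi>_rh 1 2 ..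
qed

end

section \<open>Galois action\<close>

lemma GalD:
  assumes "\<gamma> \<in> Gal F"
  shows "bij \<gamma>" "\<gamma> 1 = 1" "\<gamma> (x + y) = \<gamma> x + \<gamma> y" "\<gamma> (x * y) = \<gamma> x * \<gamma> y" "x \<in> F \<Longrightarrow> \<gamma> x = x"
  using assms by (auto simp: Gal_def)

lemma Gal_simps:
  assumes "\<gamma> \<in> Gal F"
  shows "\<gamma> 0 = 0" "\<gamma> (- x) = - \<gamma> x" "\<gamma> (x - y) = \<gamma> x - \<gamma> y" "\<gamma> (inverse x) = inverse (\<gamma> x)"
    "\<gamma> (\<Sum>i\<in>A. f i) = (\<Sum>i\<in>A. \<gamma> (f i))"
proof -
  show z: "\<gamma> 0 = 0" using GalD(3)[OF assms, of 0 0] by (metis add_0_left add_cancel_right_right)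
  show n: "\<gamma> (- x) = - \<gamma> x" for x using GalD(3)[OF assms, of x "- x"] z by (simp add: eq_neg_iff_add_eq_0 add.commute)
  show "\<gamma> (x - y) = \<gamma> x - \<gamma> y" using GalD(3)[OF assms, of x "- y"] n by simp
  show "\<gamma> (inverse x) = inverse (\<gamma> x)"
  proof (cases "x = 0")
    case False
    then have "\<gamma> x * \<gamma> (inverse x) = 1" using GalD(4)[OF assms, of x "inverse x"] GalD(2)[OF assms] by simp
    then show ?thesis by (simp add: inverse_unique)
  qed (simp add: z)
  show "\<gamma> (\<Sum>i\<in>A. f i) = (\<Sum>i\<in>A. \<gamma> (f i))"
    by (induction A rule: infinite_finite_induct) (simp_all add: z GalD(3)[OF assms])
qed

lemma Gal_comp: "\<gamma> \<in> Gal F \<Longrightarrow> \<eta> \<in> Gal F \<Longrightarrow> \<gamma> \<circ> \<eta> \<in> Gal F"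
  by (auto simp: Gal_def bij_comp)

text \<open>The fixed points of an automorphism form a field, so \<alpha> and the base field decide.
  All later case distinctions are made on \<open>\<gamma> \<alpha>\<close>.\<close>

lemma Gal_adjoin: "\<gamma> \<in> Gal (adjoin \<alpha>) \<longleftrightarrow> \<gamma> \<in> Gal base_field \<and> \<gamma> \<alpha> = \<alpha>"
proof
  have "insert \<alpha> base_field \<subseteq> adjoin \<alpha>" unfolding adjoin_def by (rule hull_subset)
  moreover assume "\<gamma> \<in> Gal (adjoin \<alpha>)"
  ultimately show "\<gamma> \<in> Gal base_field \<and> \<gamma> \<alpha> = \<alpha>" by (auto simp: Gal_def)
next
  assume \<gamma>: "\<gamma> \<in> Gal base_field \<and> \<gamma> \<alpha> = \<alpha>"
  then have g: "\<gamma> \<in> Gal base_field" by blast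
  have "field_subset {x. \<gamma> x = x}"
    by (auto simp: field_subset_def GalD(2-4)[OF g] Gal_simps[OF g])
  then have "adjoin \<alpha> \<subseteq> {x. \<gamma> x = x}"
    unfolding adjoin_def by (intro hull_minimal) (use \<gamma> GalD(5)[OF g] in auto)
  then show "\<gamma> \<in> Gal (adjoin \<alpha>)" using g by (auto simp: Gal_def)
qed

lemma map_vec_inv:
  assumes "bij \<gamma>" shows "map_vec \<gamma> (map_vec (inv_into UNIV \<gamma>) x) = x" "map_vec (inv_into UNIV \<gamma>) (map_vec \<gamma> x) = x"
  using assms by (auto simp: vec_eq_iff bij_is_surj surj_f_inv_f bij_is_inj)

lemma gal_conj_comp: "bij \<gamma> \<Longrightarrow> gal_conj \<gamma> (\<phi> \<circ> \<psi>) = gal_conj \<gamma> \<phi> \<circ> gal_conj \<gamma> \<psi>"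
  by (auto simp: gal_conj_def map_vec_inv)

lemma gal_conj_id: "bij \<gamma> \<Longrightarrow> gal_conj \<gamma> id = id"
  by (auto simp: gal_conj_def map_vec_inv)

text \<open>The matrix of a base-changed map has entries in the base field.\<close>

lemma gal_conj_bc_map:
  assumes g: "\<gamma> \<in> Gal base_field" shows "gal_conj \<gamma> (bc_map f) = bc_map f"
proof -
  have fix_ac: "\<gamma> (to_ac x) = to_ac x" for x using GalD(5)[OF g] by (simp add: base_field_def)
  have "map_vec \<gamma> (bc_map f y) = bc_map f (map_vec \<gamma> y)" for y
    by (simp add: vec_eq_iff bc_map_def sum_component Gal_simps[OF g] GalD(4)[OF g] fix_ac)
  then show ?thesis by (auto simp: gal_conj_def map_vec_inv GalD(1)[OF g])
qed

section \<open>Cohomology classes\<close>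

text \<open>The action is kept abstract, so that both the untwisted and the twisted relation are
  covered.\<close>

lemma cohomologous_equiv:
  assumes A: "id \<in> A" "\<And>\<rho> \<sigma>. \<rho> \<in> A \<Longrightarrow> \<sigma> \<in> A \<Longrightarrow> \<rho> \<circ> \<sigma> \<in> A" "\<And>\<rho>. \<rho> \<in> A \<Longrightarrow> inv_into UNIV \<rho> \<in> A" "\<And>\<rho>. \<rho> \<in> A \<Longrightarrow> bij \<rho>"
    and comp: "\<And>\<gamma> \<rho> \<sigma>. \<gamma> \<in> Gal base_field \<Longrightarrow> act \<gamma> (\<rho> \<circ> \<sigma>) = act \<gamma> \<rho> \<circ> act \<gamma> \<sigma>"
    and one: "\<And>\<gamma>. \<gamma> \<in> Gal base_field \<Longrightarrow> act \<gamma> id = id"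
  shows "equiv Z (cohomologous act A Z)"
proof (rule equivI)
  show "cohomologous act A Z \<subseteq> Z \<times> Z" by (auto simp: cohomologous_def)
  show "refl_on Z (cohomologous act A Z)"
    using A(1) one by (auto simp: refl_on_def cohomologous_def intro!: bexI[of _ id])
  show "sym (cohomologous act A Z)"
  proof (rule symI)
    fix u w assume "(u, w) \<in> cohomologous act A Z"
    then obtain \<rho> where \<rho>: "u \<in> Z" "w \<in> Z" "\<rho> \<in> A"
      "\<And>\<gamma>. \<gamma> \<in> Gal base_field \<Longrightarrow> w \<gamma> = inv_into UNIV \<rho> \<circ> u \<gamma> \<circ> act \<gamma> \<rho>"
      by (auto simp: cohomologous_def)
    let ?i = "inv_into UNIV \<rho>"
    have i: "\<rho> \<circ> ?i = id" "inv_into UNIV ?i = \<rho>"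
      using A(4)[OF \<rho>(3)] by (auto simp: fun_eq_iff bij_is_surj surj_f_inv_f inv_inv_eq)
    have "u \<gamma> = inv_into UNIV ?i \<circ> w \<gamma> \<circ> act \<gamma> ?i" if g: "\<gamma> \<in> Gal base_field" for \<gamma>
    proof -
      have "inv_into UNIV ?i \<circ> w \<gamma> \<circ> act \<gamma> ?i = (\<rho> \<circ> ?i) \<circ> u \<gamma> \<circ> (act \<gamma> \<rho> \<circ> act \<gamma> ?i)"
        by (simp only: i \<rho>(4)[OF g] o_assoc)
      then show ?thesis by (simp add: i comp[OF g, symmetric] one[OF g])
    qed
    then show "(w, u) \<in> cohomologous act A Z" using \<rho>(1-2) A(3)[OF \<rho>(3)] by (auto simp: cohomologous_def)
  qed
  show "trans (cohomologous act A Z)"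
  proof (rule transI)
    fix u w x assume "(u, w) \<in> cohomologous act A Z" "(w, x) \<in> cohomologous act A Z"
    then obtain \<rho> \<sigma> where \<rho>: "u \<in> Z" "x \<in> Z" "\<rho> \<in> A" "\<sigma> \<in> A"
      "\<And>\<gamma>. \<gamma> \<in> Gal base_field \<Longrightarrow> w \<gamma> = inv_into UNIV \<rho> \<circ> u \<gamma> \<circ> act \<gamma> \<rho>"
      "\<And>\<gamma>. \<gamma> \<in> Gal base_field \<Longrightarrow> x \<gamma> = inv_into UNIV \<sigma> \<circ> w \<gamma> \<circ> act \<gamma> \<sigma>"
      by (auto simp: cohomologous_def)
    have "x \<gamma> = inv_into UNIV (\<rho> \<circ> \<sigma>) \<circ> u \<gamma> \<circ> act \<gamma> (\<rho> \<circ> \<sigma>)" if g: "\<gamma> \<in> Gal base_field" for \<gamma>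
      by (simp only: \<rho>(6)[OF g] \<rho>(5)[OF g] o_inv_distrib[OF A(4)[OF \<rho>(3)] A(4)[OF \<rho>(4)]] comp[OF g] o_assoc)
    then show "(u, x) \<in> cohomologous act A Z"
      using \<rho>(1,2) A(2)[OF \<rho>(3,4)] by (auto simp: cohomologous_def)
  qed
qed

text \<open>One direction of \<open>iff\<close> makes the map well defined on classes, the other
  makes it injective.\<close>

lemma quotient_injection:
  assumes E: "equiv Z E" and E': "equiv Z' E'" and h: "\<And>u. u \<in> Z \<Longrightarrow> h u \<in> Z'"
    and iff: "\<And>u w. u \<in> Z \<Longrightarrow> w \<in> Z \<Longrightarrow> (h u, h w) \<in> E' \<longleftrightarrow> (u, w) \<in> E"
  shows "\<exists>F. F \<in> Z // E \<rightarrow> Z' // E' \<and> (\<forall>u\<in>Z. F (E `` {u}) = E' `` {h u}) \<and> inj_on F (Z // E)"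
proof -
  let ?F = "\<lambda>C. (\<Union>x\<in>C. E' `` {h x})"
  have ES: "E \<subseteq> Z \<times> Z" using E by (simp add: equiv_def)
  have "congruent E (\<lambda>x. E' `` {h x})"
  proof (rule congruentI)
    fix u w assume "(u, w) \<in> E"
    then have "(h u, h w) \<in> E'" using iff ES by blast
    then show "E' `` {h u} = E' `` {h w}" by (rule equiv_class_eq[OF E'])
  qed
  then have F: "?F (E `` {u}) = E' `` {h u}" if "u \<in> Z" for u using UN_equiv_class[OF E] that by blast
  have "?F \<in> Z // E \<rightarrow> Z' // E'"
  proof
    fix C assume "C \<in> Z // E"
    then obtain u where "u \<in> Z" "C = E `` {u}" by (auto elim: quotientE)
    then show "?F C \<in> Z' // E'" using F h by (auto intro: quotientI)
  qed
  moreover have "inj_on ?F (Z // E)"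
  proof (rule inj_onI)
    fix C D assume C: "C \<in> Z // E" and D: "D \<in> Z // E" and eq: "?F C = ?F D"
    obtain u where u: "u \<in> Z" "C = E `` {u}" using C by (auto elim: quotientE)
    obtain w where w: "w \<in> Z" "D = E `` {w}" using D by (auto elim: quotientE)
    have "E' `` {h u} = E' `` {h w}" using eq F u w by simp
    then have "(h u, h w) \<in> E'" using eq_equiv_class[OF _ E' h[OF w(1)]] by blast
    then show "C = D" using iff u w equiv_class_eq[OF E] by blast
  qed
  ultimately show ?thesis using F by blast
qed

section \<open>Automorphisms of the cobracket\<close>

lemma A_BD_group:
  "id \<in> A_BD br r" "\<phi> \<in> A_BD br r \<Longrightarrow> \<psi> \<in> A_BD br r \<Longrightarrow> \<phi> \<circ> \<psi> \<in> A_BD br r"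
  "\<phi> \<in> A_BD br r \<Longrightarrow> inv_into UNIV \<phi> \<in> A_BD br r" "\<phi> \<in> A_BD br r \<Longrightarrow> bij \<phi>"
proof -
  show "id \<in> A_BD br r" by (simp add: A_BD_def lie_aut_id)
  show "\<phi> \<in> A_BD br r \<Longrightarrow> bij \<phi>" by (auto simp: A_BD_def dest: lie_autD(2))
  show "\<phi> \<circ> \<psi> \<in> A_BD br r" if "\<phi> \<in> A_BD br r" "\<psi> \<in> A_BD br r"
    using that by (auto simp: A_BD_def lie_aut_comp tmap_comp lie_autD(1))
  show "inv_into UNIV \<phi> \<in> A_BD br r" if \<phi>: "\<phi> \<in> A_BD br r"
  proof -
    let ?i = "inv_into UNIV \<phi>" and ?d = "cobracket (bc_bracket br) (map_vec to_ac r)"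
    have a: "\<phi> \<in> lie_aut (bc_bracket br)" "\<And>a. tmap \<phi> \<phi> (?d a) = ?d (\<phi> a)" using \<phi> by (auto simp: A_BD_def)
    have ia: "?i \<in> lie_aut (bc_bracket br)" by (rule lie_aut_inv[OF a(1)])
    have i: "\<phi> (?i x) = x" "?i \<circ> \<phi> = id" for x
      using lie_autD(2)[OF a(1)] by (auto simp: fun_eq_iff bij_is_surj surj_f_inv_f bij_is_inj)
    have "tmap ?i ?i (?d x) = ?d (?i x)" for x
    proof -
      have "tmap ?i ?i (?d x) = tmap ?i ?i (tmap \<phi> \<phi> (?d (?i x)))" by (simp add: a(2) i)
      also have "\<dots> = ?d (?i x)"
        by (simp add: tmap_comp[symmetric] lie_autD(1)[OF a(1)] lie_autD(1)[OF ia] i)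
      finally show ?thesis .
    qed
    then show ?thesis using ia by (simp add: A_BD_def)
  qed
qed

lemma A_BD_I:
  assumes "\<phi> \<in> lie_aut (bc_bracket br)" "tmap \<phi> \<phi> (map_vec to_ac r) = map_vec to_ac r"
  shows "\<phi> \<in> A_BD br r"
  using assms cobracket_tmap[OF assms(1) linear_bc_bracket(1)] by (simp add: A_BD_def)

text \<open>This is the interface to the structure theory: two commuting involutions and their joint
  effect on \<open>r\<close>. Roots no longer appear.\<close>

locale quadratic_twist =
  fixes br :: "'k::field_char_0^'n \<Rightarrow> 'k^'n \<Rightarrow> 'k^'n" and r :: "'k^('n \<times> 'n)"
    and \<alpha> :: "'k alg_closure" and chev pihat :: "'k^'n \<Rightarrow> 'k^'n"
  assumes br: "bilinear_map (*s) br"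
    and \<alpha>: "\<alpha> \<noteq> 0" "\<exists>a. \<alpha>\<^sup>2 = to_ac a"
    and aut: "chev \<in> lie_aut br" "pihat \<in> lie_aut br"
    and invol: "chev \<circ> chev = id" "pihat \<circ> pihat = id" "chev \<circ> pihat = pihat \<circ> chev"
    and tmap_r: "tmap (chev \<circ> pihat) (chev \<circ> pihat) r = flip r"
begin

abbreviation "P \<equiv> bc_map (chev \<circ> pihat)"
abbreviation "G \<equiv> Gal (base_field :: 'k alg_closure set)"
abbreviation "r' \<equiv> map_vec to_ac r"

lemma P_eq: "bc_map chev \<circ> bc_map pihat = P" "bc_map pihat \<circ> bc_map chev = P"
  using lie_autD(1)[OF aut(1)] lie_autD(1)[OF aut(2)] by (simp_all add: invol flip: bc_map_comp)

lemma P_P: "P \<circ> P = id"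
proof -
  have "P \<circ> P = bc_map ((chev \<circ> pihat) \<circ> (chev \<circ> pihat))"
    using linear_vec_comp[OF lie_autD(1)[OF aut(1)] lie_autD(1)[OF aut(2)]] by (simp only: bc_map_comp)
  also have "(chev \<circ> pihat) \<circ> (chev \<circ> pihat) = (pihat \<circ> chev) \<circ> (chev \<circ> pihat)" by (simp only: invol(3))
  also have "\<dots> = pihat \<circ> (chev \<circ> chev) \<circ> pihat" by (simp only: o_assoc)
  finally show ?thesis by (simp only: invol(1,2) comp_id bc_map_id)
qed

lemma P_inv: "inv_into UNIV P = P" using P_P inv_unique_comp by blast

lemma P_aut: "P \<in> lie_aut (bc_bracket br)"
  by (intro bc_map_lie_aut[OF br] lie_aut_comp aut)

lemma P_r: "tmap P P r' = flip r'"
  by (simp add: tmap_bc_map tmap_r map_vec_to_ac_simps)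

lemma Gal_alpha: assumes "\<gamma> \<in> G" shows "\<gamma> \<alpha> = \<alpha> \<or> \<gamma> \<alpha> = - \<alpha>"
proof -
  obtain a where "\<alpha>\<^sup>2 = to_ac a" using \<alpha>(2) by blast
  then have "\<gamma> (\<alpha>\<^sup>2) = \<alpha>\<^sup>2" using GalD(5)[OF assms] by (simp add: base_field_def)
  then have "(\<gamma> \<alpha>)\<^sup>2 = \<alpha>\<^sup>2" by (simp add: power2_eq_square GalD(4)[OF assms])
  then show ?thesis by (simp add: power2_eq_iff)
qed

text \<open>This keeps apart the two cases in the definitions of the twist and of the modified
  cocycle.\<close>

lemma neg_alpha: "- \<alpha> \<noteq> \<alpha>" using \<alpha>(1) by simp

lemma hat_eq: "\<gamma> \<in> G \<Longrightarrow> hat_cocycle \<alpha> pihat chev u \<gamma> = (if \<gamma> \<alpha> = \<alpha> then u \<gamma> else u \<gamma> \<circ> P)"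
  by (simp add: hat_cocycle_def Gal_adjoin o_assoc[symmetric] P_eq)

lemma twisted_eq:
  "\<gamma> \<in> G \<Longrightarrow> twisted_action \<alpha> pihat chev \<gamma> \<rho> = (if \<gamma> \<alpha> = \<alpha> then gal_conj \<gamma> \<rho> else P \<circ> gal_conj \<gamma> \<rho> \<circ> P)"
  by (simp add: twisted_action_def v_pi_def Gal_adjoin P_eq P_inv)

lemma gal_conj_P: "\<gamma> \<in> G \<Longrightarrow> gal_conj \<gamma> P = P" by (rule gal_conj_bc_map)

lemma P_cancel: "x \<circ> P \<circ> P = x" "x \<circ> P = y \<circ> P \<longleftrightarrow> x = y"
proof -
  show c: "x \<circ> P \<circ> P = x" for x :: "'k alg_closure^'n \<Rightarrow> 'b" by (simp only: o_assoc[symmetric] P_P comp_id)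
  show "x \<circ> P = y \<circ> P \<longleftrightarrow> x = y" using c by metis
qed

lemma twisted_comp:
  assumes "\<gamma> \<in> G"
  shows "twisted_action \<alpha> pihat chev \<gamma> (\<rho> \<circ> \<sigma>) =
    twisted_action \<alpha> pihat chev \<gamma> \<rho> \<circ> twisted_action \<alpha> pihat chev \<gamma> \<sigma>"
  by (simp add: twisted_eq[OF assms] gal_conj_comp[OF GalD(1)[OF assms]] o_assoc P_cancel)

lemma twisted_id: assumes "\<gamma> \<in> G" shows "twisted_action \<alpha> pihat chev \<gamma> id = id"
  by (simp add: twisted_eq[OF assms] gal_conj_id[OF GalD(1)[OF assms]] P_P)

lemma hat_cocycle_identity:
  assumes "\<gamma> \<in> G" "\<eta> \<in> G" and u: "u (\<gamma> \<circ> \<eta>) = u \<gamma> \<circ> gal_conj \<gamma> (u \<eta>)"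
  shows "hat_cocycle \<alpha> pihat chev u (\<gamma> \<circ> \<eta>) =
    hat_cocycle \<alpha> pihat chev u \<gamma> \<circ> twisted_action \<alpha> pihat chev \<gamma> (hat_cocycle \<alpha> pihat chev u \<eta>)"
proof -
  \<comment> \<open>A composite fixes \<alpha> exactly when both or neither of its factors do. In
    each of the four cases the copies of \<open>P\<close> from \<open>hat_cocycle\<close> and from
    the twist cancel in pairs down to those on the left side, as \<open>P\<close> is an involution
    fixed by the Galois group.\<close>
  have c: "(\<gamma> \<circ> \<eta>) \<alpha> = \<alpha> \<longleftrightarrow> (\<gamma> \<alpha> = \<alpha> \<longleftrightarrow> \<eta> \<alpha> = \<alpha>)"
    using Gal_alpha[OF assms(1)] Gal_alpha[OF assms(2)] Gal_simps(2)[OF assms(1), of \<alpha>] neg_alpha by auto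
  show ?thesis
    unfolding hat_eq[OF assms(1)] hat_eq[OF assms(2)] hat_eq[OF Gal_comp[OF assms(1,2)]]
      twisted_eq[OF assms(1)] c u
    by (simp add: gal_conj_comp[OF GalD(1)[OF assms(1)]] gal_conj_P[OF assms(1)] o_assoc P_cancel)
qed

lemma topspace_krull: "topspace (krull_topology :: ('k alg_closure \<Rightarrow> _) topology) = G"
  by (simp add: krull_topology_def)

text \<open>Evaluation at \<alpha> is a coordinate projection, hence continuous. So the two cosets
  are open, and a cochain can be altered on one of them without losing continuity.\<close>

lemma openin_Gal_value: "openin krull_topology {\<gamma> \<in> G. \<gamma> \<alpha> = c}"
proof -
  have "continuous_map (krull_topology :: ('k alg_closure \<Rightarrow> _) topology) (discrete_topology UNIV) (\<lambda>\<gamma>. \<gamma> \<alpha>)"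
    unfolding krull_topology_def
    by (intro continuous_map_from_subtopology continuous_map_product_projection) simp
  from openin_continuous_map_preimage[OF this, of "{c}"] show ?thesis by (simp add: topspace_krull)
qed

lemma hat_in_Z1: assumes u: "u \<in> Zbar br r \<alpha>" shows "hat_cocycle \<alpha> pihat chev u \<in> Z1_v br r \<alpha> pihat chev"
proof -
  let ?L = "lie_aut (bc_bracket br)" and ?h = "hat_cocycle \<alpha> pihat chev u"
  have uL: "u \<gamma> \<in> ?L" if "\<gamma> \<in> G" for \<gamma> using u that by (auto simp: Zbar_def cocycles_def)
  have cont: "continuous_map krull_topology (discrete_topology ?L) u"
    and coc: "\<And>\<gamma> \<eta>. \<gamma> \<in> G \<Longrightarrow> \<eta> \<in> G \<Longrightarrow> u (\<gamma> \<circ> \<eta>) = u \<gamma> \<circ> gal_conj \<gamma> (u \<eta>)"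
    using u by (auto simp: Zbar_def cocycles_def)
  have hA: "?h \<gamma> \<in> A_BD br r" if g: "\<gamma> \<in> G" for \<gamma>
  proof (cases "\<gamma> \<alpha> = \<alpha>")
    case True
    then have "\<gamma> \<in> Gal (adjoin \<alpha>)" using g by (simp add: Gal_adjoin)
    then have "tmap (u \<gamma>) (u \<gamma>) r' = r'" using u by (auto simp: Zbar_def)
    then show ?thesis using True A_BD_I[OF uL[OF g]] by (simp add: hat_eq[OF g])
  next
    case False
    then have "\<gamma> \<alpha> = - \<alpha>" using Gal_alpha[OF g] by blast
    then have f: "tmap (u \<gamma>) (u \<gamma>) r' = flip r'" using u g by (auto simp: Zbar_def)
    have "tmap (u \<gamma> \<circ> P) (u \<gamma> \<circ> P) r' = r'"
      using lie_autD(1)[OF uL[OF g]] by (simp add: tmap_comp linear_bc_map P_r tmap_flip f)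
    then show ?thesis using False A_BD_I[OF lie_aut_comp[OF uL[OF g] P_aut]] by (simp add: hat_eq[OF g])
  qed
  have "continuous_map krull_topology (discrete_topology (A_BD br r)) ?h"
    unfolding continuous_map_def topspace_krull topspace_discrete_topology
  proof (intro conjI allI impI)
    show "?h \<in> G \<rightarrow> A_BD br r" using hA by blast
    fix U assume "openin (discrete_topology (A_BD br r)) U"
    have o: "openin krull_topology {\<gamma> \<in> G. u \<gamma> \<in> V}" if "V \<subseteq> ?L" for V
      using openin_continuous_map_preimage[OF cont, of V] that by (simp add: topspace_krull)
    \<comment> \<open>Split along the two cosets: on the second one, the condition on
      \<open>u \<gamma> \<circ> P\<close> is a condition on \<open>u \<gamma>\<close>, and every set
      of values is open in the discrete topology.\<close>
    have "{\<gamma> \<in> G. ?h \<gamma> \<in> U} = ({\<gamma> \<in> G. \<gamma> \<alpha> = \<alpha>} \<inter> {\<gamma> \<in> G. u \<gamma> \<in> U \<inter> ?L}) \<union>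
      ({\<gamma> \<in> G. \<gamma> \<alpha> = - \<alpha>} \<inter> {\<gamma> \<in> G. u \<gamma> \<in> {\<phi> \<in> ?L. \<phi> \<circ> P \<in> U}})"
    proof (rule Set.set_eqI)
      fix \<gamma>
      show "\<gamma> \<in> {\<gamma> \<in> G. ?h \<gamma> \<in> U} \<longleftrightarrow> \<gamma> \<in> ({\<gamma> \<in> G. \<gamma> \<alpha> = \<alpha>} \<inter> {\<gamma> \<in> G. u \<gamma> \<in> U \<inter> ?L}) \<union>
        ({\<gamma> \<in> G. \<gamma> \<alpha> = - \<alpha>} \<inter> {\<gamma> \<in> G. u \<gamma> \<in> {\<phi> \<in> ?L. \<phi> \<circ> P \<in> U}})"
        using Gal_alpha[of \<gamma>] neg_alpha uL[of \<gamma>] by (cases "\<gamma> \<alpha> = \<alpha>") (auto simp: hat_eq)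
    qed
    then show "openin krull_topology {\<gamma> \<in> G. ?h \<gamma> \<in> U}"
      by (simp only:) (intro openin_Un openin_Int openin_Gal_value o; blast)
  qed
  moreover have "?h \<in> G \<rightarrow>\<^sub>E A_BD br r" using hA by (auto simp: hat_cocycle_def PiE_def)
  ultimately show ?thesis
    by (simp add: Z1_v_def cocycles_def hat_cocycle_identity[of _ _ u] coc)
qed

text \<open>On the nontrivial coset the \<open>P\<close> that ends the modified
  \<open>u \<gamma>\<close> cancels against the one that begins the twisted \<rho>, and the final
  \<open>P\<close> is common to both sides of the relation.\<close>

lemma hat_cohomologous_iff:
  assumes "u \<in> Zbar br r \<alpha>" "w \<in> Zbar br r \<alpha>"
  shows "(hat_cocycle \<alpha> pihat chev u, hat_cocycle \<alpha> pihat chev w) \<in>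
      cohomologous (twisted_action \<alpha> pihat chev) (A_BD br r) (Z1_v br r \<alpha> pihat chev) \<longleftrightarrow>
    (u, w) \<in> cohomologous gal_conj (A_BD br r) (Zbar br r \<alpha>)"
proof -
  have "hat_cocycle \<alpha> pihat chev w \<gamma> =
      inv_into UNIV \<rho> \<circ> hat_cocycle \<alpha> pihat chev u \<gamma> \<circ> twisted_action \<alpha> pihat chev \<gamma> \<rho> \<longleftrightarrow>
    w \<gamma> = inv_into UNIV \<rho> \<circ> u \<gamma> \<circ> gal_conj \<gamma> \<rho>" if g: "\<gamma> \<in> G" for \<gamma> \<rho>
    by (simp add: hat_eq[OF g] twisted_eq[OF g] o_assoc P_cancel)
  then show ?thesis using assms hat_in_Z1 by (auto simp: cohomologous_def)
qed

lemma hat_induces_injection: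
  "(\<forall>u\<in>Zbar br r \<alpha>. hat_cocycle \<alpha> pihat chev u \<in> Z1_v br r \<alpha> pihat chev) \<and>
    (\<exists>F. F \<in> Hbar br r \<alpha> \<rightarrow> H1_v br r \<alpha> pihat chev \<and>
      (\<forall>u\<in>Zbar br r \<alpha>.
        F (cohomologous gal_conj (A_BD br r) (Zbar br r \<alpha>) `` {u}) =
        cohomologous (twisted_action \<alpha> pihat chev) (A_BD br r) (Z1_v br r \<alpha> pihat chev) ``
          {hat_cocycle \<alpha> pihat chev u}) \<and>
      inj_on F (Hbar br r \<alpha>))"
  unfolding Hbar_def H1_v_def cohomology_def
proof (rule conjI)
  show "\<exists>F. F \<in> Zbar br r \<alpha> // cohomologous gal_conj (A_BD br r) (Zbar br r \<alpha>) \<rightarrow>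
      Z1_v br r \<alpha> pihat chev //
      cohomologous (twisted_action \<alpha> pihat chev) (A_BD br r) (Z1_v br r \<alpha> pihat chev) \<and>
    (\<forall>u\<in>Zbar br r \<alpha>.
      F (cohomologous gal_conj (A_BD br r) (Zbar br r \<alpha>) `` {u}) =
      cohomologous (twisted_action \<alpha> pihat chev) (A_BD br r) (Z1_v br r \<alpha> pihat chev) ``
        {hat_cocycle \<alpha> pihat chev u}) \<and>
    inj_on F (Zbar br r \<alpha> // cohomologous gal_conj (A_BD br r) (Zbar br r \<alpha>))"
  proof (rule quotient_injection[where h = "hat_cocycle \<alpha> pihat chev"])
    show "equiv (Zbar br r \<alpha>) (cohomologous gal_conj (A_BD br r) (Zbar br r \<alpha>))"
      by (rule cohomologous_equiv)
        (simp_all add: A_BD_group gal_conj_comp[OF GalD(1)] gal_conj_id[OF GalD(1)])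
    show "equiv (Z1_v br r \<alpha> pihat chev)
        (cohomologous (twisted_action \<alpha> pihat chev) (A_BD br r) (Z1_v br r \<alpha> pihat chev))"
      by (rule cohomologous_equiv) (simp_all add: A_BD_group twisted_comp twisted_id)
  qed (simp_all add: hat_in_Z1 hat_cohomologous_iff)
qed (simp add: hat_in_Z1)

end

theorem theorem5p11:
  fixes br :: "'k::field_char_0^'n \<Rightarrow> 'k^'n \<Rightarrow> 'k^'n"
    and B :: "'k^'n \<Rightarrow> 'k^'n \<Rightarrow> 'k"
    and h :: "('k^'n) set"
    and \<Gamma> \<Gamma>\<^sub>1 \<Gamma>\<^sub>2 :: "('k^'n \<Rightarrow> 'k) set"
    and Xr :: "('k^'n \<Rightarrow> 'k) \<Rightarrow> 'k^'n"
    and \<tau> \<pi> :: "('k^'n \<Rightarrow> 'k) \<Rightarrow> ('k^'n \<Rightarrow> 'k)"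
    and r\<^sub>h r :: "'k^('n \<times> 'n)"
    and chev pihat :: "'k^'n \<Rightarrow> 'k^'n"
    and \<alpha> :: "'k alg_closure"
  assumes alpha: "\<alpha> \<noteq> 0" "\<exists>a. a \<noteq> 0 \<and> \<alpha>\<^sup>2 = to_ac a \<and> \<not> (\<exists>b. a = b\<^sup>2)"
    and lie: "simple_lie br"
    and pin: "pinning br h \<Gamma> Xr"
    and form: "invariant_form br B" "form_from_Q br h \<Gamma> Xr B"
    and root_vecs: "root_vectors br h B Xr"
    and quadruple: "admissible_quadruple br h B \<Gamma> Xr \<Gamma>\<^sub>1 \<Gamma>\<^sub>2 \<tau> r\<^sub>h"
    and compatible: "tau_compatible br h Xr \<Gamma>\<^sub>1 \<tau>"
    and r: "r = r_BD br h \<Gamma> Xr \<Gamma>\<^sub>1 \<tau> r\<^sub>h"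
    and chev: "is_chevalley_aut br h \<Gamma> Xr chev"
    and nonempty: "Hbar br r \<alpha> \<noteq> {}"
    and diagram: "diagram_aut B h \<Gamma> \<pi>" "\<forall>\<beta>\<in>\<Gamma>. \<pi> (\<pi> \<beta>) = \<beta>"
    and pihat: "is_pi_hat br h \<Gamma> Xr \<pi> pihat"
    and swap: "\<pi> ` \<Gamma>\<^sub>1 = \<Gamma>\<^sub>2" "\<pi> ` \<Gamma>\<^sub>2 = \<Gamma>\<^sub>1"
    and conj: "\<forall>\<beta>\<in>\<Gamma>\<^sub>2. \<pi> (\<tau> (inv_into \<Gamma> \<pi> \<beta>)) = inv_into \<Gamma>\<^sub>1 \<tau> \<beta>"
    and cartan_part: "tmap pihat pihat r\<^sub>h = flip r\<^sub>h"
  shows "(\<forall>u\<in>Zbar br r \<alpha>. hat_cocycle \<alpha> pihat chev u \<in> Z1_v br r \<alpha> pihat chev) \<and>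
    (\<exists>F. F \<in> Hbar br r \<alpha> \<rightarrow> H1_v br r \<alpha> pihat chev \<and>
      (\<forall>u\<in>Zbar br r \<alpha>.
        F (cohomologous gal_conj (A_BD br r) (Zbar br r \<alpha>) `` {u}) =
        cohomologous (twisted_action \<alpha> pihat chev) (A_BD br r) (Z1_v br r \<alpha> pihat chev) ``
          {hat_cocycle \<alpha> pihat chev u}) \<and>
      inj_on F (Hbar br r \<alpha>))"
proof -
  have q: "\<Gamma>\<^sub>1 \<subseteq> \<Gamma>" "\<Gamma>\<^sub>2 \<subseteq> \<Gamma>" "bij_betw \<tau> \<Gamma>\<^sub>1 \<Gamma>\<^sub>2" "r\<^sub>h \<in> tensor_square h" "r\<^sub>h + flip r\<^sub>h = Omega_h br h B Xr"
    using quadruple by (auto simp: admissible_quadruple_def)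
  have bij: "bij_betw \<pi> \<Gamma> \<Gamma>" using diagram(1) by (simp add: diagram_aut_def)
  interpret bd: bd_setup br B h \<Gamma> Xr r\<^sub>h chev \<Gamma>\<^sub>1 \<Gamma>\<^sub>2 \<tau> \<pi> pihat
    by unfold_locales
      (use lie pin form root_vecs q chev compatible bij diagram(2) pihat swap conj cartan_part in auto)
  interpret quadratic_twist br r \<alpha> chev pihat
  proof
    show "bilinear_map (*s) br" using lie by (simp add: simple_lie_def lie_bracket_def)
    show "\<exists>a. \<alpha>\<^sup>2 = to_ac a" using alpha(2) by blast
    show "tmap (chev \<circ> pihat) (chev \<circ> pihat) r = flip r"
      unfolding r bd.\<psi>_def[symmetric] by (rule bd.tmap_\<psi>_r_BD)
  qed (rule alpha(1) bd.chev_aut bd.pihat_aut bd.chev_chev bd.pihat_pihat bd.chev_pihat)+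
  show ?thesis by (rule hat_induces_injection)
qed

end
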